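(* Let $f\in\mathscr{E}'(\mathbb{T})$ and let $I\subset\mathbb{T}$ be a closed interval such that $\mathop{\rm supp} f\subset\mathscr{R}_2(I)$ and there is no closed interval $I'\subsetneq I$ with $\mathop{\rm supp} f\subset\mathscr{R}_2(I')$. Assume $I\subset(-\pi/2,\pi/2)$ and $|I|<\pi/2$. If $\mathop{\rm supp} f\ast f^\sharp\subset\{0,\pi\}$, then $\mathop{\rm supp} f\subset\{\inf I,\ \sup I,\ \pi+\inf I,\ \pi+\sup I\}$, and moreover there exist distributions $\mu,\nu\in\mathscr{E}'(\mathbb{T})$, each supported at a single point, such that $f=\mu+S_\pi\mu+\nu-S_\pi\nu$.
   Context: $\mathbb{T}=\mathbb{R}/2\pi\mathbb{Z}$ and $\mathscr{E}'(\mathbb{T})$ is the space of distributions on $\mathbb{T}$. For $y\in\mathbb{T}$ the shift $S_y$ is defined by $(S_yf)(\omega)=f(\omega-y)$ in the sense of distributions. $f^\sharp$ is defined by $f^\sharp(\omega)=f(-\omega)$. For $I\subset\mathbb{T}$, $\mathscr{R}_2(I)=I\cup S_\pi I$. A closed interval $I\subset(-\pi/2,\pi/2)$ is $[\inf I,\sup I]$ with $|I|=\sup I-\inf I$. *)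

theory Defs
  imports "HOL-Analysis.Analysis"
begin

text \<open>The torus T = R/2piZ is modelled by 2pi-periodic objects on the real line.
Test functions: real-valued, 2pi-periodic, C-infinity functions on R.
A (complex-valued) distribution on T is a real-linear map from test functions to
complex numbers satisfying the standard continuity estimate
|T phi| <= C * sum_{k<=N} sup |phi^(k)|.  (A complex-linear functional on complex
test functions is the same thing as a real-linear one on real test functions.)
Since T is compact, E'(T) = D'(T).\<close>

definition test_fun :: "(real \<Rightarrow> real) \<Rightarrow> bool" where
  "test_fun \<phi> \<longleftrightarrow> (\<forall>k x. ((deriv ^^ k) \<phi>) differentiable (at x)) \<and> (\<forall>x. \<phi> (x + 2 * pi) = \<phi> x)"

definition seminorm :: "nat \<Rightarrow> (real \<Rightarrow> real) \<Rightarrow> real" where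
  "seminorm k \<phi> = Sup (range (\<lambda>x. \<bar>(deriv ^^ k) \<phi> x\<bar>))"

definition distribution :: "((real \<Rightarrow> real) \<Rightarrow> complex) \<Rightarrow> bool" where
  "distribution T \<longleftrightarrow>
     (\<forall>\<phi> \<psi> (a::real) (b::real). test_fun \<phi> \<longrightarrow> test_fun \<psi> \<longrightarrow>
        T (\<lambda>x. a * \<phi> x + b * \<psi> x) = of_real a * T \<phi> + of_real b * T \<psi>) \<and>
     (\<exists>C N. \<forall>\<phi>. test_fun \<phi> \<longrightarrow> norm (T \<phi>) \<le> C * (\<Sum>k\<le>N. seminorm k \<phi>))"

text \<open>Subsets of T are represented as 2pi-periodic subsets of R: per A is the preimage
under R -> T of the image of A.\<close>

definition per :: "real set \<Rightarrow> real set" where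
  "per A = {t. \<exists>k::int. t + 2 * pi * of_int k \<in> A}"

definition dsupp :: "((real \<Rightarrow> real) \<Rightarrow> complex) \<Rightarrow> real set" where
  "dsupp T = {x. \<forall>e>0. \<exists>\<phi>. test_fun \<phi> \<and>
       (\<forall>t. \<phi> t \<noteq> 0 \<longrightarrow> (\<exists>k::int. \<bar>t - x - 2 * pi * of_int k\<bar> < e)) \<and> T \<phi> \<noteq> 0}"

text \<open>Shift: (S_y f)(w) = f(w - y), i.e. <S_y f, phi> = <f, phi(. + y)>.\<close>

definition dshift :: "real \<Rightarrow> ((real \<Rightarrow> real) \<Rightarrow> complex) \<Rightarrow> ((real \<Rightarrow> real) \<Rightarrow> complex)" where
  "dshift y T = (\<lambda>\<phi>. T (\<lambda>x. \<phi> (x + y)))"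

definition dreflect :: "((real \<Rightarrow> real) \<Rightarrow> complex) \<Rightarrow> ((real \<Rightarrow> real) \<Rightarrow> complex)" where
  "dreflect T = (\<lambda>\<phi>. T (\<lambda>x. \<phi> (- x)))"

text \<open>Convolution on T: <f * g, phi> = <f_x, <g_y, phi(x + y)>>, with f extended
complex-linearly to the complex-valued test function x |-> <g_y, phi(x+y)>.\<close>

definition dconv :: "((real \<Rightarrow> real) \<Rightarrow> complex) \<Rightarrow> ((real \<Rightarrow> real) \<Rightarrow> complex) \<Rightarrow> ((real \<Rightarrow> real) \<Rightarrow> complex)" where
  "dconv F G = (\<lambda>\<phi>. F (\<lambda>x. Re (G (\<lambda>y. \<phi> (x + y)))) + \<i> * F (\<lambda>x. Im (G (\<lambda>y. \<phi> (x + y)))))"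

definition R2 :: "real \<Rightarrow> real \<Rightarrow> real set" where
  "R2 a b = per ({a..b} \<union> {a + pi..b + pi})"

end

theory Submission
  imports Defs "HOL-Complex_Analysis.Complex_Analysis" "HOL-Real_Asymp.Real_Asymp"
    "HOL-Computational_Algebra.Fundamental_Theorem_Algebra"
begin

text \<open>Split \<open>f\<close> into its \<open>\<pi>\<close>-periodic and \<open>\<pi>\<close>-antiperiodic halves and cut each of them off to a neighbourhood of
  \<open>[a, b]\<close>. Because \<open>b - a < \<pi> / 2\<close>, the contributions of \<open>f * f\<^sup>\<sharp>\<close> near \<open>0\<close> and near \<open>\<pi>\<close> do not overlap, so each
  cut-off half \<open>\<mu>\<close> satisfies: \<open>\<mu> * \<mu>\<^sup>\<sharp>\<close> is supported at \<open>0\<close>. In terms of the entire function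
  \<open>F(z) = \<Sum> m\<^sub>n z\<^sup>n / n!\<close> built from the moments \<open>m\<^sub>n = \<langle>\<mu>, x\<^sup>n\<rangle>\<close> this says that \<open>F(z) F(-z)\<close> is a polynomial. As \<open>F\<close>
  has exponential type, dividing out its finitely many zeros and applying the Borel-Caratheodory estimate to
  the logarithm gives \<open>F(z) = Q(z) exp(c z)\<close>; polynomial growth of \<open>F\<close> along the imaginary axis makes \<open>c\<close> real.
  Hence \<open>\<mu>\<close> has the same moments as a combination of derivatives of the Dirac measure at \<open>c\<close>, and density of
  polynomials in \<open>C\<^sup>N\<close> makes the two equal.\<close>

section \<open>Entire functions of exponential type\<close>

text \<open>Write \<open>f = f1 + S_pi f2\<close> with both pieces near \<open>[a, b]\<close>, and
  \<open>'\<close> for reflection. Near \<open>0\<close> the autocorrelation is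
  \<open>f1 * f1' + f2 * f2'\<close>, a sum of products from which no single factor can be
  extracted; near \<open>pi\<close> it is the translate of \<open>f1 * f2' + f2 * f1'\<close>.
  Adding or subtracting the two gives \<open>(f1 + f2) * (f1 + f2)'\<close> and
  \<open>(f1 - f2) * (f1 - f2)'\<close>, which is why the halves under \<open>S_pi\<close> are
  treated instead of \<open>f\<close>. Moments replace Fourier coefficients because a distribution
  living in a short window can be paired with powers of a coordinate, and they determine an entire
  function, not only its values at the integers. Reflection involves no conjugation, so the second
  factor is \<open>F(-z)\<close>: zeros of a nonzero \<open>F\<close> are zeros of a polynomial,
  hence finite in number. A nonreal \<open>c\<close> has to be ruled out separately, since
  \<open>exp (c z)\<close> then still has exponential type but is the transform of no compactly
  supported distribution. Minimality of \<open>[a, b]\<close> acts at the end: the two points found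
  span an interval that must be all of it.\<close>

lemma Borel_Caratheodory_half:
  fixes h :: "complex \<Rightarrow> complex"
  assumes holh: "h holomorphic_on UNIV" and h0: "h 0 = 0"
    and Re_less: "\<And>z. norm z < R \<Longrightarrow> Re (h z) < M"
    and R: "R > 0" and z: "norm z \<le> R / 2"
  shows "norm (h z) \<le> 2 * M"
proof -
  have M: "M > 0" using Re_less[of 0] R h0 by simp
  \<comment> \<open>The map sending \<open>u\<close> to \<open>u / (2 * M - u)\<close> takes the
    half-plane \<open>Re u < M\<close> into the unit disc and fixes \<open>0\<close>, so Schwarz's
    lemma applies to \<open>g\<close>. At radius \<open>R / 2\<close> it yields
    \<open>2 * norm (h z) \<le> norm (2 * M - h z)\<close>, whence the bound
    \<open>2 * M\<close>.\<close>
  define g where "g = (\<lambda>w. h (of_real R * w) / (of_real (2 * M) - h (of_real R * w)))"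
  have less: "norm (h w) < norm (of_real (2 * M) - h w) \<and> of_real (2 * M) - h w \<noteq> 0"
    if "norm w < R" for w
  proof -
    have "Re (h w) < M" using Re_less that by blast
    have *: "(Re (h w))\<^sup>2 < (2 * M - Re (h w))\<^sup>2"
    proof -
      have "(2 * M - Re (h w))\<^sup>2 - (Re (h w))\<^sup>2 = 4 * M * (M - Re (h w))"
        by (simp add: power2_eq_square algebra_simps)
      moreover have "4 * M * (M - Re (h w)) > 0" using M \<open>Re (h w) < M\<close> by simp
      ultimately show ?thesis by linarith
    qed
    then have "norm (h w) < norm (of_real (2 * M) - h w)"
      by (simp add: cmod_def real_sqrt_less_iff)
    then show ?thesis by (metis norm_ge_zero norm_zero not_less)
  qed
  have nR: "norm (of_real R * w) < R" if "norm w < 1" for w :: complex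
    using that R by (simp add: norm_mult)
  have holg: "g holomorphic_on ball 0 1"
    unfolding g_def using less nR
    by (intro holomorphic_intros holomorphic_on_compose_gen[OF _ holh, unfolded o_def]) auto
  have "norm (g w) < 1" if "norm w < 1" for w
    using less[OF nR[OF that]] by (simp add: g_def norm_divide divide_less_eq)
  moreover have "g 0 = 0" by (simp add: g_def h0)
  ultimately have "norm (g (z / of_real R)) \<le> norm (z / of_real R)"
    using Schwarz_Lemma(1)[OF holg, of "z / of_real R"] z R
    by (auto simp: norm_divide divide_less_eq)
  then have "norm (g (z / of_real R)) \<le> 1 / 2"
    using z R order_trans[of _ "norm z / R" "1 / 2"] by (simp add: norm_divide divide_le_eq)
  moreover have "g (z / of_real R) = h z / (of_real (2 * M) - h z)"
    using R by (simp add: g_def)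
  moreover have "norm z < R" using z R by linarith
  ultimately have "norm (h z) \<le> norm (of_real (2 * M) - h z) / 2"
    using less[of z] by (simp add: norm_divide divide_le_eq)
  also have "\<dots> \<le> (2 * M + norm (h z)) / 2"
    using norm_triangle_ineq4[of "of_real (2 * M)" "h z"] M by (simp add: norm_mult)
  finally show ?thesis by simp
qed

text \<open>The growth of \<open>F\<close> controls only the real part of its logarithm. The
  preceding estimate on a disc of twice the radius passes this to the modulus, and an entire
  function of linear growth is affine by Liouville.\<close>

lemma zero_free_exponential_type:
  fixes F :: "complex \<Rightarrow> complex"
  assumes holF: "F holomorphic_on UNIV" and nz: "\<And>z. F z \<noteq> 0"
    and bound: "\<And>z. norm (F z) \<le> A * exp (B * norm z)" and B: "B \<ge> 0"
  shows "\<exists>d c. \<forall>z. F z = d * exp (c * z)"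
proof -
  obtain h where h: "h holomorphic_on UNIV" "\<And>z. F z = exp (h z)"
    using simply_connected_eq_holomorphic_log[of UNIV] holF nz
      convex_imp_simply_connected[of "UNIV :: complex set"] by auto
  have A: "A > 0" using bound[of 0] nz[of 0] less_le_trans[of 0 "norm (F 0)" A] by simp
  define H where "H = (\<lambda>z. h z - h 0)"
  have holH: "H holomorphic_on UNIV" unfolding H_def by (intro holomorphic_intros h)
  define a where "a = \<bar>ln A - Re (h 0)\<bar>"
  have Re_H: "Re (H z) \<le> a + B * norm z" for z
  proof -
    have "exp (Re (h z)) \<le> exp (ln A + B * norm z)"
      using bound[of z] A by (simp add: h(2) norm_exp_eq_Re exp_add)
    then show ?thesis by (simp add: H_def a_def)
  qed
  have H_bound: "norm (H z) \<le> (2 * a + 4 * B + 2) * norm z ^ 1" if "1 \<le> norm z" for z :: complex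
  proof -
    \<comment> \<open>The summand \<open>1\<close> makes the bound on the real part strict.
      Restricting to \<open>1 \<le> norm z\<close> lets all constants be absorbed into the linear
      term.\<close>
    have "norm (H z) \<le> 2 * (a + B * (2 * norm z) + 1)"
    proof (rule Borel_Caratheodory_half[OF holH, of "2 * norm z"])
      fix w :: complex assume "norm w < 2 * norm z"
      then have "B * norm w \<le> B * (2 * norm z)" using B by (intro mult_left_mono) auto
      then show "Re (H w) < a + B * (2 * norm z) + 1" using Re_H[of w] by linarith
    qed (use that in \<open>auto simp: H_def\<close>)
    also have "\<dots> \<le> (2 * a + 4 * B + 2) * norm z"
    proof -
      have "(2 * a + 2) * 1 \<le> (2 * a + 2) * norm z"
        using that by (intro mult_left_mono) (auto simp: a_def)
      then show ?thesis by (simp add: algebra_simps)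
    qed
    finally show ?thesis by simp
  qed
  have "H z = deriv H 0 * z" for z
    using Liouville_polynomial[OF holH H_bound, where \<xi> = z] by (simp add: H_def)
  then have "F z = exp (h 0) * exp (deriv H 0 * z)" for z
    by (metis H_def add.commute diff_add_cancel exp_add h(2))
  then show ?thesis by blast
qed

text \<open>Licenses cancelling a linear factor from an identity between continuous functions: at
  the zero of the factor the value is recovered as a limit.\<close>

lemma continuous_eq_zero_off_point:
  fixes h :: "complex \<Rightarrow> complex"
  assumes "continuous_on UNIV h" "\<And>z. (z - w) * h z = 0"
  shows "h z = 0"
proof (cases "z = w")
  case True
  have "(h \<longlongrightarrow> h w) (at w)"
    using assms(1) by (simp add: continuous_on_eq_continuous_at isContD)
  moreover have "\<forall>\<^sub>F z in at w. h z = 0"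
    using assms(2) by (intro eventually_at_filter[THEN iffD2] always_eventually) auto
  then have "(h \<longlongrightarrow> 0) (at w)" by (simp add: tendsto_eventually)
  ultimately show ?thesis using True tendsto_unique at_neq_bot by blast
qed (use assms(2)[of z] in auto)

text \<open>A zero \<open>w\<close> of \<open>F\<close> contributes the factor \<open>z - w\<close>
  to \<open>F(z)\<close> and \<open>- z - w\<close> to \<open>F(- z)\<close>, so removing it from
  \<open>F\<close> removes two linear factors from \<open>P\<close>; this also works for
  \<open>w = 0\<close>. Induction on the degree of \<open>P\<close> ends with a zero-free
  \<open>F\<close>. The constant \<open>A\<close> changes on the way while \<open>B\<close> does
  not, so only \<open>A\<close> is generalised.\<close>

lemma exponential_type_even_product_poly:
  fixes F :: "complex \<Rightarrow> complex"
  assumes "F holomorphic_on UNIV" and "\<And>z. norm (F z) \<le> A * exp (B * norm z)" and B: "B \<ge> 0"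
    and "\<And>z. F z * F (- z) = poly P z" and "P \<noteq> 0"
  shows "\<exists>Q c. \<forall>z. F z = poly Q z * exp (c * z)"
  using assms
proof (induction "degree P" arbitrary: P F A rule: less_induct)
  case less
  note holF = less.prems(1) and bound = less.prems(2) and FP = less.prems(4)
  show ?case
  proof (cases "\<exists>w. F w = 0")
    case False
    then obtain d c where "\<forall>z. F z = d * exp (c * z)"
      using zero_free_exponential_type[OF holF _ bound B] by blast
    then have "\<forall>z. F z = poly [:d:] z * exp (c * z)" by simp
    then show ?thesis by blast
  next
    case True
    then obtain w where w: "F w = 0" by blast
    define G where "G = (\<lambda>z. if z = w then deriv F w else (F z - F w) / (z - w))"
    have holG: "G holomorphic_on UNIV"
      unfolding G_def using pole_lemma[OF holF, of w] by simp
    have FG: "F z = (z - w) * G z" for z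
      using w by (simp add: G_def)
    have contG: "continuous_on UNIV G" and contG': "continuous_on UNIV (\<lambda>z. G (- z))"
      using holomorphic_on_imp_continuous_on[OF holG] continuous_on_compose2[OF _ continuous_on_minus[OF continuous_on_id]]
      by blast+
    have "poly P w = 0" using FP[of w] w by simp
    then obtain P1 where P1: "P = [:- w, 1:] * P1" by (auto simp: poly_eq_0_iff_dvd)
    have "poly P1 z - (- z - w) * (G z * G (- z)) = 0" for z
    proof (rule continuous_eq_zero_off_point[where h = "\<lambda>z. poly P1 z - (- z - w) * (G z * G (- z))" and w = w])
      show "(z - w) * (poly P1 z - (- z - w) * (G z * G (- z))) = 0" for z
        using FP[of z] FG[of z] FG[of "- z"] by (simp add: P1 algebra_simps)
    qed (intro continuous_intros contG contG')
    then have P1_eq: "poly P1 z = (- z - w) * (G z * G (- z))" for z by simp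
    then have "poly P1 (- w) = 0" by simp
    then obtain P2 where P2: "P1 = [:w, 1:] * P2" by (auto simp: poly_eq_0_iff_dvd)
    \<comment> \<open>The minus sign appears because the factor coming from \<open>F(- z)\<close> is
      \<open>- (z + w)\<close>, whereas \<open>P2\<close> is defined by dividing by
      \<open>z + w\<close>.\<close>
    have "poly (- P2) z - G z * G (- z) = 0" for z
    proof (rule continuous_eq_zero_off_point[where h = "\<lambda>z. poly (- P2) z - G z * G (- z)" and w = "- w"])
      show "(z - - w) * (poly (- P2) z - G z * G (- z)) = 0" for z
        using P1_eq[of z] by (simp add: P2) algebra
    qed (intro continuous_intros contG contG')
    then have GP: "G z * G (- z) = poly (- P2) z" for z by simp
    have nz: "P1 \<noteq> 0" "P2 \<noteq> 0" using less.prems(5) P1 P2 by auto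
    have deg: "degree (- P2) < degree P"
      using nz unfolding P1 P2 by (subst degree_mult_eq; (subst degree_mult_eq)?) (auto simp del: mult_pCons_left)
    have "compact (G ` cball w 1)"
      using contG by (intro compact_continuous_image) (auto intro: continuous_on_subset)
    then obtain b where b: "\<And>z. z \<in> cball w 1 \<Longrightarrow> norm (G z) \<le> b"
      using compact_imp_bounded bounded_iff by (metis image_eqI)
    \<comment> \<open>Dividing by \<open>z - w\<close> cannot increase the modulus outside the unit
      disc around \<open>w\<close>, and inside that disc \<open>G\<close> is bounded by
      compactness.\<close>
    have Gbound: "norm (G z) \<le> (\<bar>A\<bar> + \<bar>b\<bar>) * exp (B * norm z)" for z
    proof (cases "z \<in> cball w 1")
      case True
      have "\<bar>b\<bar> * 1 \<le> (\<bar>A\<bar> + \<bar>b\<bar>) * exp (B * norm z)"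
        using B by (intro mult_mono) auto
      then show ?thesis using b[OF True] by linarith
    next
      case False
      then have "1 \<le> norm (z - w)" by (simp add: dist_norm norm_minus_commute)
      then have "norm (G z) \<le> norm (F z)"
        unfolding FG norm_mult by (metis mult.left_neutral mult_right_mono norm_ge_zero)
      also have "\<dots> \<le> A * exp (B * norm z)" by (rule bound)
      also have "\<dots> \<le> (\<bar>A\<bar> + \<bar>b\<bar>) * exp (B * norm z)" by (intro mult_right_mono) auto
      finally show ?thesis .
    qed
    obtain Q c where Q: "\<forall>z. G z = poly Q z * exp (c * z)"
      using less.hyps[OF deg holG Gbound B GP] nz by auto
    then have "\<forall>z. F z = poly ([:- w, 1:] * Q) z * exp (c * z)"
      by (simp add: FG algebra_simps)
    then show ?thesis by blast
  qed
qed

text \<open>The second factor in the hypothesis is the power series \<open>M(-z)\<close>.\<close>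

lemma fps_exponential_type_even_product_poly:
  fixes M :: "complex fps"
  assumes bound: "\<And>n. norm (fps_nth M n) \<le> C * K ^ n / fact n" and K: "K \<ge> 0"
    and prod: "M * Abs_fps (\<lambda>n. (- 1) ^ n * fps_nth M n) = fps_of_poly P"
  shows "fps_conv_radius M = \<infinity>" and "\<exists>Q c. M = fps_of_poly Q * fps_exp c"
proof -
  let ?N = "Abs_fps (\<lambda>n. (- 1) ^ n * fps_nth M n)"
  have le: "norm (fps_nth M n * z ^ n) \<le> C * ((K * norm z) ^ n /\<^sub>R fact n)" for n z
    using mult_right_mono[OF bound[of n], of "norm z ^ n"]
    by (simp add: norm_mult norm_power power_mult_distrib field_simps)
  have sums: "(\<lambda>n. C * ((K * norm z) ^ n /\<^sub>R fact n)) sums (C * exp (K * norm z))" for z :: complex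
    by (intro sums_mult exp_converges)
  have summ: "summable (\<lambda>n. norm (fps_nth M n * z ^ n))" for z
    by (rule summable_comparison_test'[OF sums_summable[OF sums[of z]], of 0]) (simp only: real_norm_def abs_norm_cancel le)
  show rad: "fps_conv_radius M = \<infinity>"
    unfolding fps_conv_radius_def
    by (rule conv_radius_inftyI'', rule summable_norm_cancel, rule summ)
  define F where "F = eval_fps M"
  have holF: "F holomorphic_on UNIV"
    unfolding F_def using rad by (intro holomorphic_on_eval_fps) auto
  have Fb: "norm (F z) \<le> C * exp (K * norm z)" for z
  proof -
    have "norm (F z) \<le> (\<Sum>n. norm (fps_nth M n * z ^ n))"
      unfolding F_def eval_fps_def by (rule summable_norm[OF summ])
    also have "\<dots> \<le> (\<Sum>n. C * ((K * norm z) ^ n /\<^sub>R fact n))"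
      by (intro suminf_le le summ sums_summable[OF sums])
    also have "\<dots> = C * exp (K * norm z)" using sums sums_unique by metis
    finally show ?thesis .
  qed
  have "summable (\<lambda>n. norm (fps_nth ?N n * z ^ n))" for z
    using summ[of z] by (simp add: norm_mult norm_power)
  then have radN: "fps_conv_radius ?N = \<infinity>"
    unfolding fps_conv_radius_def
    by (intro conv_radius_inftyI'') (rule summable_norm_cancel)
  have FN: "eval_fps ?N z = F (- z)" for z
    by (simp add: F_def eval_fps_def power_minus[of z] mult_ac)
  have FP: "F z * F (- z) = poly P z" for z
    using arg_cong[OF prod, of "\<lambda>M. eval_fps M z"] rad radN FN
    by (simp add: eval_fps_mult F_def)
  show "\<exists>Q c. M = fps_of_poly Q * fps_exp c"
  proof (cases "P = 0")
    \<comment> \<open>The degree induction needs a nonzero \<open>P\<close>. If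
      \<open>P = 0\<close>, then \<open>M\<close> vanishes because formal power series have no zero
      divisors.\<close>
    case True
    then have "M * ?N = 0" using prod by simp
    then have "M = 0 \<or> ?N = 0" by simp
    then have "M = 0" by (auto simp: fps_eq_iff)
    then show ?thesis by (intro exI[of _ 0]) simp
  next
    case False
    obtain Q c where Q: "\<And>z. F z = poly Q z * exp (c * z)"
      using exponential_type_even_product_poly[OF holF Fb K FP False] by blast
    have "F has_fps_expansion M"
      unfolding F_def using rad by (intro eval_fps_has_fps_expansion) simp
    moreover have "(\<lambda>z. eval_fps (fps_of_poly Q) z * exp (c * z)) has_fps_expansion fps_of_poly Q * fps_exp c"
      by (intro has_fps_expansion_mult eval_fps_has_fps_expansion has_fps_expansion_exp) simp
    moreover have "(\<lambda>z. eval_fps (fps_of_poly Q) z * exp (c * z)) = F" using Q by auto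
    ultimately show ?thesis using fps_expansion_unique_complex by metis
  qed
qed

section \<open>Smooth functions\<close>

text \<open>Regularity is separated from periodicity because monomials, antiderivatives and the
  staircase functions below are not periodic.\<close>

definition smooth :: "(real \<Rightarrow> real) \<Rightarrow> bool" where
  "smooth \<phi> \<longleftrightarrow> (\<forall>k x. ((deriv ^^ k) \<phi>) differentiable (at x))"

lemma test_fun_iff: "test_fun \<phi> \<longleftrightarrow> smooth \<phi> \<and> (\<forall>x. \<phi> (x + 2 * pi) = \<phi> x)"
  by (simp add: test_fun_def smooth_def)

lemma smooth_has_derivative:
  assumes "smooth \<phi>"
  shows "((deriv ^^ k) \<phi> has_real_derivative (deriv ^^ Suc k) \<phi> x) (at x)"
  using assms DERIV_deriv_iff_real_differentiable[of "(deriv ^^ k) \<phi>" x]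
  by (simp add: smooth_def)

lemma higher_deriv_deriv: "(deriv ^^ k) (deriv \<phi>) = (deriv ^^ Suc k) \<phi>"
  by (metis comp_apply funpow_Suc_right)

lemma smooth_deriv: "smooth \<phi> \<Longrightarrow> smooth (deriv \<phi>)"
  unfolding smooth_def higher_deriv_deriv by blast

lemma smooth_higher_deriv: "smooth \<phi> \<Longrightarrow> smooth ((deriv ^^ k) \<phi>)"
  by (induction k) (auto intro: smooth_deriv)

text \<open>All iterated derivatives stay in \<open>S\<close>, so exhibiting a set closed under
  differentiation proves smoothness without any formula for the derivatives.\<close>

lemma smooth_coinduct:
  assumes "g \<in> S" and step: "\<And>g. g \<in> S \<Longrightarrow> \<exists>g'\<in>S. \<forall>x. (g has_real_derivative g' x) (at x)"
  shows "smooth g"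
proof -
  have "(deriv ^^ k) g \<in> S" for k
  proof (induction k)
    case (Suc k)
    then obtain g' where g': "g' \<in> S" "\<And>x. ((deriv ^^ k) g has_real_derivative g' x) (at x)"
      using step by blast
    then have "(deriv ^^ Suc k) g = g'" using DERIV_imp_deriv by fastforce
    then show ?case using g'(1) by simp
  qed (use assms(1) in simp)
  then show ?thesis unfolding smooth_def using step real_differentiable_def by blast
qed

inductive_set generated_algebra :: "(real \<Rightarrow> real) set \<Rightarrow> (real \<Rightarrow> real) set" for A where
  gen: "g \<in> A \<Longrightarrow> g \<in> generated_algebra A"
| const: "(\<lambda>x. c) \<in> generated_algebra A"
| add: "g \<in> generated_algebra A \<Longrightarrow> h \<in> generated_algebra A \<Longrightarrow> (\<lambda>x. g x + h x) \<in> generated_algebra A"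
| mult: "g \<in> generated_algebra A \<Longrightarrow> h \<in> generated_algebra A \<Longrightarrow> (\<lambda>x. g x * h x) \<in> generated_algebra A"

text \<open>By the sum and product rules, closure under differentiation only has to be checked on
  generators. The derivative of a generator may be any element of the algebra, which accommodates
  families that refer to one another, such as sine and cosine.\<close>

lemma smooth_alg:
  assumes "g \<in> generated_algebra A" and "\<And>g. g \<in> A \<Longrightarrow> \<exists>g'\<in>generated_algebra A. \<forall>x. (g has_real_derivative g' x) (at x)"
  shows "smooth g"
proof (rule smooth_coinduct[OF assms(1)])
  fix g assume "g \<in> generated_algebra A"
  then show "\<exists>g'\<in>generated_algebra A. \<forall>x. (g has_real_derivative g' x) (at x)"
  proof induction
    case (gen g) then show ?case by (rule assms(2))
  next
    case (const c)
    then show ?case by (intro bexI[of _ "\<lambda>x. 0"]) (auto intro: generated_algebra.const)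
  next
    case (add g h)
    then obtain g' h' where "g' \<in> generated_algebra A" "h' \<in> generated_algebra A"
      "\<And>x. (g has_real_derivative g' x) (at x)" "\<And>x. (h has_real_derivative h' x) (at x)" by blast
    then show ?case
      by (intro bexI[of _ "\<lambda>x. g' x + h' x"]) (auto intro: generated_algebra.add DERIV_add)
  next
    case (mult g h)
    then obtain g' h' where "g' \<in> generated_algebra A" "h' \<in> generated_algebra A"
      "\<And>x. (g has_real_derivative g' x) (at x)" "\<And>x. (h has_real_derivative h' x) (at x)" by blast
    then show ?case using mult.hyps
      by (intro bexI[of _ "\<lambda>x. g' x * h x + h' x * g x"]) (auto intro!: generated_algebra.add generated_algebra.mult DERIV_mult)
  qed
qed

lemma smooth_alg_smooth:
  assumes "g \<in> generated_algebra (Collect smooth)" shows "smooth g"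
proof (rule smooth_alg[OF assms])
  fix g assume "g \<in> Collect smooth"
  then show "\<exists>g'\<in>generated_algebra (Collect smooth). \<forall>x. (g has_real_derivative g' x) (at x)"
    using smooth_has_derivative[of g 0] smooth_deriv[of g]
    by (intro bexI[of _ "deriv g"]) (auto intro: generated_algebra.gen)
qed

lemma smooth_const: "smooth (\<lambda>x. c)"
  by (intro smooth_alg_smooth generated_algebra.const)

lemma smooth_add: "smooth \<phi> \<Longrightarrow> smooth \<psi> \<Longrightarrow> smooth (\<lambda>x. \<phi> x + \<psi> x)"
  by (intro smooth_alg_smooth generated_algebra.add generated_algebra.gen) auto

lemma smooth_mult: "smooth \<phi> \<Longrightarrow> smooth \<psi> \<Longrightarrow> smooth (\<lambda>x. \<phi> x * \<psi> x)"
  by (intro smooth_alg_smooth generated_algebra.mult generated_algebra.gen) auto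

lemma smooth_cmult: "smooth \<phi> \<Longrightarrow> smooth (\<lambda>x. c * \<phi> x)"
  by (intro smooth_mult smooth_const)

lemma smooth_diff: "smooth \<phi> \<Longrightarrow> smooth \<psi> \<Longrightarrow> smooth (\<lambda>x. \<phi> x - \<psi> x)"
  using smooth_add[of \<phi> "\<lambda>x. (- 1) * \<psi> x"] smooth_cmult[of \<psi> "- 1"] by simp

lemma smooth_power: "smooth \<phi> \<Longrightarrow> smooth (\<lambda>x. \<phi> x ^ n)"
  by (induction n) (auto intro: smooth_const smooth_mult)

lemma smooth_sum: "(\<And>i. i \<in> I \<Longrightarrow> smooth (\<phi> i)) \<Longrightarrow> smooth (\<lambda>x. \<Sum>i\<in>I. \<phi> i x)"
  by (induction I rule: infinite_finite_induct) (auto intro: smooth_const smooth_add)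

lemma smooth_ident: "smooth (\<lambda>x. x)"
  by (rule smooth_coinduct[of _ "{\<lambda>x. x, \<lambda>x. 1, \<lambda>x. 0}"]) auto

lemma smooth_antideriv:
  assumes "\<And>x. (g has_real_derivative h x) (at x)" "smooth h"
  shows "smooth g"
proof (rule smooth_coinduct[of _ "insert g (Collect smooth)"])
  fix k assume "k \<in> insert g (Collect smooth)"
  then show "\<exists>g'\<in>insert g (Collect smooth). \<forall>x. (k has_real_derivative g' x) (at x)"
    using assms smooth_has_derivative[of k 0] smooth_deriv[of k] by auto
qed simp

lemma smooth_sin_cos: "smooth sin" "smooth cos"
proof -
  let ?S = "generated_algebra {sin, cos}"
  have *: "\<exists>g'\<in>?S. \<forall>x. (g has_real_derivative g' x) (at x)" if g: "g \<in> {sin, cos}" for g :: "real \<Rightarrow> real"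
  proof (cases "g = sin")
    case True
    then show ?thesis by (intro bexI[of _ cos]) (auto intro: generated_algebra.gen)
  next
    case False
    then have "g = cos" using g by simp
    then show ?thesis
      by (intro bexI[of _ "\<lambda>x. (- 1) * sin x"] generated_algebra.mult generated_algebra.const)
         (auto intro: generated_algebra.gen intro!: derivative_eq_intros)
  qed
  show "smooth sin" "smooth cos" by (rule smooth_alg[OF generated_algebra.gen *]; simp)+
qed

section \<open>Higher derivatives of affine substitutions, linear combinations and products\<close>

lemma higher_deriv_affine:
  assumes "smooth \<phi>"
  shows "(deriv ^^ k) (\<lambda>x. \<phi> (m * x + c)) = (\<lambda>x. m ^ k * (deriv ^^ k) \<phi> (m * x + c))" (is "_ = ?G k")
proof (induction k)
  case (Suc k)
  have "((\<lambda>x. m ^ k * (deriv ^^ k) \<phi> (m * x + c)) has_real_derivative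
      m ^ Suc k * (deriv ^^ Suc k) \<phi> (m * x + c)) (at x)" for x
    by (rule derivative_eq_intros DERIV_chain2[where g = "\<lambda>x. m * x + c"] smooth_has_derivative[OF assms] refl)+ simp
  then have "deriv (?G k) = ?G (Suc k)" by (intro ext DERIV_imp_deriv)
  then show ?case by (simp add: Suc.IH)
qed simp

lemma smooth_affine:
  assumes "smooth \<phi>" shows "smooth (\<lambda>x. \<phi> (m * x + c))"
  unfolding smooth_def
proof (intro allI)
  fix k x
  have "((\<lambda>x. m ^ k * (deriv ^^ k) \<phi> (m * x + c)) has_real_derivative
      m ^ k * ((deriv ^^ Suc k) \<phi> (m * x + c) * m)) (at x)"
    by (rule derivative_eq_intros DERIV_chain2[where g = "\<lambda>x. m * x + c"] smooth_has_derivative[OF assms] refl)+ simp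
  then show "(deriv ^^ k) (\<lambda>x. \<phi> (m * x + c)) differentiable at x"
    unfolding higher_deriv_affine[OF assms] using real_differentiable_def by blast
qed

lemma higher_deriv_lincomb:
  assumes "smooth \<phi>" "smooth \<psi>"
  shows "(deriv ^^ k) (\<lambda>x. a * \<phi> x + b * \<psi> x) = (\<lambda>x. a * (deriv ^^ k) \<phi> x + b * (deriv ^^ k) \<psi> x)"
    (is "_ = ?G k")
proof (induction k)
  case (Suc k)
  have "((\<lambda>x. a * (deriv ^^ k) \<phi> x + b * (deriv ^^ k) \<psi> x) has_real_derivative
     a * (deriv ^^ Suc k) \<phi> x + b * (deriv ^^ Suc k) \<psi> x) (at x)" for x
    by (intro DERIV_add DERIV_cmult smooth_has_derivative assms)
  then have "deriv (?G k) = ?G (Suc k)" by (intro ext DERIV_imp_deriv)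
  then show ?case by (simp add: Suc.IH)
qed simp

lemma higher_deriv_zero: "(deriv ^^ k) (\<lambda>x::real. 0::real) = (\<lambda>x. 0)"
  using higher_deriv_lincomb[OF smooth_const smooth_const, of k 0 0 0 0] by simp

lemma smooth_higher_deriv_diff:
  assumes "smooth \<phi>" "smooth \<psi>"
  shows "(deriv ^^ k) (\<lambda>x. \<phi> x - \<psi> x) = (\<lambda>x. (deriv ^^ k) \<phi> x - (deriv ^^ k) \<psi> x)"
  using higher_deriv_lincomb[OF assms, of k 1 "- 1"] by simp

text \<open>A crude Leibniz rule: each differentiation doubles the number of terms, and every term
  is at most \<open>A * B\<close>. The bounds are only required at the single point
  \<open>x\<close>, so they can later be applied locally.\<close>

lemma higher_deriv_mult_bound:
  assumes "smooth \<phi>" "smooth \<psi>"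
    and "\<And>k. k \<le> n \<Longrightarrow> \<bar>(deriv ^^ k) \<phi> x\<bar> \<le> A" "\<And>k. k \<le> n \<Longrightarrow> \<bar>(deriv ^^ k) \<psi> x\<bar> \<le> B"
  shows "\<bar>(deriv ^^ n) (\<lambda>x. \<phi> x * \<psi> x) x\<bar> \<le> 2 ^ n * A * B"
  using assms
proof (induction n arbitrary: \<phi> \<psi>)
  case 0
  then show ?case using mult_mono[of "\<bar>\<phi> x\<bar>" A "\<bar>\<psi> x\<bar>" B] by (force simp: abs_mult)
next
  case (Suc n)
  have *: "deriv (\<lambda>x. \<phi> x * \<psi> x) = (\<lambda>x. 1 * (deriv \<phi> x * \<psi> x) + 1 * (\<phi> x * deriv \<psi> x))"
  proof
    fix x
    show "deriv (\<lambda>x. \<phi> x * \<psi> x) x = 1 * (deriv \<phi> x * \<psi> x) + 1 * (\<phi> x * deriv \<psi> x)"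
      using DERIV_mult[OF smooth_has_derivative[of \<phi> 0 x] smooth_has_derivative[of \<psi> 0 x]] Suc.prems
      by (auto intro!: DERIV_imp_deriv simp: mult_ac)
  qed
  have 1: "\<bar>(deriv ^^ n) (\<lambda>x. deriv \<phi> x * \<psi> x) x\<bar> \<le> 2 ^ n * A * B"
    by (rule Suc.IH) (use Suc.prems in \<open>auto intro: smooth_deriv simp: higher_deriv_deriv simp del: funpow.simps\<close>)
  have 2: "\<bar>(deriv ^^ n) (\<lambda>x. \<phi> x * deriv \<psi> x) x\<bar> \<le> 2 ^ n * A * B"
    by (rule Suc.IH) (use Suc.prems in \<open>auto intro: smooth_deriv simp: higher_deriv_deriv simp del: funpow.simps\<close>)
  have "(deriv ^^ Suc n) (\<lambda>x. \<phi> x * \<psi> x) x =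
      1 * (deriv ^^ n) (\<lambda>x. deriv \<phi> x * \<psi> x) x + 1 * (deriv ^^ n) (\<lambda>x. \<phi> x * deriv \<psi> x) x"
    unfolding higher_deriv_deriv[symmetric] * using Suc.prems
    by (subst higher_deriv_lincomb) (auto intro: smooth_mult smooth_deriv)
  then show ?case using 1 2 by simp
qed

lemma higher_deriv_cong_open:
  assumes "open U" "\<And>x. x \<in> U \<Longrightarrow> \<phi> x = \<psi> x" "x \<in> U"
  shows "(deriv ^^ k) \<phi> x = (deriv ^^ k) \<psi> x"
  using assms(3)
proof (induction k arbitrary: x)
  case (Suc k)
  have "\<forall>\<^sub>F y in nhds x. (deriv ^^ k) \<phi> y = (deriv ^^ k) \<psi> y"
    using eventually_nhds_in_open[OF assms(1) Suc.prems] Suc.IH by (auto elim: eventually_mono)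
  then show ?case by (simp add: deriv_cong_ev)
qed (use assms in auto)

subsection \<open>A periodic bump function\<close>

text \<open>Composing the flat function with \<open>cos x - cos e\<close> gives bumps that are periodic from the outset.\<close>

definition flat :: "nat \<Rightarrow> real \<Rightarrow> real" where
  "flat n t = (if t > 0 then exp (- 1 / t) / t ^ n else 0)"

lemma flat_tendsto_0: "(flat n \<longlongrightarrow> 0) (at 0)"
proof -
  have "((\<lambda>x. x ^ n / exp x) \<longlongrightarrow> (0::real)) at_top" by (rule tendsto_power_div_exp_0)
  then have "((\<lambda>t. inverse t ^ n / exp (inverse t)) \<longlongrightarrow> (0::real)) (at_right 0)"
    using filterlim_compose filterlim_inverse_at_top_right by blast
  moreover have "\<forall>\<^sub>F t in at_right 0. inverse t ^ n / exp (inverse t) = flat n (t::real)"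
    by (auto simp: eventually_at_filter flat_def exp_minus field_simps)
  ultimately have R: "(flat n \<longlongrightarrow> 0) (at_right 0)"
    using tendsto_cong by fastforce
  have "\<forall>\<^sub>F t in at_left 0. flat n t = 0"
    by (auto simp: eventually_at_filter flat_def)
  then have "(flat n \<longlongrightarrow> 0) (at_left 0)" by (simp add: tendsto_eventually)
  then show ?thesis using R by (simp add: filterlim_at_split)
qed

text \<open>The index \<open>n\<close> exists so that the family is closed under differentiation up
  to linear combinations. At \<open>0\<close> the difference quotient of \<open>flat n\<close> is
  \<open>flat (Suc n)\<close>, which tends to \<open>0\<close> because the exponential beats every
  power.\<close>

lemma flat_has_derivative:
  "(flat n has_real_derivative flat (n + 2) t - n * flat (n + 1) t) (at t)"
proof -
  consider "t > 0" | "t < 0" | "t = 0" by linarith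
  then show ?thesis
  proof cases
    case 1
    have "((\<lambda>t. exp (- 1 / t) / t ^ n) has_real_derivative flat (n + 2) t - n * flat (n + 1) t) (at t)"
      using 1 by (auto intro!: derivative_eq_intros simp: flat_def divide_simps)
         (cases n; simp add: field_simps power_add)
    then show ?thesis
      by (rule has_field_derivative_transform_within_open[where S = "{0<..}"])
         (use 1 in \<open>auto simp: flat_def\<close>)
  next
    case 2
    have "((\<lambda>t. 0) has_real_derivative flat (n + 2) t - n * flat (n + 1) t) (at t)"
      using 2 by (simp add: flat_def)
    then show ?thesis
      by (rule has_field_derivative_transform_within_open[where S = "{..<0}"])
         (use 2 in \<open>auto simp: flat_def\<close>)
  next
    case 3
    have "\<forall>\<^sub>F h in at 0. flat (Suc n) h = (flat n (0 + h) - flat n 0) / h"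
      by (auto simp: eventually_at_filter flat_def)
    then have "((\<lambda>h. (flat n (0 + h) - flat n 0) / h) \<longlongrightarrow> 0) (at 0)"
      using flat_tendsto_0[of "Suc n"] tendsto_cong by fastforce
    then show ?thesis using 3 by (simp add: DERIV_def flat_def)
  qed
qed

lemma smooth_flat_cos: "smooth (\<lambda>x. flat n (cos x - c))"
proof -
  \<comment> \<open>All indices are taken at once, since differentiating a generator raises its
    index.\<close>
  let ?A = "{sin, cos} \<union> range (\<lambda>n x. flat n (cos x - c))"
  have gens: "sin \<in> generated_algebra ?A" "cos \<in> generated_algebra ?A" "(\<lambda>x. flat n (cos x - c)) \<in> generated_algebra ?A" for n
    by (auto intro!: generated_algebra.gen)
  show ?thesis
  proof (rule smooth_alg[OF gens(3)])
    fix g assume "g \<in> ?A"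
    then consider "g = sin" | "g = cos" | n where "g = (\<lambda>x. flat n (cos x - c))" by auto
    then show "\<exists>g'\<in>generated_algebra ?A. \<forall>x. (g has_real_derivative g' x) (at x)"
    proof cases
      case 1
      then show ?thesis using gens by (intro bexI[of _ cos]) auto
    next
      case 2
      then show ?thesis using gens
        by (intro bexI[of _ "\<lambda>x. (- 1) * sin x"] generated_algebra.mult generated_algebra.const) (auto intro!: derivative_eq_intros)
    next
      case 3
      show ?thesis
      proof (intro bexI[of _ "\<lambda>x. (flat (n + 2) (cos x - c) + (- n) * flat (n + 1) (cos x - c)) * ((- 1) * sin x)"]
          generated_algebra.mult generated_algebra.add generated_algebra.const gens allI)
        fix x
        have "((\<lambda>x. cos x - c) has_real_derivative - sin x) (at x)"
          by (auto intro!: derivative_eq_intros)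
        from DERIV_chain2[OF flat_has_derivative this]
        show "(g has_real_derivative (flat (n + 2) (cos x - c) + (- n) * flat (n + 1) (cos x - c)) * ((- 1) * sin x)) (at x)"
          unfolding 3 by simp
      qed
    qed
  qed
qed

section \<open>Periodic test functions\<close>

lemma test_funI: "smooth \<phi> \<Longrightarrow> (\<And>x. \<phi> (x + 2 * pi) = \<phi> x) \<Longrightarrow> test_fun \<phi>"
  by (simp add: test_fun_iff)

lemma test_fun_smooth: "test_fun \<phi> \<Longrightarrow> smooth \<phi>"
  by (simp add: test_fun_iff)

lemma test_fun_const: "test_fun (\<lambda>x. c)"
  by (simp add: test_fun_iff smooth_const)

lemma test_fun_add: "test_fun \<phi> \<Longrightarrow> test_fun \<psi> \<Longrightarrow> test_fun (\<lambda>x. \<phi> x + \<psi> x)"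
  by (simp add: test_fun_iff smooth_add)

lemma test_fun_diff: "test_fun \<phi> \<Longrightarrow> test_fun \<psi> \<Longrightarrow> test_fun (\<lambda>x. \<phi> x - \<psi> x)"
  by (simp add: test_fun_iff smooth_diff)

lemma test_fun_mult: "test_fun \<phi> \<Longrightarrow> test_fun \<psi> \<Longrightarrow> test_fun (\<lambda>x. \<phi> x * \<psi> x)"
  by (simp add: test_fun_iff smooth_mult)

lemma test_fun_cmult: "test_fun \<phi> \<Longrightarrow> test_fun (\<lambda>x. c * \<phi> x)"
  by (simp add: test_fun_iff smooth_cmult)

lemma test_fun_power: "test_fun \<phi> \<Longrightarrow> test_fun (\<lambda>x. \<phi> x ^ n)"
  by (simp add: test_fun_iff smooth_power)

lemma test_fun_sum: "(\<And>i. i \<in> I \<Longrightarrow> test_fun (\<phi> i)) \<Longrightarrow> test_fun (\<lambda>x. \<Sum>i\<in>I. \<phi> i x)"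
  by (simp add: test_fun_iff smooth_sum)

lemma test_fun_periodic:
  assumes "test_fun \<phi>" shows "\<phi> (x + 2 * pi * of_int k) = \<phi> x"
proof -
  have nat: "\<phi> (x + 2 * pi * of_nat n) = \<phi> x" for n x
  proof (induction n)
    case (Suc n)
    have "\<phi> (x + 2 * pi * of_nat (Suc n)) = \<phi> (x + 2 * pi * of_nat n + 2 * pi)"
      by (simp add: algebra_simps)
    then show ?case using assms Suc by (simp add: test_fun_iff)
  qed simp
  show ?thesis
  proof (cases k)
    case (nonneg n) then show ?thesis using nat by simp
  next
    case (neg n)
    then have "x + 2 * pi * of_int k + 2 * pi * of_nat (Suc n) = x" by (simp flip: distrib_left)
    then show ?thesis using nat[of "x + 2 * pi * of_int k" "Suc n"] by metis
  qed
qed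

text \<open>An integer slope preserves the period. Slopes \<open>1\<close> and \<open>- 1\<close>
  give shifts and reflections; large slopes give the rescalings used for distributions supported at
  a point.\<close>

lemma test_fun_affine:
  assumes "test_fun \<phi>" shows "test_fun (\<lambda>x. \<phi> (of_int m * x + c))"
proof (rule test_funI)
  show "smooth (\<lambda>x. \<phi> (of_int m * x + c))" using assms by (simp add: test_fun_iff smooth_affine)
  show "\<phi> (of_int m * (x + 2 * pi) + c) = \<phi> (of_int m * x + c)" for x
    using test_fun_periodic[OF assms, of "of_int m * x + c" m] by (simp add: algebra_simps)
qed

lemma test_fun_shift: "test_fun \<phi> \<Longrightarrow> test_fun (\<lambda>x. \<phi> (x + y))"
  and test_fun_shift': "test_fun \<phi> \<Longrightarrow> test_fun (\<lambda>x. \<phi> (y + x))"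
  and test_fun_reflect: "test_fun \<phi> \<Longrightarrow> test_fun (\<lambda>x. \<phi> (y - x))"
  using test_fun_affine[of \<phi> 1 y] test_fun_affine[of \<phi> "- 1" y]
  by (simp_all add: add.commute)

lemma test_fun_higher_deriv:
  assumes "test_fun \<phi>" shows "test_fun ((deriv ^^ k) \<phi>)"
proof (rule test_funI)
  have "(\<lambda>x. \<phi> (1 * x + 2 * pi)) = \<phi>" using assms by (simp add: test_fun_iff)
  then show "(deriv ^^ k) \<phi> (x + 2 * pi) = (deriv ^^ k) \<phi> x" for x
    using higher_deriv_affine[OF test_fun_smooth[OF assms], of k 1 "2 * pi"]
    by (simp add: fun_eq_iff)
qed (use assms test_fun_smooth smooth_higher_deriv in blast)

lemma ex_period_shift: "\<exists>k::int. y \<le> x + 2 * pi * of_int k \<and> x + 2 * pi * of_int k < y + 2 * pi"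
proof -
  define k where "k = \<lfloor>(x - y) / (2 * pi)\<rfloor>"
  have "of_int k \<le> (x - y) / (2 * pi)" "(x - y) / (2 * pi) < of_int k + 1"
    unfolding k_def by linarith+
  then have "2 * pi * of_int k \<le> x - y" "x - y < 2 * pi * (of_int k + 1)"
    by (simp_all add: field_simps)
  then show ?thesis by (intro exI[of _ "- k"]) (auto simp: algebra_simps)
qed

lemma test_fun_bounded:
  assumes "test_fun \<phi>" obtains B where "\<And>x. \<bar>\<phi> x\<bar> \<le> B"
proof -
  have "isCont \<phi> x" for x
    using smooth_has_derivative[OF test_fun_smooth[OF assms], of 0 x] DERIV_isCont by auto
  then have "compact (\<phi> ` {0..2 * pi})"
    by (intro compact_continuous_image) (auto intro: continuous_at_imp_continuous_on)
  then obtain B where B: "\<And>x. x \<in> {0..2 * pi} \<Longrightarrow> \<bar>\<phi> x\<bar> \<le> B"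
    using compact_imp_bounded bounded_iff by (metis image_eqI real_norm_def)
  have "\<bar>\<phi> x\<bar> \<le> B" for x
  proof -
    obtain k :: int where "0 \<le> x + 2 * pi * of_int k" "x + 2 * pi * of_int k < 0 + 2 * pi"
      using ex_period_shift by blast
    then show ?thesis using B[of "x + 2 * pi * of_int k"] test_fun_periodic[OF assms, of x k] by simp
  qed
  then show ?thesis using that by blast
qed

lemma abs_le_seminorm:
  assumes "test_fun \<phi>" shows "\<bar>(deriv ^^ k) \<phi> x\<bar> \<le> seminorm k \<phi>"
proof -
  obtain B where "\<And>x. \<bar>(deriv ^^ k) \<phi> x\<bar> \<le> B"
    using test_fun_bounded[OF test_fun_higher_deriv[OF assms]] by blast
  then show ?thesis unfolding seminorm_def by (intro cSUP_upper) (auto intro!: bdd_aboveI2)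
qed

lemma seminorm_nonneg: "test_fun \<phi> \<Longrightarrow> 0 \<le> seminorm k \<phi>"
  using abs_le_seminorm abs_ge_zero order_trans by blast

lemma seminorm_le: "(\<And>x. \<bar>(deriv ^^ k) \<phi> x\<bar> \<le> B) \<Longrightarrow> seminorm k \<phi> \<le> B"
  unfolding seminorm_def by (rule cSUP_least) auto

lemma test_fun_derivs_bounded:
  assumes "test_fun \<phi>" obtains B where "B \<ge> 0" "\<And>k x. k \<le> N \<Longrightarrow> \<bar>(deriv ^^ k) \<phi> x\<bar> \<le> B"
proof
  show "0 \<le> (\<Sum>k\<le>N. seminorm k \<phi>)" by (intro sum_nonneg seminorm_nonneg assms)
  show "\<bar>(deriv ^^ k) \<phi> x\<bar> \<le> (\<Sum>k\<le>N. seminorm k \<phi>)" if "k \<le> N" for k x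
    using abs_le_seminorm[OF assms, of k x] member_le_sum[of k "{..N}" "\<lambda>k. seminorm k \<phi>"] that
      seminorm_nonneg[OF assms] by fastforce
qed

subsection \<open>Cutoff functions\<close>

text \<open>\<open>R\<close> is a smooth staircase: the antiderivative of a periodic bump living
  within \<open>e\<close> of the multiples of \<open>2 * pi\<close>, normalised to gain
  \<open>1\<close> per period. Cutoffs, partitions of unity and the periodic coordinate are all
  derived from it.\<close>

lemma smooth_step:
  assumes "0 < e" "e < pi"
  obtains R where "smooth R" "\<And>x. R (x + 2 * pi) = R x + 1"
    "\<And>x. e - 2 * pi \<le> x \<Longrightarrow> x \<le> - e \<Longrightarrow> R x = 0"
proof -
  define \<rho> where "\<rho> = (\<lambda>x. flat 0 (cos x - cos e))"
  have smooth: "smooth \<rho>" unfolding \<rho>_def by (rule smooth_flat_cos)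
  have cont: "isCont \<rho> x" for x
    using smooth_has_derivative[OF smooth, of 0 x] DERIV_isCont by auto
  obtain F where "\<forall>x::real. -\<infinity> < ereal x \<longrightarrow> ereal x < \<infinity> \<longrightarrow> (F has_vector_derivative \<rho> x) (at x)"
    using einterval_antiderivative[of "-\<infinity>" "\<infinity>" \<rho>] cont by auto
  then have F: "(F has_real_derivative \<rho> x) (at x)" for x
    by (simp add: has_real_derivative_iff_has_vector_derivative)
  have nonneg: "\<rho> x \<ge> 0" for x by (simp add: \<rho>_def flat_def)
  define K where "K = F (2 * pi) - F 0"
  have per: "F (x + 2 * pi) - F x = K" for x
  proof -
    have "((\<lambda>x. F (x + 2 * pi) - F x) has_real_derivative 0) (at x)" for x
    proof -
      have "\<rho> (x + 2 * pi) = \<rho> x" by (simp add: \<rho>_def)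
      then show ?thesis using DERIV_diff[OF DERIV_shift[THEN iffD1, OF F[of "x + 2 * pi"]] F[of x]] by simp
    qed
    then have "F (x + 2 * pi) - F x = F (0 + 2 * pi) - F 0"
      by (rule DERIV_isconst_all[rule_format, of "\<lambda>x. F (x + 2 * pi) - F x"])
    then show ?thesis by (simp add: K_def)
  qed
  have "F 0 < F (e / 2)"
  proof (rule DERIV_pos_imp_increasing[of 0 "e / 2" F])
    fix x assume "0 \<le> x" "x \<le> e / 2"
    then have "cos e < cos x" using assms by (intro cos_monotone_0_pi) auto
    then have "\<rho> x > 0" by (simp add: \<rho>_def flat_def)
    then show "\<exists>y. (F has_real_derivative y) (at x) \<and> 0 < y" using F by blast
  qed (use assms in simp)
  also have "F (e / 2) \<le> F (2 * pi)"
    by (rule DERIV_nonneg_imp_nondecreasing[of "e / 2" "2 * pi" F]) (use assms F nonneg in \<open>simp, blast\<close>)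
  finally have K: "K > 0" by (simp add: K_def)
  define R where "R = (\<lambda>x. (1 / K) * (F x - F (- e)))"
  show ?thesis
  proof
    have "((\<lambda>x. (1 / K) * (F x - F (- e))) has_real_derivative (1 / K) * (\<rho> x - 0)) (at x)" for x
      by (rule DERIV_cmult DERIV_diff F DERIV_const)+
    then show "smooth R" unfolding R_def
      by (rule smooth_antideriv) (use smooth_cmult[OF smooth, of "1 / K"] in simp)
    show "R (x + 2 * pi) = R x + 1" for x
      using per[of x] K by (simp add: R_def field_simps)
    show "R x = 0" if x: "e - 2 * pi \<le> x" "x \<le> - e" for x
    proof -
      have z: "\<rho> t = 0" if "x \<le> t" "t \<le> - e" for t
      proof -
        \<comment> \<open>Periodicity or evenness, according to the side of \<open>- pi\<close> on
          which \<open>t\<close> lies, moves the argument into \<open>[e, pi]\<close>, where the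
          cosine decreases.\<close>
        have "cos t \<le> cos e"
        proof (cases "t \<le> - pi")
          case True
          have "cos (t + 2 * pi) \<le> cos e" using True x that assms by (intro cos_monotone_0_pi_le) auto
          then show ?thesis by simp
        next
          case False
          have "cos (- t) \<le> cos e" using False x that assms by (intro cos_monotone_0_pi_le) auto
          then show ?thesis by simp
        qed
        then show ?thesis by (simp add: \<rho>_def flat_def)
      qed
      have "F x = F (- e)"
      proof (cases "x = - e")
        case False
        then have "x < - e" using x by simp
        then show ?thesis
          using DERIV_isconst_end[of x "- e" F] F z
          by (metis DERIV_isCont continuous_at_imp_continuous_on less_imp_le)
      qed simp
      then show ?thesis by (simp add: R_def)
    qed
  qed
qed

text \<open>The unit gains per period cancel in the difference of two translates. What remains rises
  within \<open>e\<close> of \<open>c\<close> and falls within \<open>e\<close> of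
  \<open>d\<close>.\<close>

lemma smooth_step_difference:
  assumes R: "smooth R" "\<And>x. R (x + 2 * pi) = R x + 1"
    "\<And>x. e - 2 * pi \<le> x \<Longrightarrow> x \<le> - e \<Longrightarrow> R x = 0" and "c \<le> d"
  shows "test_fun (\<lambda>x. R (x - c) - R (x - d))"
    and "d + e \<le> x \<Longrightarrow> x \<le> c + 2 * pi - e \<Longrightarrow> R (x - c) - R (x - d) = 0"
    and "c + e \<le> x \<Longrightarrow> x \<le> d - e \<Longrightarrow> d \<le> c + 2 * pi \<Longrightarrow> R (x - c) - R (x - d) = 1"
proof -
  have R1: "R x = 1" if "e \<le> x" "x \<le> 2 * pi - e" for x
    using R(2)[of "x - 2 * pi"] R(3)[of "x - 2 * pi"] that by simp
  show "test_fun (\<lambda>x. R (x - c) - R (x - d))"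
  proof (rule test_funI)
    show "smooth (\<lambda>x. R (x - c) - R (x - d))"
      using smooth_affine[OF R(1), of 1 "- c"] smooth_affine[OF R(1), of 1 "- d"]
      by (intro smooth_diff) auto
    show "R (x + 2 * pi - c) - R (x + 2 * pi - d) = R (x - c) - R (x - d)" for x
      using R(2)[of "x - c"] R(2)[of "x - d"] by (simp add: algebra_simps)
  qed
  show "R (x - c) - R (x - d) = 0" if "d + e \<le> x" "x \<le> c + 2 * pi - e"
    using that R1[of "x - c"] R1[of "x - d"] \<open>c \<le> d\<close> by simp
  show "R (x - c) - R (x - d) = 1" if "c + e \<le> x" "x \<le> d - e" "d \<le> c + 2 * pi"
    using that R1[of "x - c"] R(3)[of "x - d"] by simp
qed

lemma cutoff_exists:
  assumes "c' < c" "c \<le> d" "d < d'" "d' \<le> c' + 2 * pi"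
  obtains \<eta> where "test_fun \<eta>" "\<And>x. c \<le> x \<Longrightarrow> x \<le> d \<Longrightarrow> \<eta> x = 1"
    "\<And>x. d' \<le> x \<Longrightarrow> x \<le> c' + 2 * pi \<Longrightarrow> \<eta> x = 0"
proof -
  \<comment> \<open>The transitions are centred at the midpoints \<open>C\<close> and
    \<open>D\<close> of the two gaps, so \<open>e\<close> may be at most half of either gap; the cap
    \<open>1\<close> ensures \<open>e < pi\<close>.\<close>
  define e where "e = min 1 (min ((c - c') / 2) ((d' - d) / 2))"
  have e: "0 < e" "e \<le> (c - c') / 2" "e \<le> (d' - d) / 2" "e < pi"
    using assms pi_gt3 unfolding e_def by (simp_all only: min_less_iff_conj min_less_iff_disj min_le_iff_disj) auto
  obtain R where R: "smooth R" "\<And>x. R (x + 2 * pi) = R x + 1"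
    "\<And>x. e - 2 * pi \<le> x \<Longrightarrow> x \<le> - e \<Longrightarrow> R x = 0"
    using smooth_step[OF e(1,4)] by blast
  define C D where "C = (c + c') / 2" and "D = (d + d') / 2"
  have CD: "C \<le> D" "C + e \<le> c" "d \<le> D - e" "D + e \<le> d'" "c' + 2 * pi \<le> C + 2 * pi - e" "D \<le> C + 2 * pi"
    using assms e by (auto simp: C_def D_def field_simps)
  note W = smooth_step_difference[of R e, OF R CD(1)]
  show ?thesis
    by (rule that[of "\<lambda>x. R (x - C) - R (x - D)"]) (use W CD in auto)
qed

text \<open>Powers of such a \<open>q\<close> serve as periodic substitutes for the monomials.\<close>

lemma periodic_coordinate_exists:
  obtains q where "test_fun q" "\<And>x. \<bar>x\<bar> \<le> 2 \<Longrightarrow> q x = x"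
proof -
  obtain R where R: "smooth R" "\<And>x. R (x + 2 * pi) = R x + 1"
    "\<And>x. 1 - 2 * pi \<le> x \<Longrightarrow> x \<le> - 1 \<Longrightarrow> R x = 0"
    by (rule smooth_step[of 1]) (use pi_gt3 in auto)
  show ?thesis
  proof
    \<comment> \<open>Subtracting \<open>2 * pi\<close> times the staircase cancels the growth of
      \<open>x\<close> over a period. The steps are placed at odd multiples of \<open>pi\<close>
      with half-width \<open>1\<close>, hence they miss \<open>[-2, 2]\<close> because
      \<open>pi > 3\<close>.\<close>
    show "test_fun (\<lambda>x. x - 2 * pi * R (x - pi))"
    proof (rule test_funI)
      show "smooth (\<lambda>x. x - 2 * pi * R (x - pi))"
        using smooth_affine[OF R(1), of 1 "- pi"] by (intro smooth_diff smooth_ident smooth_cmult) simp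
      show "x + 2 * pi - 2 * pi * R (x + 2 * pi - pi) = x - 2 * pi * R (x - pi)" for x
        using R(2)[of "x - pi"] by (simp add: algebra_simps)
    qed
    show "x - 2 * pi * R (x - pi) = x" if "\<bar>x\<bar> \<le> 2" for x
      using R(3)[of "x - pi"] that pi_gt3 by simp
  qed
qed

text \<open>Differences of consecutive translates of a staircase telescope to
  \<open>R x - R (x - 2 * pi) = 1\<close>. The window from \<open>-1\<close> to \<open>8\<close> is
  a compact interval containing one representative of every piece, as a Lebesgue number argument
  requires.\<close>

lemma fine_partition_of_unity:
  assumes "\<delta> > 0"
  shows "\<exists>(w :: nat \<Rightarrow> real \<Rightarrow> real) c d n. (\<forall>j. test_fun (w j)) \<and> (\<forall>x. (\<Sum>j<n. w j x) = 1) \<and>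
    (\<forall>j x. w j x \<noteq> 0 \<longrightarrow> (\<exists>k::int. c j < x + 2 * pi * of_int k \<and> x + 2 * pi * of_int k < d j)) \<and>
    (\<forall>j<n. -1 \<le> c j \<and> d j \<le> 8 \<and> c j \<le> d j \<and> d j - c j < \<delta>)"
proof -
  \<comment> \<open>A piece has length \<open>2 * pi / n + 2 * e\<close> with
    \<open>e = 1 / n\<close>, which is at most \<open>8.4 / n\<close> because
    \<open>pi < 3.2\<close>.\<close>
  obtain n :: nat where n: "n > 10 / \<delta>" "n > 10" 
    using reals_Archimedean2[of "max (10 / \<delta>) 10"] by auto
  define e where "e = 1 / real n"
  have e: "0 < e" "e \<le> 1" using n by (auto simp: e_def field_simps)
  then have e': "e < pi" using pi_gt3 by linarith
  define p where "p = (\<lambda>j. 2 * pi * real j / n)"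
  have p_step: "p (Suc j) = p j + 2 * pi / n" for j by (simp add: p_def add_divide_distrib ring_distribs)
  obtain R where R: "smooth R" "\<And>x. R (x + 2 * pi) = R x + 1"
    "\<And>x. e - 2 * pi \<le> x \<Longrightarrow> x \<le> - e \<Longrightarrow> R x = 0"
    using smooth_step[OF e(1) e'] by blast
  have pj: "p j \<le> p (Suc j)" for j using p_step by simp
  note W = smooth_step_difference[of R e, OF R pj]
  have pi4: "pi < 3.2" using pi_approx by simp
  have w0: "test_fun (\<lambda>x. R (x - p j) - R (x - p (Suc j)))" for j by (rule W(1))
  have w1: "(\<Sum>j<n. R (x - p j) - R (x - p (Suc j))) = 1" for x
    proof -
      have "(\<Sum>j<n. R (x - p j) - R (x - p (Suc j))) = R (x - p 0) - R (x - p n)"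
        by (rule sum_lessThan_telescope')
      also have "\<dots> = 1" using R(2)[of "x - 2 * pi"] n by (simp add: p_def)
      finally show ?thesis .
    qed
  have w2: "\<exists>k::int. p j - e < x + 2 * pi * of_int k \<and> x + 2 * pi * of_int k < p (Suc j) + e"
      if nz: "R (x - p j) - R (x - p (Suc j)) \<noteq> 0" for j x
    proof -
      \<comment> \<open>The representatives supplied form an interval closed on the left; applying
        the fact to \<open>- x\<close> turns it into one open on the left, as the strict lower bound
        demands.\<close>
      obtain l :: int where "- (p j - e + 2 * pi) \<le> - x + 2 * pi * of_int l"
        "- x + 2 * pi * of_int l < - (p j - e + 2 * pi) + 2 * pi"
        using ex_period_shift by blast
      then obtain k :: int where k: "p j - e < x + 2 * pi * of_int k" "x + 2 * pi * of_int k \<le> p j - e + 2 * pi"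
        by (intro that[of "- l"]) (auto simp: algebra_simps)
      have "R (x + 2 * pi * of_int k - p j) - R (x + 2 * pi * of_int k - p (Suc j)) \<noteq> 0"
        using test_fun_periodic[OF W(1), of x k] nz by simp
      then have "\<not> p (Suc j) + e \<le> x + 2 * pi * of_int k" using W(2)[of _ "x + 2 * pi * of_int k"] k
        by (smt (verit))
      then show ?thesis using k by (intro exI[of _ k]) auto
    qed
  have w3: "-1 \<le> p j - e \<and> p (Suc j) + e \<le> 8 \<and> p j - e \<le> p (Suc j) + e \<and> p (Suc j) + e - (p j - e) < \<delta>"
    if "j < n" for j
  proof -
    have "0 \<le> p j" by (simp add: p_def)
    moreover have "p (Suc j) \<le> 2 * pi"
      using that mult_left_mono[of "real (Suc j)" "real n" "2 * pi"] by (simp add: p_def divide_le_eq)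
    moreover have "2 * pi / n + 2 * e \<le> 8.4 / n" using pi4 n by (simp add: e_def field_simps)
    moreover have "8.4 / n < \<delta>" using n assms by (simp add: field_simps)
    ultimately show ?thesis using e pj[of j] p_step[of j] pi4 by linarith
  qed
  show ?thesis
    by (rule exI[of _ "\<lambda>j x. R (x - p j) - R (x - p (Suc j))"], rule exI[of _ "\<lambda>j. p j - e"],
        rule exI[of _ "\<lambda>j. p (Suc j) + e"], rule exI[of _ n]) (use w0 w1 w2 w3 in blast)
qed

section \<open>Distributions on the torus\<close>

lemma distribution_linear:
  assumes "distribution T" "test_fun \<phi>" "test_fun \<psi>"
  shows "T (\<lambda>x. a * \<phi> x + b * \<psi> x) = of_real a * T \<phi> + of_real b * T \<psi>"
  using assms unfolding distribution_def by blast

lemma distribution_zero: "distribution T \<Longrightarrow> T (\<lambda>x. 0) = 0"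
  using distribution_linear[OF _ test_fun_const test_fun_const, of T 0 0 0 0] by simp

lemma distribution_add:
  "distribution T \<Longrightarrow> test_fun \<phi> \<Longrightarrow> test_fun \<psi> \<Longrightarrow> T (\<lambda>x. \<phi> x + \<psi> x) = T \<phi> + T \<psi>"
  using distribution_linear[of T \<phi> \<psi> 1 1] by simp

lemma distribution_diff:
  "distribution T \<Longrightarrow> test_fun \<phi> \<Longrightarrow> test_fun \<psi> \<Longrightarrow> T (\<lambda>x. \<phi> x - \<psi> x) = T \<phi> - T \<psi>"
  using distribution_linear[of T \<phi> \<psi> 1 "- 1"] by simp

lemma distribution_cmult:
  "distribution T \<Longrightarrow> test_fun \<phi> \<Longrightarrow> T (\<lambda>x. a * \<phi> x) = of_real a * T \<phi>"
  using distribution_linear[of T \<phi> \<phi> a 0] by simp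

lemma distribution_sum:
  assumes "distribution T" "\<And>i. i \<in> I \<Longrightarrow> test_fun (\<phi> i)"
  shows "T (\<lambda>x. \<Sum>i\<in>I. \<phi> i x) = (\<Sum>i\<in>I. T (\<phi> i))"
  using assms(2)
  by (induction I rule: infinite_finite_induct)
     (auto simp: distribution_zero[OF assms(1)] distribution_add[OF assms(1)] test_fun_sum)

text \<open>Trades the sum of seminorms for one common bound \<open>B\<close> on the first
  derivatives, so that estimates can be checked pointwise; \<open>distributionI\<close> is the
  converse.\<close>

lemma distribution_boundE:
  assumes "distribution T"
  obtains C N where "C \<ge> 0"
    "\<And>\<phi> B. test_fun \<phi> \<Longrightarrow> (\<And>k x. k \<le> N \<Longrightarrow> \<bar>(deriv ^^ k) \<phi> x\<bar> \<le> B) \<Longrightarrow> norm (T \<phi>) \<le> C * B"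
proof -
  obtain C N where C: "\<And>\<phi>. test_fun \<phi> \<Longrightarrow> norm (T \<phi>) \<le> C * (\<Sum>k\<le>N. seminorm k \<phi>)"
    using assms unfolding distribution_def by blast
  have "norm (T \<phi>) \<le> (\<bar>C\<bar> * real (N + 1)) * B"
    if "test_fun \<phi>" "\<And>k x. k \<le> N \<Longrightarrow> \<bar>(deriv ^^ k) \<phi> x\<bar> \<le> B" for \<phi> B
  proof -
    have "norm (T \<phi>) \<le> C * (\<Sum>k\<le>N. seminorm k \<phi>)" by (rule C[OF that(1)])
    also have "\<dots> \<le> \<bar>C\<bar> * (\<Sum>k\<le>N. seminorm k \<phi>)"
      by (intro mult_right_mono sum_nonneg seminorm_nonneg that(1)) auto
    also have "\<dots> \<le> \<bar>C\<bar> * (\<Sum>k\<le>N. B)"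
      by (intro mult_left_mono sum_mono seminorm_le that(2)) auto
    finally show ?thesis by simp
  qed
  then show ?thesis by (intro that[of "\<bar>C\<bar> * real (N + 1)" N]) auto
qed

lemma distributionI:
  assumes "\<And>\<phi> \<psi> a b. test_fun \<phi> \<Longrightarrow> test_fun \<psi> \<Longrightarrow>
      T (\<lambda>x. a * \<phi> x + b * \<psi> x) = of_real a * T \<phi> + of_real b * T \<psi>"
    and bound: "\<And>\<phi> B. test_fun \<phi> \<Longrightarrow> B \<ge> 0 \<Longrightarrow> (\<And>k x. k \<le> N \<Longrightarrow> \<bar>(deriv ^^ k) \<phi> x\<bar> \<le> B) \<Longrightarrow> norm (T \<phi>) \<le> C * B"
  shows "distribution T"
  unfolding distribution_def
proof (intro conjI exI allI impI)
  fix \<phi> assume \<phi>: "test_fun \<phi>"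
  show "norm (T \<phi>) \<le> C * (\<Sum>k\<le>N. seminorm k \<phi>)"
  proof (rule bound[OF \<phi>])
    show "0 \<le> (\<Sum>k\<le>N. seminorm k \<phi>)" by (intro sum_nonneg seminorm_nonneg \<phi>)
    fix k x assume "k \<le> N"
    then show "\<bar>(deriv ^^ k) \<phi> x\<bar> \<le> (\<Sum>k\<le>N. seminorm k \<phi>)"
      using abs_le_seminorm[OF \<phi>, of k x] seminorm_nonneg[OF \<phi>]
        member_le_sum[of k "{..N}" "\<lambda>k. seminorm k \<phi>"] by fastforce
  qed
qed (use assms(1) in blast)

lemma distribution_lincomb:
  assumes "distribution S" "distribution T"
  shows "distribution (\<lambda>\<phi>. a * S \<phi> + b * T \<phi>)"
proof -
  obtain C N where C: "C \<ge> 0" "\<And>\<phi> B. test_fun \<phi> \<Longrightarrow> (\<And>k x. k \<le> N \<Longrightarrow> \<bar>(deriv ^^ k) \<phi> x\<bar> \<le> B) \<Longrightarrow> norm (S \<phi>) \<le> C * B"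
    using distribution_boundE[OF assms(1)] by blast
  obtain C' N' where C': "C' \<ge> 0" "\<And>\<phi> B. test_fun \<phi> \<Longrightarrow> (\<And>k x. k \<le> N' \<Longrightarrow> \<bar>(deriv ^^ k) \<phi> x\<bar> \<le> B) \<Longrightarrow> norm (T \<phi>) \<le> C' * B"
    using distribution_boundE[OF assms(2)] by blast
  show ?thesis
  proof (rule distributionI[where N = "max N N'" and C = "norm a * C + norm b * C'"])
    fix \<phi> and B :: real assume *: "test_fun \<phi>" "\<And>k x. k \<le> max N N' \<Longrightarrow> \<bar>(deriv ^^ k) \<phi> x\<bar> \<le> B"
    have "norm (S \<phi>) \<le> C * B" "norm (T \<phi>) \<le> C' * B" using C(2) C'(2) * by auto
    then have "norm a * norm (S \<phi>) + norm b * norm (T \<phi>) \<le> norm a * (C * B) + norm b * (C' * B)"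
      by (intro add_mono mult_left_mono) auto
    then show "norm (a * S \<phi> + b * T \<phi>) \<le> (norm a * C + norm b * C') * B"
      using norm_triangle_ineq[of "a * S \<phi>" "b * T \<phi>"] by (simp add: norm_mult algebra_simps)
  qed (simp add: distribution_linear[OF assms(1)] distribution_linear[OF assms(2)] algebra_simps)
qed

lemma distribution_affine:
  assumes "distribution T" "\<bar>m\<bar> = 1"
  shows "distribution (\<lambda>\<phi>. T (\<lambda>x. \<phi> (of_int m * x + c)))"
proof -
  obtain C N where C: "C \<ge> 0" "\<And>\<phi> B. test_fun \<phi> \<Longrightarrow> (\<And>k x. k \<le> N \<Longrightarrow> \<bar>(deriv ^^ k) \<phi> x\<bar> \<le> B) \<Longrightarrow> norm (T \<phi>) \<le> C * B"
    using distribution_boundE[OF assms(1)] by blast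
  have m: "\<bar>of_int m ^ k :: real\<bar> = 1" for k
    using assms(2) by (metis of_int_1 of_int_abs power_abs power_one)
  show ?thesis
  proof (rule distributionI)
    fix \<phi> and B :: real assume *: "test_fun \<phi>" "\<And>k x. k \<le> N \<Longrightarrow> \<bar>(deriv ^^ k) \<phi> x\<bar> \<le> B"
    show "norm (T (\<lambda>x. \<phi> (of_int m * x + c))) \<le> C * B"
      using * by (intro C(2) test_fun_affine)
        (auto simp: higher_deriv_affine test_fun_smooth abs_mult m)
  qed (rule distribution_linear[OF assms(1) test_fun_affine test_fun_affine])
qed

lemma distribution_dshift: "distribution T \<Longrightarrow> distribution (dshift y T)"
  unfolding dshift_def using distribution_affine[of T 1 y] by simp

lemma distribution_dreflect: "distribution T \<Longrightarrow> distribution (dreflect T)"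
  unfolding dreflect_def using distribution_affine[of T "- 1" 0] by simp

lemma distribution_mult:
  assumes "distribution T" "test_fun \<eta>"
  shows "distribution (\<lambda>\<phi>. T (\<lambda>x. \<eta> x * \<phi> x))"
proof -
  obtain C N where C: "C \<ge> 0" "\<And>\<phi> B. test_fun \<phi> \<Longrightarrow> (\<And>k x. k \<le> N \<Longrightarrow> \<bar>(deriv ^^ k) \<phi> x\<bar> \<le> B) \<Longrightarrow> norm (T \<phi>) \<le> C * B"
    using distribution_boundE[OF assms(1)] by blast
  obtain A where A: "A \<ge> 0" "\<And>k x. k \<le> N \<Longrightarrow> \<bar>(deriv ^^ k) \<eta> x\<bar> \<le> A"
    using test_fun_derivs_bounded[OF assms(2)] by blast
  show ?thesis
  proof (rule distributionI[where N = N and C = "C * (2 ^ N * A)"])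
    fix \<phi> \<psi> and a b :: real assume *: "test_fun \<phi>" "test_fun \<psi>"
    have "T (\<lambda>x. a * (\<eta> x * \<phi> x) + b * (\<eta> x * \<psi> x)) =
        of_real a * T (\<lambda>x. \<eta> x * \<phi> x) + of_real b * T (\<lambda>x. \<eta> x * \<psi> x)"
      by (intro distribution_linear assms test_fun_mult *)
    then show "T (\<lambda>x. \<eta> x * (a * \<phi> x + b * \<psi> x)) =
        of_real a * T (\<lambda>x. \<eta> x * \<phi> x) + of_real b * T (\<lambda>x. \<eta> x * \<psi> x)"
      by (simp add: algebra_simps)
  next
    fix \<phi> and B :: real assume *: "test_fun \<phi>" "B \<ge> 0" "\<And>k x. k \<le> N \<Longrightarrow> \<bar>(deriv ^^ k) \<phi> x\<bar> \<le> B"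
    have "norm (T (\<lambda>x. \<eta> x * \<phi> x)) \<le> C * (2 ^ N * A * B)"
    proof (intro C(2) test_fun_mult assms *)
      fix k x assume k: "k \<le> N"
      have "\<bar>(deriv ^^ k) (\<lambda>x. \<eta> x * \<phi> x) x\<bar> \<le> 2 ^ k * A * B"
        using k A * assms(2) by (intro higher_deriv_mult_bound test_fun_smooth) auto
      also have "\<dots> \<le> 2 ^ N * A * B"
        using k A * by (intro mult_right_mono power_increasing) auto
      finally show "\<bar>(deriv ^^ k) (\<lambda>x. \<eta> x * \<phi> x) x\<bar> \<le> 2 ^ N * A * B" .
    qed
    then show "norm (T (\<lambda>x. \<eta> x * \<phi> x)) \<le> C * (2 ^ N * A) * B" by (simp add: mult_ac)
  qed
qed

subsection \<open>Localisation\<close>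

text \<open>Stands in for statements about supports: it lets integrands be exchanged when they agree
  on \<open>U\<close>. It is used with open neighbourhoods \<open>U\<close> of the support; for the
  support itself it can fail, since a derivative of a Dirac measure sees more than values at the
  point.\<close>

definition vanishes_off :: "((real \<Rightarrow> real) \<Rightarrow> complex) \<Rightarrow> real set \<Rightarrow> bool" where
  "vanishes_off T U \<longleftrightarrow> (\<forall>\<phi>. test_fun \<phi> \<longrightarrow> (\<forall>x\<in>U. \<phi> x = 0) \<longrightarrow> T \<phi> = 0)"

lemma vanishes_offD: "vanishes_off T U \<Longrightarrow> test_fun \<phi> \<Longrightarrow> (\<And>x. x \<in> U \<Longrightarrow> \<phi> x = 0) \<Longrightarrow> T \<phi> = 0"
  by (simp add: vanishes_off_def)

lemma vanishes_off_eq: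
  assumes "distribution T" "vanishes_off T U" "test_fun \<phi>" "test_fun \<psi>" "\<And>x. x \<in> U \<Longrightarrow> \<phi> x = \<psi> x"
  shows "T \<phi> = T \<psi>"
proof -
  have "T (\<lambda>x. \<phi> x - \<psi> x) = 0"
    by (rule vanishes_offD[OF assms(2)]) (use assms in \<open>auto intro: test_fun_diff\<close>)
  then show ?thesis using distribution_diff[OF assms(1,3,4)] by simp
qed

text \<open>By a Lebesgue number for the cover of \<open>[-1, 8]\<close>, every piece of a
  sufficiently fine partition of unity fits into one of the balls on which the hypothesis applies.
  Then \<open>\<phi>\<close> is a finite sum of products that \<open>T\<close> annihilates.\<close>

lemma locally_zero_imp_zero:
  assumes T: "distribution T" and \<phi>: "test_fun \<phi>"
    and loc: "\<And>x. \<exists>e>0. \<forall>\<psi>. test_fun \<psi> \<longrightarrow>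
       (\<forall>t. \<psi> t \<noteq> 0 \<longrightarrow> (\<exists>k::int. \<bar>t - x - 2 * pi * of_int k\<bar> < e)) \<longrightarrow> T (\<lambda>t. \<psi> t * \<phi> t) = 0"
  shows "T \<phi> = 0"
proof -
  obtain e where e: "\<And>x. e x > 0"
    "\<And>x \<psi>. test_fun \<psi> \<Longrightarrow> (\<And>t. \<psi> t \<noteq> 0 \<Longrightarrow> (\<exists>k::int. \<bar>t - x - 2 * pi * of_int k\<bar> < e x)) \<Longrightarrow> T (\<lambda>t. \<psi> t * \<phi> t) = 0"
    using loc by metis
  let ?\<C> = "range (\<lambda>x. ball x (e x))"
  have cover: "{-1..8} \<subseteq> \<Union>?\<C>" using e(1) centre_in_ball by blast
  have cover_nonempty: "?\<C> \<noteq> {}" and cover_open: "\<And>B. B \<in> ?\<C> \<Longrightarrow> open B" by auto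
  obtain \<delta> where \<delta>: "0 < \<delta>" "\<And>A. A \<subseteq> {-1..8} \<Longrightarrow> diameter A < \<delta> \<Longrightarrow> \<exists>B\<in>?\<C>. A \<subseteq> B"
    using Lebesgue_number_lemma[OF compact_Icc cover_nonempty cover cover_open] by metis
  obtain w :: "nat \<Rightarrow> real \<Rightarrow> real" and c d :: "nat \<Rightarrow> real" and n where
    w: "\<And>j. test_fun (w j)" and w1: "\<And>x. (\<Sum>j<n. w j x) = 1"
    and ws: "\<And>j x. w j x \<noteq> 0 \<Longrightarrow> \<exists>k::int. c j < x + 2 * pi * of_int k \<and> x + 2 * pi * of_int k < d j"
    and cd: "\<And>j. j < n \<Longrightarrow> -1 \<le> c j \<and> d j \<le> 8 \<and> c j \<le> d j \<and> d j - c j < \<delta>"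
    using fine_partition_of_unity[OF \<delta>(1)] by metis
  have "T (\<lambda>t. w j t * \<phi> t) = 0" if j: "j < n" for j
  proof -
    have "{c j..d j} \<subseteq> {-1..8}" "diameter {c j..d j} < \<delta>"
      using cd[OF j] by (auto simp: diameter_closed_interval)
    then obtain x where x: "{c j..d j} \<subseteq> ball x (e x)" using \<delta>(2) by blast
    show ?thesis
    proof (rule e(2)[OF w])
      fix t assume "w j t \<noteq> 0"
      then obtain k :: int where "c j < t + 2 * pi * of_int k" "t + 2 * pi * of_int k < d j" using ws by blast
      then have "t + 2 * pi * of_int k \<in> ball x (e x)" by (intro subsetD[OF x]) auto
      then have "\<bar>t - x - 2 * pi * of_int (- k)\<bar> < e x" by (simp add: dist_real_def algebra_simps)
      then show "\<exists>k::int. \<bar>t - x - 2 * pi * of_int k\<bar> < e x" by blast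
    qed
  qed
  then have "(\<Sum>j<n. T (\<lambda>t. w j t * \<phi> t)) = 0" by simp
  moreover have "(\<Sum>j<n. T (\<lambda>t. w j t * \<phi> t)) = T (\<lambda>t. \<Sum>j<n. w j t * \<phi> t)"
    by (rule distribution_sum[OF T, symmetric]) (intro test_fun_mult w \<phi>)
  moreover have "(\<lambda>t. \<Sum>j<n. w j t * \<phi> t) = \<phi>"
    by (simp add: sum_distrib_right[symmetric] w1)
  ultimately show ?thesis by simp
qed

text \<open>Near a point of \<open>U\<close> the localised product is identically zero; near any
  other point \<open>T\<close> itself annihilates it, as the point lies outside the support.\<close>

lemma vanishes_off_neighbourhood:
  assumes T: "distribution T" and U: "open U" "dsupp T \<subseteq> U"
  shows "vanishes_off T U"
  unfolding vanishes_off_def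
proof (intro allI impI)
  fix \<phi> assume \<phi>: "test_fun \<phi>" and 0: "\<forall>x\<in>U. \<phi> x = 0"
  show "T \<phi> = 0"
  proof (rule locally_zero_imp_zero[OF T \<phi>])
    fix x
    show "\<exists>e>0. \<forall>\<psi>. test_fun \<psi> \<longrightarrow>
       (\<forall>t. \<psi> t \<noteq> 0 \<longrightarrow> (\<exists>k::int. \<bar>t - x - 2 * pi * of_int k\<bar> < e)) \<longrightarrow> T (\<lambda>t. \<psi> t * \<phi> t) = 0"
    proof (cases "x \<in> U")
      case True
      then obtain e where e: "e > 0" "ball x e \<subseteq> U" using U(1) openE by blast
      have *: "\<psi> t * \<phi> t = 0" if "\<forall>t. \<psi> t \<noteq> 0 \<longrightarrow> (\<exists>k::int. \<bar>t - x - 2 * pi * of_int k\<bar> < e)" for \<psi> :: "real \<Rightarrow> real" and t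
      proof (cases "\<psi> t = 0")
        case False
        then obtain k :: int where "\<bar>t - x - 2 * pi * of_int k\<bar> < e" using \<open>\<forall>t. \<psi> t \<noteq> 0 \<longrightarrow> _\<close> by blast
        then have "t + 2 * pi * of_int (- k) \<in> U" using e(2) by (auto simp: dist_real_def subset_iff)
        then show ?thesis using 0 test_fun_periodic[OF \<phi>, of t "- k"] by simp
      qed simp
      show ?thesis
      proof (intro exI[of _ e] conjI allI impI e(1))
        fix \<psi> :: "real \<Rightarrow> real" assume "\<forall>t. \<psi> t \<noteq> 0 \<longrightarrow> (\<exists>k::int. \<bar>t - x - 2 * pi * of_int k\<bar> < e)"
        then have "(\<lambda>t. \<psi> t * \<phi> t) = (\<lambda>t. 0)" using * by blast
        then show "T (\<lambda>t. \<psi> t * \<phi> t) = 0" using distribution_zero[OF T] by simp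
      qed
    next
      case False
      then have "x \<notin> dsupp T" using U(2) by blast
      then obtain e where "e > 0" "\<And>\<psi>. test_fun \<psi> \<Longrightarrow>
          (\<forall>t. \<psi> t \<noteq> 0 \<longrightarrow> (\<exists>k::int. \<bar>t - x - 2 * pi * of_int k\<bar> < e)) \<Longrightarrow> T \<psi> = 0"
        unfolding dsupp_def by blast
      then show ?thesis using test_fun_mult[OF _ \<phi>] by (intro exI[of _ e]) auto
    qed
  qed
qed

subsection \<open>Convolution\<close>

text \<open>The mean value inequality is used twice, first for \<open>g'\<close> and then for
  \<open>g\<close> minus its linear part. This loses a factor \<open>2\<close> against Taylor's
  formula, which does no harm.\<close>

lemma second_order_bound:
  fixes g g' g'' :: "real \<Rightarrow> real"
  assumes g: "\<And>x. (g has_real_derivative g' x) (at x)" and g': "\<And>x. (g' has_real_derivative g'' x) (at x)"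
    and B: "\<And>x. \<bar>g'' x\<bar> \<le> B"
  shows "\<bar>g (t + h) - g t - h * g' t\<bar> \<le> B * h\<^sup>2"
proof -
  have lip: "\<bar>g' s - g' t\<bar> \<le> B * \<bar>s - t\<bar>" for s
    using field_differentiable_bound[of UNIV g' g'' B s t] g' B by (simp add: has_field_derivative_at_within)
  let ?k = "\<lambda>s. g s - s * g' t"
  have k: "(?k has_real_derivative g' s - 1 * g' t) (at s)" for s
    by (intro DERIV_diff g) (auto intro!: derivative_eq_intros)
  have "norm (?k (t + h) - ?k t) \<le> (B * \<bar>h\<bar>) * norm (t + h - t)"
  proof (rule field_differentiable_bound[of "cball t \<bar>h\<bar>"])
    fix s assume "s \<in> cball t \<bar>h\<bar>"
    then have "B * \<bar>s - t\<bar> \<le> B * \<bar>h\<bar>"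
      using B[of 0] by (intro mult_left_mono) (auto simp: dist_real_def)
    then show "norm (g' s - 1 * g' t) \<le> B * \<bar>h\<bar>" using lip[of s] by simp
  qed (use k in \<open>auto simp: has_field_derivative_at_within dist_real_def\<close>)
  then show ?thesis by (simp add: algebra_simps power2_eq_square)
qed

text \<open>The continuity estimate of \<open>G\<close> is applied to the remainder of the linear
  approximation in \<open>h\<close>. Its derivatives up to order \<open>N\<close> are uniformly of
  size \<open>h\<^sup>2\<close>, because those of \<open>\<phi>\<close> are bounded up to order
  \<open>N + 2\<close>.\<close>

lemma distribution_translate_has_derivative:
  assumes G: "distribution G" and \<phi>: "test_fun \<phi>"
  shows "((\<lambda>x. G (\<lambda>y. \<phi> (x + y))) has_vector_derivative G (\<lambda>y. deriv \<phi> (x + y))) (at x)"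
proof -
  obtain C N where C: "C \<ge> 0" "\<And>\<phi> B. test_fun \<phi> \<Longrightarrow> (\<And>k x. k \<le> N \<Longrightarrow> \<bar>(deriv ^^ k) \<phi> x\<bar> \<le> B) \<Longrightarrow> norm (G \<phi>) \<le> C * B"
    using distribution_boundE[OF G] by blast
  obtain B where B: "B \<ge> 0" "\<And>k x. k \<le> N + 2 \<Longrightarrow> \<bar>(deriv ^^ k) \<phi> x\<bar> \<le> B"
    using test_fun_derivs_bounded[OF \<phi>] by blast
  note sm = test_fun_smooth[OF \<phi>]
  have \<phi>': "test_fun (deriv \<phi>)" using test_fun_higher_deriv[OF \<phi>, of 1] by simp
  have tests: "test_fun (\<lambda>y. \<phi> (z + y))" "test_fun (\<lambda>y. deriv \<phi> (z + y))" for z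
    by (intro test_fun_shift' \<phi> \<phi>')+
  have le: "norm (G (\<lambda>y. \<phi> (x + h + y)) - G (\<lambda>y. \<phi> (x + y)) - h *\<^sub>R G (\<lambda>y. deriv \<phi> (x + y))) \<le> C * B * h\<^sup>2" for h
  proof -
    let ?\<psi> = "\<lambda>y. (\<phi> (x + h + y) - \<phi> (x + y)) - h * deriv \<phi> (x + y)"
    have eq: "G ?\<psi> = G (\<lambda>y. \<phi> (x + h + y)) - G (\<lambda>y. \<phi> (x + y)) - h *\<^sub>R G (\<lambda>y. deriv \<phi> (x + y))"
      by (simp add: distribution_diff[OF G] distribution_cmult[OF G] tests test_fun_diff test_fun_cmult
          scaleR_conv_of_real)
    have "norm (G ?\<psi>) \<le> C * (B * h\<^sup>2)"
    proof (rule C(2))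
      show "test_fun ?\<psi>" by (intro test_fun_diff test_fun_cmult tests)
      fix k y assume k: "k \<le> N"
      have sh: "(deriv ^^ k) (\<lambda>y. \<theta> (z + y)) y = (deriv ^^ k) \<theta> (z + y)" if "smooth \<theta>" for \<theta> z
        using higher_deriv_affine[OF that, of k 1 z] by (simp add: add.commute)
      have "(deriv ^^ k) ?\<psi> y = (deriv ^^ k) (\<lambda>y. \<phi> (x + h + y) - \<phi> (x + y)) y - (deriv ^^ k) (\<lambda>y. h * deriv \<phi> (x + y)) y"
        by (rule fun_cong[OF smooth_higher_deriv_diff]) (intro test_fun_smooth test_fun_diff test_fun_cmult tests)+
      also have "(deriv ^^ k) (\<lambda>y. \<phi> (x + h + y) - \<phi> (x + y)) y = (deriv ^^ k) \<phi> (x + h + y) - (deriv ^^ k) \<phi> (x + y)"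
        using fun_cong[OF smooth_higher_deriv_diff[of "\<lambda>y. \<phi> (x + h + y)" "\<lambda>y. \<phi> (x + y)" k], of y]
          sh[OF sm, of "x + h"] sh[OF sm, of x] test_fun_smooth[OF tests(1)] by simp
      also have "(deriv ^^ k) (\<lambda>y. h * deriv \<phi> (x + y)) y = h * (deriv ^^ Suc k) \<phi> (x + y)"
        using higher_deriv_lincomb[of "\<lambda>y. deriv \<phi> (x + y)" "\<lambda>y. deriv \<phi> (x + y)" k h 0]
          test_fun_smooth[OF tests(2)] sh[of "deriv \<phi>" x] smooth_deriv[OF sm] higher_deriv_deriv[of k \<phi>]
        by simp
      finally have "(deriv ^^ k) ?\<psi> y = (deriv ^^ k) \<phi> (x + y + h) - (deriv ^^ k) \<phi> (x + y) - h * (deriv ^^ Suc k) \<phi> (x + y)"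
        by (simp add: add_ac)
      also have "\<bar>\<dots>\<bar> \<le> B * h\<^sup>2"
        by (rule second_order_bound[where g'' = "(deriv ^^ Suc (Suc k)) \<phi>"])
           (use smooth_has_derivative[OF sm] B(2)[of "Suc (Suc k)"] k in \<open>auto simp del: funpow.simps\<close>)
      finally show "\<bar>(deriv ^^ k) ?\<psi> y\<bar> \<le> B * h\<^sup>2" .
    qed
    then show ?thesis unfolding eq by (simp add: mult_ac)
  qed
  show ?thesis
    unfolding has_vector_derivative_def has_derivative_at
  proof (intro conjI bounded_linear_scaleR_left)
    show "(\<lambda>h. norm (G (\<lambda>y. \<phi> (x + h + y)) - G (\<lambda>y. \<phi> (x + y)) - h *\<^sub>R G (\<lambda>y. deriv \<phi> (x + y))) / norm h) \<midarrow>0\<rightarrow> 0"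
    proof (rule Lim_null_comparison)
      show "((\<lambda>h. C * B * \<bar>h\<bar>) \<longlongrightarrow> 0) (at (0::real))"
        by (auto intro!: tendsto_eq_intros)
      show "\<forall>\<^sub>F h in at 0. norm (norm (G (\<lambda>y. \<phi> (x + h + y)) - G (\<lambda>y. \<phi> (x + y)) - h *\<^sub>R G (\<lambda>y. deriv \<phi> (x + y))) / norm h) \<le> C * B * \<bar>h\<bar>"
        unfolding eventually_at_filter
      proof (intro always_eventually allI impI)
        fix h :: real assume "h \<noteq> 0"
        then show "norm (norm (G (\<lambda>y. \<phi> (x + h + y)) - G (\<lambda>y. \<phi> (x + y)) - h *\<^sub>R G (\<lambda>y. deriv \<phi> (x + y))) / norm h) \<le> C * B * \<bar>h\<bar>"
          using le[of h] by (simp add: divide_le_eq power2_eq_square mult_ac flip: abs_mult)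
      qed
    qed
  qed
qed

text \<open>The functional \<open>L\<close> stands for \<open>Re\<close> or \<open>Im\<close>: the
  outer distribution of a convolution acts on real functions, so both parts must be test functions,
  and one argument serves both.\<close>

lemma distribution_translate_smooth:
  fixes L :: "complex \<Rightarrow> real"
  assumes G: "distribution G" and L: "bounded_linear L" and \<phi>: "test_fun \<phi>"
  shows "test_fun (\<lambda>x. L (G (\<lambda>y. \<phi> (x + y))))"
    and "(deriv ^^ k) (\<lambda>x. L (G (\<lambda>y. \<phi> (x + y)))) = (\<lambda>x. L (G (\<lambda>y. (deriv ^^ k) \<phi> (x + y))))"
proof -
  have der: "((\<lambda>x. L (G (\<lambda>y. \<phi> (x + y)))) has_real_derivative L (G (\<lambda>y. deriv \<phi> (x + y)))) (at x)"
    if "test_fun \<phi>" for \<phi> x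
    using bounded_linear.has_vector_derivative[OF L distribution_translate_has_derivative[OF G that, of x]]
    by (simp add: has_real_derivative_iff_has_vector_derivative)
  show "test_fun (\<lambda>x. L (G (\<lambda>y. \<phi> (x + y))))"
  proof (rule test_funI)
    show "smooth (\<lambda>x. L (G (\<lambda>y. \<phi> (x + y))))"
    proof (rule smooth_coinduct[of _ "(\<lambda>\<phi> x. L (G (\<lambda>y. \<phi> (x + y)))) ` Collect test_fun"])
      fix g assume "g \<in> (\<lambda>\<phi> x. L (G (\<lambda>y. \<phi> (x + y)))) ` Collect test_fun"
      then obtain \<psi> where \<psi>: "test_fun \<psi>" "g = (\<lambda>x. L (G (\<lambda>y. \<psi> (x + y))))" by blast
      then show "\<exists>g'\<in>(\<lambda>\<phi> x. L (G (\<lambda>y. \<phi> (x + y)))) ` Collect test_fun. \<forall>x. (g has_real_derivative g' x) (at x)"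
        using der[OF \<psi>(1)] test_fun_higher_deriv[OF \<psi>(1), of 1] by auto
    qed (use \<phi> in auto)
    show "L (G (\<lambda>y. \<phi> (x + 2 * pi + y))) = L (G (\<lambda>y. \<phi> (x + y)))" for x
    proof -
      have "\<phi> (x + 2 * pi + y) = \<phi> (x + y)" for y
        using \<phi> by (simp add: test_fun_iff add.assoc add.commute[of "2 * pi"]) (metis add.assoc)
      then show ?thesis by simp
    qed
  qed
  show "(deriv ^^ k) (\<lambda>x. L (G (\<lambda>y. \<phi> (x + y)))) = (\<lambda>x. L (G (\<lambda>y. (deriv ^^ k) \<phi> (x + y))))"
  proof (induction k)
    case (Suc k)
    have "deriv (\<lambda>x. L (G (\<lambda>y. (deriv ^^ k) \<phi> (x + y)))) = (\<lambda>x. L (G (\<lambda>y. deriv ((deriv ^^ k) \<phi>) (x + y))))"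
      by (intro ext DERIV_imp_deriv der test_fun_higher_deriv \<phi>)
    then show ?case using Suc by simp
  qed simp
qed

definition complex_test_fun :: "(real \<Rightarrow> complex) \<Rightarrow> bool" where
  "complex_test_fun h \<longleftrightarrow> test_fun (\<lambda>x. Re (h x)) \<and> test_fun (\<lambda>x. Im (h x))"

text \<open>Names the extension hidden in \<open>dconv\<close>, so that complex linearity in the
  outer variable becomes available for calculation.\<close>

definition complex_ext :: "((real \<Rightarrow> real) \<Rightarrow> complex) \<Rightarrow> (real \<Rightarrow> complex) \<Rightarrow> complex" where
  "complex_ext F h = F (\<lambda>x. Re (h x)) + \<i> * F (\<lambda>x. Im (h x))"

lemma complex_test_fun_of_real: "test_fun \<phi> \<Longrightarrow> complex_test_fun (\<lambda>x. of_real (\<phi> x))"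
  by (simp add: complex_test_fun_def test_fun_const)

lemma complex_test_fun_add:
  "complex_test_fun h \<Longrightarrow> complex_test_fun k \<Longrightarrow> complex_test_fun (\<lambda>x. h x + k x)"
  by (simp add: complex_test_fun_def test_fun_add)

lemma complex_test_fun_cmult: "complex_test_fun h \<Longrightarrow> complex_test_fun (\<lambda>x. c * h x)"
  by (simp add: complex_test_fun_def test_fun_add test_fun_diff test_fun_cmult)

lemma complex_test_fun_sum:
  "(\<And>i. i \<in> I \<Longrightarrow> complex_test_fun (h i)) \<Longrightarrow> complex_test_fun (\<lambda>x. \<Sum>i\<in>I. h i x)"
  by (simp add: complex_test_fun_def test_fun_sum)

lemma complex_test_fun_shift: "complex_test_fun h \<Longrightarrow> complex_test_fun (\<lambda>x. h (x + y))"
  using test_fun_shift[of "\<lambda>x. Re (h x)" y] test_fun_shift[of "\<lambda>x. Im (h x)" y]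
  by (simp add: complex_test_fun_def)

lemma complex_ext_of_real: "distribution F \<Longrightarrow> complex_ext F (\<lambda>x. of_real (\<phi> x)) = F \<phi>"
  by (simp add: complex_ext_def distribution_zero)

lemma complex_ext_add:
  assumes "distribution F" "complex_test_fun h" "complex_test_fun k"
  shows "complex_ext F (\<lambda>x. h x + k x) = complex_ext F h + complex_ext F k"
  using assms by (simp add: complex_ext_def complex_test_fun_def distribution_add[OF assms(1)] algebra_simps)

lemma complex_ext_cmult:
  assumes "distribution F" "complex_test_fun h"
  shows "complex_ext F (\<lambda>x. c * h x) = c * complex_ext F h"
proof -
  have "complex_ext F (\<lambda>x. c * h x) = (of_real (Re c) * F (\<lambda>x. Re (h x)) - of_real (Im c) * F (\<lambda>x. Im (h x)))
     + \<i> * (of_real (Re c) * F (\<lambda>x. Im (h x)) + of_real (Im c) * F (\<lambda>x. Re (h x)))"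
    using assms
    by (simp add: complex_ext_def complex_test_fun_def distribution_add[OF assms(1)]
        distribution_diff[OF assms(1)] distribution_cmult[OF assms(1)] test_fun_cmult)
  also have "\<dots> = (of_real (Re c) + \<i> * of_real (Im c)) * complex_ext F h"
    by (simp add: complex_ext_def algebra_simps)
  finally show ?thesis by (simp flip: complex_eq)
qed

lemma complex_ext_sum:
  assumes "distribution F" "\<And>i. i \<in> I \<Longrightarrow> complex_test_fun (h i)"
  shows "complex_ext F (\<lambda>x. \<Sum>i\<in>I. h i x) = (\<Sum>i\<in>I. complex_ext F (h i))"
  using assms by (simp add: complex_ext_def complex_test_fun_def distribution_sum[OF assms(1)] sum.distrib sum_distrib_left)

lemma complex_ext_cong:
  assumes "distribution F" "vanishes_off F U" "complex_test_fun h" "complex_test_fun k" "\<And>x. x \<in> U \<Longrightarrow> h x = k x"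
  shows "complex_ext F h = complex_ext F k"
  using assms vanishes_off_eq[OF assms(1,2), of "\<lambda>x. Re (h x)" "\<lambda>x. Re (k x)"]
    vanishes_off_eq[OF assms(1,2), of "\<lambda>x. Im (h x)" "\<lambda>x. Im (k x)"]
  by (simp add: complex_ext_def complex_test_fun_def)

lemma dconv_eq: "dconv F G \<phi> = complex_ext F (\<lambda>x. G (\<lambda>y. \<phi> (x + y)))"
  by (simp add: dconv_def complex_ext_def)

lemma dconv_dreflect_eq: "dconv F (dreflect G) \<phi> = complex_ext F (\<lambda>x. G (\<lambda>y. \<phi> (x - y)))"
  by (simp add: dconv_eq dreflect_def)

lemma complex_test_fun_translate:
  "distribution G \<Longrightarrow> test_fun \<phi> \<Longrightarrow> complex_test_fun (\<lambda>x. G (\<lambda>y. \<phi> (x + y)))"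
  by (simp add: complex_test_fun_def distribution_translate_smooth(1) bounded_linear_Re bounded_linear_Im)

lemma complex_test_fun_translate_reflect:
  "distribution G \<Longrightarrow> test_fun \<phi> \<Longrightarrow> complex_test_fun (\<lambda>x. G (\<lambda>y. \<phi> (x - y)))"
  using complex_test_fun_translate[OF distribution_dreflect, of G \<phi>] by (simp add: dreflect_def)

lemma distribution_dconv:
  assumes F: "distribution F" and G: "distribution G"
  shows "distribution (dconv F G)"
proof -
  obtain C N where C: "C \<ge> 0" "\<And>\<phi> B. test_fun \<phi> \<Longrightarrow> (\<And>k x. k \<le> N \<Longrightarrow> \<bar>(deriv ^^ k) \<phi> x\<bar> \<le> B) \<Longrightarrow> norm (F \<phi>) \<le> C * B"
    using distribution_boundE[OF F] by blast
  obtain C' N' where C': "C' \<ge> 0" "\<And>\<phi> B. test_fun \<phi> \<Longrightarrow> (\<And>k x. k \<le> N' \<Longrightarrow> \<bar>(deriv ^^ k) \<phi> x\<bar> \<le> B) \<Longrightarrow> norm (G \<phi>) \<le> C' * B"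
    using distribution_boundE[OF G] by blast
  show ?thesis
  proof (rule distributionI[where N = "N' + N" and C = "2 * C * C'"])
    fix \<phi> \<psi> and a b :: real assume *: "test_fun \<phi>" "test_fun \<psi>"
    have "(\<lambda>x. G (\<lambda>y. a * \<phi> (x + y) + b * \<psi> (x + y))) =
      (\<lambda>x. of_real a * G (\<lambda>y. \<phi> (x + y)) + of_real b * G (\<lambda>y. \<psi> (x + y)))"
      by (intro ext distribution_linear G test_fun_shift' *)
    then show "dconv F G (\<lambda>x. a * \<phi> x + b * \<psi> x) = of_real a * dconv F G \<phi> + of_real b * dconv F G \<psi>"
      by (simp add: dconv_eq complex_ext_add complex_ext_cmult F G * complex_test_fun_cmult complex_test_fun_translate)
  next
    fix \<phi> and B :: real assume *: "test_fun \<phi>" "B \<ge> 0" "\<And>k x. k \<le> N' + N \<Longrightarrow> \<bar>(deriv ^^ k) \<phi> x\<bar> \<le> B"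
    \<comment> \<open>Derivatives demanded by \<open>F\<close> and by \<open>G\<close> fall on the
      same \<open>\<phi>\<close>, so the orders add up to \<open>N' + N\<close>. The factor
      \<open>2\<close> in the final constant accounts for the real and imaginary parts.\<close>
    have G_le: "norm (G (\<lambda>y. (deriv ^^ k) \<phi> (x + y))) \<le> C' * B" if "k \<le> N" for k x
    proof (intro C'(2) test_fun_shift' test_fun_higher_deriv *)
      fix j y assume "j \<le> N'"
      then show "\<bar>(deriv ^^ j) (\<lambda>y. (deriv ^^ k) \<phi> (x + y)) y\<bar> \<le> B"
        using higher_deriv_affine[OF smooth_higher_deriv[OF test_fun_smooth[OF *(1)]], of j k 1 x]
          *(3)[of "j + k" "x + y"] that
        by (simp add: funpow_add add.commute)
    qed
    have L_le: "norm (F (\<lambda>x. L (G (\<lambda>y. \<phi> (x + y))))) \<le> C * (C' * B)"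
      if L: "bounded_linear L" "\<And>z. \<bar>L z\<bar> \<le> norm z" for L
    proof (rule C(2)[OF distribution_translate_smooth(1)[OF G L(1) *(1)]])
      fix k x assume "k \<le> N"
      then show "\<bar>(deriv ^^ k) (\<lambda>x. L (G (\<lambda>y. \<phi> (x + y)))) x\<bar> \<le> C' * B"
        unfolding distribution_translate_smooth(2)[OF G L(1) *(1)] using G_le L(2) order_trans by blast
    qed
    have "norm (dconv F G \<phi>) \<le> norm (F (\<lambda>x. Re (G (\<lambda>y. \<phi> (x + y))))) + norm (F (\<lambda>x. Im (G (\<lambda>y. \<phi> (x + y)))))"
      unfolding dconv_def by (metis norm_ii norm_mult mult_1 norm_triangle_ineq)
    also have "\<dots> \<le> C * (C' * B) + C * (C' * B)"
      by (intro add_mono L_le bounded_linear_Re bounded_linear_Im abs_Re_le_cmod abs_Im_le_cmod)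
    finally show "norm (dconv F G \<phi>) \<le> 2 * C * C' * B" by (simp add: mult_ac)
  qed
qed

section \<open>Polynomial approximation of smooth functions\<close>

lemma higher_deriv_monomial:
  "(deriv ^^ k) (\<lambda>x::real. x ^ n) = (\<lambda>x. if k \<le> n then fact n / fact (n - k) * x ^ (n - k) else 0)"
proof (induction k)
  case (Suc k)
  have "((\<lambda>x::real. if k \<le> n then fact n / fact (n - k) * x ^ (n - k) else 0) has_real_derivative
     (if Suc k \<le> n then fact n / fact (n - Suc k) * x ^ (n - Suc k) else 0)) (at x)" for x
  proof (cases "Suc k \<le> n")
    case True
    then have *: "n - k = Suc (n - Suc k)" by simp
    have "((\<lambda>x::real. fact n / fact (n - k) * x ^ (n - k)) has_real_derivative
        fact n / fact (n - k) * (real (n - k) * x ^ (n - Suc k))) (at x)"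
      using DERIV_cmult[OF DERIV_pow[of "n - k" x UNIV], of "fact n / fact (n - k)"] by simp
    moreover have "fact n / fact (n - k) * (real (n - k) * x ^ (n - Suc k)) = fact n / fact (n - Suc k) * x ^ (n - Suc k)"
      unfolding * by (simp add: fact_Suc del: of_nat_Suc)
    ultimately show ?thesis using True by simp
  next
    case False
    then show ?thesis by (cases "k = n") auto
  qed
  then show ?case unfolding funpow.simps o_def Suc.IH by (intro ext DERIV_imp_deriv)
qed simp

text \<open>The quotient of factorials is \<open>k!\<close> times a binomial coefficient, hence at
  most \<open>N! * 2 ^ n\<close>, and the remaining power of \<open>x\<close> contributes another
  \<open>2 ^ n\<close>. Growth that is only exponential in \<open>n\<close> is what gives the moment
  series exponential type.\<close>

lemma higher_deriv_monomial_bound: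
  assumes "\<bar>x\<bar> \<le> 2" "k \<le> N"
  shows "\<bar>(deriv ^^ k) (\<lambda>x::real. x ^ n) x\<bar> \<le> fact N * 4 ^ n"
proof (cases "k \<le> n")
  case True
  have "fact n / fact (n - k) = fact k * real (n choose k)"
    using True by (simp add: binomial_fact)
  also have "\<dots> \<le> fact N * 2 ^ n"
  proof (rule mult_mono)
    show "real (n choose k) \<le> 2 ^ n"
      using binomial_le_pow2[of n k] by (metis of_nat_le_iff of_nat_numeral of_nat_power)
  qed (use fact_mono[OF assms(2)] in auto)
  finally have 1: "fact n / fact (n - k) \<le> (fact N * 2 ^ n :: real)" .
  have "\<bar>x\<bar> ^ (n - k) \<le> 2 ^ (n - k)" using assms(1) by (intro power_mono) auto
  also have "\<dots> \<le> (2::real) ^ n" by (intro power_increasing) auto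
  finally have "fact n / fact (n - k) * \<bar>x\<bar> ^ (n - k) \<le> (fact N * 2 ^ n) * 2 ^ n"
    using 1 by (intro mult_mono) auto
  then show ?thesis using True
    by (simp add: higher_deriv_monomial abs_mult power_abs mult.assoc flip: power_mult_distrib)
qed (simp add: higher_deriv_monomial)

lemma higher_deriv_sum:
  assumes "\<And>i. i \<in> I \<Longrightarrow> smooth (\<phi> i)"
  shows "(deriv ^^ k) (\<lambda>x. \<Sum>i\<in>I. a i * \<phi> i x) = (\<lambda>x. \<Sum>i\<in>I. a i * (deriv ^^ k) (\<phi> i) x)"
  using assms
proof (induction I rule: infinite_finite_induct)
  case (insert j I)
  have "(deriv ^^ k) (\<lambda>x. a j * \<phi> j x + 1 * (\<Sum>i\<in>I. a i * \<phi> i x)) =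
      (\<lambda>x. a j * (deriv ^^ k) (\<phi> j) x + 1 * (deriv ^^ k) (\<lambda>x. \<Sum>i\<in>I. a i * \<phi> i x) x)"
    using insert.prems by (intro higher_deriv_lincomb smooth_sum smooth_cmult) auto
  then show ?case using insert by simp
next
  case (infinite I)
  then show ?case by (simp add: higher_deriv_zero)
next
  case empty
  then show ?case by (simp add: higher_deriv_zero)
qed

text \<open>Induction on the order: approximate the derivative by a polynomial and integrate, with
  constant term \<open>\<phi> 0\<close>. Integration over a length of at most \<open>A\<close>
  multiplies the error by \<open>A\<close>, so the derivative is given the tolerance
  \<open>e / (A + 1)\<close>. The base case is Weierstrass.\<close>

lemma smooth_polynomial_approximation:
  assumes "smooth \<phi>" "e > 0" "A \<ge> 0"
  shows "\<exists>a (n::nat). \<forall>k\<le>N. \<forall>x. \<bar>x\<bar> \<le> A \<longrightarrow>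
     \<bar>(deriv ^^ k) \<phi> x - (deriv ^^ k) (\<lambda>x. \<Sum>i\<le>n. a i * x ^ i) x\<bar> \<le> e"
  using assms(1,2)
proof (induction N arbitrary: \<phi> e)
  case 0
  have "isCont \<phi> x" for x
    using smooth_has_derivative[OF 0(1), of 0 x] DERIV_isCont by auto
  then have "continuous_on {-A..A} \<phi>" by (simp add: continuous_at_imp_continuous_on)
  then obtain g where g: "real_polynomial_function g" "\<And>x. x \<in> {-A..A} \<Longrightarrow> \<bar>\<phi> x - g x\<bar> < e"
    using Stone_Weierstrass_real_polynomial_function[OF compact_Icc _ 0(2)] by blast
  from g(1) obtain a n where an: "g = (\<lambda>x. \<Sum>i\<le>n. a i * x ^ i)"
    unfolding real_polynomial_function_iff_sum by blast
  have "\<forall>k\<le>0. \<forall>x. \<bar>x\<bar> \<le> A \<longrightarrow> \<bar>(deriv ^^ k) \<phi> x - (deriv ^^ k) (\<lambda>x. \<Sum>i\<le>n. a i * x ^ i) x\<bar> \<le> e"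
  proof (intro allI impI)
    fix k x assume kx: "k \<le> (0::nat)" "\<bar>x\<bar> \<le> A"
    have "-A \<le> x" "x \<le> A" using kx(2) by linarith+
    with kx show "\<bar>(deriv ^^ k) \<phi> x - (deriv ^^ k) (\<lambda>x. \<Sum>i\<le>n. a i * x ^ i) x\<bar> \<le> e"
      using g(2)[of x] unfolding an by auto
  qed
  then show ?case by blast
next
  case (Suc N)
  let ?e = "e / (A + 1)"
  have e: "?e > 0" "?e \<le> e" "?e * A \<le> e" using Suc.prems assms(3) by (auto simp: field_simps)
  obtain a n where an: "\<And>k x. k \<le> N \<Longrightarrow> \<bar>x\<bar> \<le> A \<Longrightarrow>
      \<bar>(deriv ^^ k) (deriv \<phi>) x - (deriv ^^ k) (\<lambda>x. \<Sum>i\<le>n. a i * x ^ i) x\<bar> \<le> ?e"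
    using Suc.IH[OF smooth_deriv[OF Suc.prems(1)] e(1)] by blast
  define b where "b = (\<lambda>i. case i of 0 \<Rightarrow> \<phi> 0 | Suc j \<Rightarrow> a j / real (Suc j))"
  let ?P = "\<lambda>x::real. \<Sum>i\<le>Suc n. b i * x ^ i" and ?p = "\<lambda>x::real. \<Sum>i\<le>n. a i * x ^ i"
  have P: "?P = (\<lambda>x. \<phi> 0 + (\<Sum>j\<le>n. a j / real (Suc j) * x ^ Suc j))"
    by (simp only: sum.atMost_Suc_shift) (simp add: b_def)
  have dP: "(?P has_real_derivative ?p x) (at x)" for x
  proof -
    have "(?P has_real_derivative 0 + (\<Sum>j\<le>n. a j / real (Suc j) * (real (Suc j) * x ^ (Suc j - Suc 0)))) (at x)"
      unfolding P by (intro DERIV_add DERIV_const DERIV_sum DERIV_cmult DERIV_pow)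
    then show ?thesis by (simp del: of_nat_Suc)
  qed
  then have dP': "deriv ?P = ?p" using DERIV_imp_deriv by blast
  have "\<bar>(deriv ^^ k) \<phi> x - (deriv ^^ k) ?P x\<bar> \<le> e" if "k \<le> Suc N" "\<bar>x\<bar> \<le> A" for k x
  proof (cases k)
    case 0
    have "norm ((\<phi> x - ?P x) - (\<phi> 0 - ?P 0)) \<le> ?e * norm (x - 0)"
    proof (rule field_differentiable_bound[of "cball 0 A" _ "\<lambda>x. deriv \<phi> x - ?p x"])
      fix z :: real assume "z \<in> cball 0 A"
      then show "norm (deriv \<phi> z - ?p z) \<le> ?e" using an[of 0 z] by simp
      show "((\<lambda>x. \<phi> x - ?P x) has_field_derivative deriv \<phi> z - ?p z) (at z within cball 0 A)"
        using DERIV_diff[OF smooth_has_derivative[OF Suc.prems(1), of 0 z] dP]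
        by (simp add: has_field_derivative_at_within)
    qed (use that assms(3) in auto)
    moreover have "?P 0 = \<phi> 0" using fun_cong[OF P, of 0] by simp
    moreover have "?e * \<bar>x\<bar> \<le> ?e * A" using e that by (intro mult_left_mono) auto
    ultimately show ?thesis using 0 e by simp
  next
    case (Suc l)
    then show ?thesis using an[of l x] that e
      by (simp add: dP' higher_deriv_deriv[symmetric] del: funpow.simps sum.atMost_Suc)
  qed
  then show ?case by blast
qed

section \<open>Taylor approximation and the trigonometric functions\<close>

text \<open>Differentiating a Taylor polynomial gives the Taylor polynomial of the derivative with
  one term fewer, which reduces every order to the Lagrange remainder. Passing to the derivative
  replaces \<open>A\<close> by \<open>A * J\<close>, hence the generalisation over
  \<open>A\<close>.\<close>

lemma Taylor_higher_deriv_bound: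
  assumes "smooth \<phi>" "\<And>l x. \<bar>(deriv ^^ l) \<phi> x\<bar> \<le> A * J ^ l" "\<bar>x\<bar> \<le> 2" "k \<le> n" "J \<ge> 0"
  shows "\<bar>(deriv ^^ k) \<phi> x - (deriv ^^ k) (\<lambda>x. \<Sum>i<n. (deriv ^^ i) \<phi> 0 / fact i * x ^ i) x\<bar> \<le> A * J ^ n * 2 ^ n / fact (n - k)"
  using assms
proof (induction k arbitrary: \<phi> A n)
  case 0
  obtain t where "\<bar>t\<bar> \<le> \<bar>x\<bar>" and t: "\<phi> x = (\<Sum>m<n. (deriv ^^ m) \<phi> 0 / fact m * x ^ m) + (deriv ^^ n) \<phi> t / fact n * x ^ n"
    using Maclaurin_all_le[of "\<lambda>m. (deriv ^^ m) \<phi>" \<phi> x n] smooth_has_derivative[OF 0(1)] by auto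
  have "\<bar>(deriv ^^ n) \<phi> t / fact n * x ^ n\<bar> \<le> (A * J ^ n) / fact n * 2 ^ n"
    unfolding abs_mult abs_divide power_abs using 0(2)[of n t] 0(3)
    by (intro mult_mono divide_right_mono power_mono) (auto intro: divide_right_mono order_trans[OF abs_ge_zero])
  then show ?case using t by simp
next
  case (Suc k)
  then obtain n' where n': "n = Suc n'" by (cases n) auto
  let ?P = "\<lambda>x. \<Sum>i<n. (deriv ^^ i) \<phi> 0 / fact i * x ^ i"
  let ?p = "\<lambda>x. \<Sum>i<n'. (deriv ^^ i) (deriv \<phi>) 0 / fact i * x ^ i"
  have P: "?P = (\<lambda>x. \<phi> 0 + (\<Sum>i<n'. (deriv ^^ Suc i) \<phi> 0 / fact (Suc i) * x ^ Suc i))"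
    unfolding n' by (simp only: sum.lessThan_Suc_shift) simp
  have "(?P has_real_derivative ?p x) (at x)" for x
  proof -
    have "(?P has_real_derivative 0 + (\<Sum>i<n'. (deriv ^^ Suc i) \<phi> 0 / fact (Suc i) * (real (Suc i) * x ^ (Suc i - Suc 0)))) (at x)"
      unfolding P by (intro DERIV_add DERIV_const DERIV_sum DERIV_cmult DERIV_pow)
    also have "0 + (\<Sum>i<n'. (deriv ^^ Suc i) \<phi> 0 / fact (Suc i) * (real (Suc i) * x ^ (Suc i - Suc 0))) = ?p x"
      unfolding higher_deriv_deriv by (simp add: fact_Suc del: of_nat_Suc funpow.simps)
    finally show ?thesis .
  qed
  then have dP: "deriv ?P = ?p" using DERIV_imp_deriv by blast
  have "\<bar>(deriv ^^ k) (deriv \<phi>) x - (deriv ^^ k) ?p x\<bar> \<le> (A * J) * J ^ n' * 2 ^ n' / fact (n' - k)"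
    using Suc.prems n' by (intro Suc.IH smooth_deriv) (auto simp: higher_deriv_deriv mult.assoc simp del: funpow.simps simp flip: power_Suc)
  also have "\<dots> \<le> A * J ^ n * 2 ^ n / fact (n - Suc k)"
  proof -
    have "0 \<le> A * J ^ n" using Suc.prems(2)[of n x] abs_ge_zero order_trans by blast
    then have "A * J ^ n * 2 ^ n' \<le> A * J ^ n * 2 ^ n" by (intro mult_left_mono) (auto simp: n')
    then show ?thesis by (simp add: n' divide_right_mono mult_ac)
  qed
  finally show ?case
    unfolding higher_deriv_deriv[symmetric] dP .
qed

text \<open>Cosine and sine are combined into one exponential, whose differentiation is
  multiplication by \<open>\<i> * j\<close>; bounds for both functions then come from a single
  modulus.\<close>

lemma higher_deriv_cos_sin:
  fixes j x :: real
  shows "complex_of_real ((deriv ^^ l) (\<lambda>x. cos (j * x)) x) + \<i> * of_real ((deriv ^^ l) (\<lambda>x. sin (j * x)) x) = (\<i> * of_real j) ^ l * cis (j * x)"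
proof -
  have sm: "smooth (\<lambda>x. cos (j * x))" "smooth (\<lambda>x. sin (j * x))"
    using smooth_affine[OF smooth_sin_cos(1), of j 0] smooth_affine[OF smooth_sin_cos(2), of j 0] by auto
  show ?thesis
  proof (induction l)
    case 0
    show ?case by (simp add: cis_conv_exp exp_Euler flip: sin_of_real cos_of_real)
  next
    case (Suc l)
    have dc: "deriv (\<lambda>x. cos (j * x)) = (\<lambda>x. (- j) * sin (j * x) + 0 * sin (j * x))"
      by (intro ext DERIV_imp_deriv) (auto intro!: derivative_eq_intros)
    have ds: "deriv (\<lambda>x. sin (j * x)) = (\<lambda>x. j * cos (j * x) + 0 * cos (j * x))"
      by (intro ext DERIV_imp_deriv) (auto intro!: derivative_eq_intros)
    have c: "(deriv ^^ Suc l) (\<lambda>x. cos (j * x)) x = - j * (deriv ^^ l) (\<lambda>x. sin (j * x)) x"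
      unfolding higher_deriv_deriv[symmetric] dc higher_deriv_lincomb[OF sm(2) sm(2)] by simp
    have s: "(deriv ^^ Suc l) (\<lambda>x. sin (j * x)) x = j * (deriv ^^ l) (\<lambda>x. cos (j * x)) x"
      unfolding higher_deriv_deriv[symmetric] ds higher_deriv_lincomb[OF sm(1) sm(1)] by simp
    have "complex_of_real ((deriv ^^ Suc l) (\<lambda>x. cos (j * x)) x) + \<i> * of_real ((deriv ^^ Suc l) (\<lambda>x. sin (j * x)) x)
       = (\<i> * of_real j) * (complex_of_real ((deriv ^^ l) (\<lambda>x. cos (j * x)) x) + \<i> * of_real ((deriv ^^ l) (\<lambda>x. sin (j * x)) x))"
      unfolding c s by (simp add: algebra_simps)
    then show ?case using Suc by (simp add: mult.assoc)
  qed
qed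

lemma higher_deriv_cos_sin_bound:
  fixes j x :: real
  shows "\<bar>(deriv ^^ l) (\<lambda>x. cos (j * x)) x\<bar> \<le> \<bar>j\<bar> ^ l" "\<bar>(deriv ^^ l) (\<lambda>x. sin (j * x)) x\<bar> \<le> \<bar>j\<bar> ^ l"
proof -
  let ?z = "complex_of_real ((deriv ^^ l) (\<lambda>x. cos (j * x)) x) + \<i> * of_real ((deriv ^^ l) (\<lambda>x. sin (j * x)) x)"
  have "norm ?z = \<bar>j\<bar> ^ l" unfolding higher_deriv_cos_sin by (simp add: norm_mult norm_power)
  then show "\<bar>(deriv ^^ l) (\<lambda>x. cos (j * x)) x\<bar> \<le> \<bar>j\<bar> ^ l" "\<bar>(deriv ^^ l) (\<lambda>x. sin (j * x)) x\<bar> \<le> \<bar>j\<bar> ^ l"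
    using abs_Re_le_cmod[of ?z] abs_Im_le_cmod[of ?z] by simp_all
qed

section \<open>Growth of polynomials and exponentials at infinity\<close>

lemma poly_bounded_below:
  fixes Q :: "complex poly"
  assumes "Q \<noteq> 0"
  obtains \<delta> r where "\<delta> > 0" "\<And>z. r \<le> norm z \<Longrightarrow> \<delta> \<le> norm (poly Q z)"
proof (cases Q)
  case (pCons a Q')
  show ?thesis
  proof (cases "Q' = 0")
    case True
    then show ?thesis using assms pCons by (intro that[of "norm a" 0]) auto
  next
    case False
    then obtain r where "\<And>z. r \<le> norm z \<Longrightarrow> 1 \<le> norm (poly (pCons a Q') z)" using poly_infinity by blast
    then show ?thesis using pCons by (intro that[of 1 r]) auto
  qed
qed

lemma exp_not_polynomially_bounded:
  fixes s \<delta> C :: real and l N :: nat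
  assumes "s > 0" "\<delta> > 0" "\<And>n::nat. n \<ge> l \<Longrightarrow> \<delta> * exp (s * real n) \<le> C * (1 + real n) ^ N"
  shows False
proof -
  have "((\<lambda>x::real. C * (1 + x) ^ N / exp (s * x)) \<longlongrightarrow> 0) at_top"
    using assms(1) by real_asymp
  then have "(\<lambda>n::nat. C * (1 + real n) ^ N / exp (s * real n)) \<longlonglongrightarrow> 0"
    by (rule filterlim_compose[OF _ filterlim_real_sequentially])
  then have "\<forall>\<^sub>F n in sequentially. C * (1 + real n) ^ N / exp (s * real n) < \<delta>"
    using assms(2) by (rule order_tendstoD)
  moreover have "\<forall>\<^sub>F n in sequentially. n \<ge> l" by (rule eventually_ge_at_top)
  ultimately have "\<forall>\<^sub>F n :: nat in sequentially. False"
  proof eventually_elim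
    case (elim n)
    then show ?case using assms(3)[of n] by (simp add: divide_less_eq)
  qed
  then show False by simp
qed

section \<open>Moments and autocorrelation\<close>

text \<open>Derivatives are compared only on \<open>\<bar>x\<bar> < 2\<close>, the range in which a
  periodic coordinate is known to equal \<open>x\<close>, so that polynomials can be used as if they
  were test functions. A cutoff equal to \<open>1\<close> on the window makes the values elsewhere
  irrelevant.\<close>

lemma local_bound:
  assumes \<mu>: "distribution \<mu>" and cd: "-2 < c" "c < d" "d < 2" and off: "vanishes_off \<mu> (per {c<..<d})"
  shows "\<exists>C\<ge>0. \<exists>N. \<forall>\<phi> B. test_fun \<phi> \<longrightarrow> (\<forall>k x. k \<le> N \<longrightarrow> \<bar>x\<bar> < 2 \<longrightarrow> \<bar>(deriv ^^ k) \<phi> x\<bar> \<le> B) \<longrightarrow> norm (\<mu> \<phi>) \<le> C * B"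
proof -
  \<comment> \<open>Midpoints between the window and \<open>-2\<close> or \<open>2\<close>, leaving
    room for the cutoff to vanish before the boundary is reached.\<close>
  define c' d' where "c' = (c - 2) / 2" and "d' = (d + 2) / 2"
  have cd': "-2 < c'" "c' < c" "d < d'" "d' < 2" "d' \<le> c' + 2 * pi"
    using cd pi_gt3 by (auto simp: c'_def d'_def field_simps)
  obtain \<eta> where \<eta>: "test_fun \<eta>" "\<And>x. c \<le> x \<Longrightarrow> x \<le> d \<Longrightarrow> \<eta> x = 1"
    "\<And>x. d' \<le> x \<Longrightarrow> x \<le> c' + 2 * pi \<Longrightarrow> \<eta> x = 0"
    using cutoff_exists[OF cd'(2) less_imp_le[OF cd(2)] cd'(3,5)] by metis
  obtain C N where C: "C \<ge> 0" "\<And>\<phi> B. test_fun \<phi> \<Longrightarrow> (\<And>k x. k \<le> N \<Longrightarrow> \<bar>(deriv ^^ k) \<phi> x\<bar> \<le> B) \<Longrightarrow> norm (\<mu> \<phi>) \<le> C * B"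
    using distribution_boundE[OF \<mu>] by blast
  obtain A where A: "A \<ge> 0" "\<And>k x. k \<le> N \<Longrightarrow> \<bar>(deriv ^^ k) \<eta> x\<bar> \<le> A"
    using test_fun_derivs_bounded[OF \<eta>(1)] by blast
  have "norm (\<mu> \<phi>) \<le> (C * (2 ^ N * A)) * B"
    if \<phi>: "test_fun \<phi>" and B: "\<And>k x. k \<le> N \<Longrightarrow> \<bar>x\<bar> < 2 \<Longrightarrow> \<bar>(deriv ^^ k) \<phi> x\<bar> \<le> B" for \<phi> B
  proof -
    have B0: "B \<ge> 0" using B[of 0 0] by simp
    have test: "test_fun (\<lambda>x. \<eta> x * \<phi> x)" by (intro test_fun_mult \<eta> \<phi>)
    have "\<mu> \<phi> = \<mu> (\<lambda>x. \<eta> x * \<phi> x)"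
    proof (rule vanishes_off_eq[OF \<mu> off \<phi> test])
      fix x assume "x \<in> per {c<..<d}"
      then obtain k :: int where "x + 2 * pi * of_int k \<in> {c<..<d}" by (auto simp: per_def)
      then have "\<eta> x = 1" using \<eta>(2)[of "x + 2 * pi * of_int k"] test_fun_periodic[OF \<eta>(1), of x k] by simp
      then show "\<phi> x = \<eta> x * \<phi> x" by simp
    qed
    also have "norm \<dots> \<le> C * (2 ^ N * A * B)"
    proof (rule C(2)[OF test])
      fix k and x :: real assume k: "k \<le> N"
      \<comment> \<open>The fundamental interval starts halfway between \<open>-2\<close> and
        \<open>c'\<close>. A representative is then either in \<open>(-2, 2)\<close> or in the open
        interval \<open>(d', c' + 2 * pi)\<close>, where the cutoff vanishes identically and so do
        its derivatives.\<close>
      obtain l :: int where l: "(c' - 2) / 2 \<le> x + 2 * pi * of_int l" "x + 2 * pi * of_int l < (c' - 2) / 2 + 2 * pi"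
        using ex_period_shift by blast
      let ?y = "x + 2 * pi * of_int l"
      have "\<bar>(deriv ^^ k) (\<lambda>x. \<eta> x * \<phi> x) ?y\<bar> \<le> 2 ^ N * A * B"
      proof (cases "?y < 2")
        case True
        have "- 2 < (c' - 2) / 2" using cd' by simp
        then have y2: "\<bar>?y\<bar> < 2" using True l by linarith
        have "\<bar>(deriv ^^ k) (\<lambda>x. \<eta> x * \<phi> x) ?y\<bar> \<le> 2 ^ k * A * B"
          using k A(2) B y2 by (intro higher_deriv_mult_bound test_fun_smooth \<eta>(1) \<phi>) auto
        also have "\<dots> \<le> 2 ^ N * A * B"
          using k A B0 by (intro mult_right_mono power_increasing) auto
        finally show ?thesis .
      next
        case False
        have "(deriv ^^ k) (\<lambda>x. \<eta> x * \<phi> x) ?y = (deriv ^^ k) (\<lambda>x. 0) ?y"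
        proof (rule higher_deriv_cong_open[where U = "{d'<..<c' + 2 * pi}"])
          have "(c' - 2) / 2 < c'" using cd' by simp
          then show "?y \<in> {d'<..<c' + 2 * pi}" using False l cd' unfolding greaterThanLessThan_iff by linarith
        qed (use \<eta>(3) in auto)
        also have "\<dots> = 0" by (simp add: higher_deriv_zero)
        finally show ?thesis using A B0 by simp
      qed
      then show "\<bar>(deriv ^^ k) (\<lambda>x. \<eta> x * \<phi> x) x\<bar> \<le> 2 ^ N * A * B"
        using test_fun_periodic[OF test_fun_higher_deriv[OF test, of k], of x l] by simp
    qed
    finally show ?thesis by (simp add: mult_ac)
  qed
  moreover have "C * (2 ^ N * A) \<ge> 0" using C(1) A(1) by simp
  ultimately show ?thesis by blast
qed

text \<open>The binomial theorem applied to \<open>(x - y) ^ n\<close>, with reflection accounting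
  for the signs. The window keeps \<open>x\<close>, \<open>y\<close> and \<open>x - y\<close> in the
  range where \<open>q\<close> is the identity, so \<open>q\<close> is additive on the differences
  involved.\<close>

lemma autocorrelation_moments:
  assumes \<mu>: "distribution \<mu>" and cd: "-2 < c" "d < 2" "d - c < 2" and off: "vanishes_off \<mu> (per {c<..<d})"
    and q: "test_fun q" "\<And>x. \<bar>x\<bar> \<le> 2 \<Longrightarrow> q x = x"
  shows "dconv \<mu> (dreflect \<mu>) (\<lambda>x. q x ^ n) =
    (\<Sum>k\<le>n. of_nat (n choose k) * (- 1) ^ (n - k) * \<mu> (\<lambda>x. q x ^ k) * \<mu> (\<lambda>x. q x ^ (n - k)))"
proof -
  have q_diff: "q (x - y) = q x - q y" if xy: "x \<in> per {c<..<d}" "y \<in> per {c<..<d}" for x y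
  proof -
    obtain k l :: int where kl: "x + 2 * pi * of_int k \<in> {c<..<d}" "y + 2 * pi * of_int l \<in> {c<..<d}"
      using xy unfolding per_def by blast
    let ?x = "x + 2 * pi * of_int k" and ?y = "y + 2 * pi * of_int l"
    have "q (x - y) = q (?x - ?y)"
      using test_fun_periodic[OF q(1), of "x - y" "k - l"] by (simp add: algebra_simps)
    also have "\<dots> = ?x - ?y" by (rule q(2)) (use kl cd in \<open>simp, linarith\<close>)
    also have "\<dots> = q ?x - q ?y"
    proof -
      have "\<bar>?x\<bar> \<le> 2" "\<bar>?y\<bar> \<le> 2" using kl cd by (simp_all, linarith+)
      then show ?thesis by (simp add: q(2))
    qed
    finally show ?thesis using test_fun_periodic[OF q(1)] by simp
  qed
  let ?m = "\<lambda>k. \<mu> (\<lambda>x. q x ^ k)"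
  have inner: "\<mu> (\<lambda>y. q (x - y) ^ n) = (\<Sum>k\<le>n. (of_nat (n choose k) * (- 1) ^ (n - k) * ?m (n - k)) * of_real (q x ^ k))"
    if x: "x \<in> per {c<..<d}" for x
  proof -
    have "\<mu> (\<lambda>y. q (x - y) ^ n) = \<mu> (\<lambda>y. \<Sum>k\<le>n. (of_nat (n choose k) * q x ^ k * (- 1) ^ (n - k)) * q y ^ (n - k))"
    proof (rule vanishes_off_eq[OF \<mu> off])
      show "test_fun (\<lambda>y. q (x - y) ^ n)" by (intro test_fun_power test_fun_reflect q)
      show "test_fun (\<lambda>y. \<Sum>k\<le>n. (of_nat (n choose k) * q x ^ k * (- 1) ^ (n - k)) * q y ^ (n - k))"
        by (intro test_fun_sum test_fun_cmult test_fun_power q)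
      fix y assume "y \<in> per {c<..<d}"
      then have "q (x - y) ^ n = (q x + (- q y)) ^ n" using q_diff x by simp
      also have "\<dots> = (\<Sum>k\<le>n. of_nat (n choose k) * q x ^ k * (- q y) ^ (n - k))" by (rule binomial_ring)
      also have "\<dots> = (\<Sum>k\<le>n. (of_nat (n choose k) * q x ^ k * (- 1) ^ (n - k)) * q y ^ (n - k))"
        by (intro sum.cong refl) (simp add: power_minus[of "q y"] mult_ac)
      finally show "q (x - y) ^ n = \<dots>" .
    qed
    also have "\<dots> = (\<Sum>k\<le>n. of_real (of_nat (n choose k) * q x ^ k * (- 1) ^ (n - k)) * ?m (n - k))"
      by (simp only: distribution_sum[OF \<mu> test_fun_cmult[OF test_fun_power[OF q(1)]]] distribution_cmult[OF \<mu> test_fun_power[OF q(1)]])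
    finally show ?thesis by (simp add: mult_ac)
  qed
  have "dconv \<mu> (dreflect \<mu>) (\<lambda>x. q x ^ n) = complex_ext \<mu> (\<lambda>x. \<mu> (\<lambda>y. q (x - y) ^ n))"
    by (rule dconv_dreflect_eq)
  also have "\<dots> = complex_ext \<mu> (\<lambda>x. \<Sum>k\<le>n. (of_nat (n choose k) * (- 1) ^ (n - k) * ?m (n - k)) * of_real (q x ^ k))"
    by (intro complex_ext_cong[OF \<mu> off] inner complex_test_fun_sum complex_test_fun_cmult complex_test_fun_of_real
        test_fun_power q complex_test_fun_translate_reflect[OF \<mu>, where \<phi> = "\<lambda>x. q x ^ n"])
  also have "\<dots> = (\<Sum>k\<le>n. complex_ext \<mu> (\<lambda>x. (of_nat (n choose k) * (- 1) ^ (n - k) * ?m (n - k)) * of_real (q x ^ k)))"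
    by (intro complex_ext_sum[OF \<mu>] complex_test_fun_cmult complex_test_fun_of_real test_fun_power q)
  also have "\<dots> = (\<Sum>k\<le>n. (of_nat (n choose k) * (- 1) ^ (n - k) * ?m (n - k)) * ?m k)"
    by (intro sum.cong refl)
       (simp only: complex_ext_cmult[OF \<mu> complex_test_fun_of_real[OF test_fun_power[OF q(1)]]] complex_ext_of_real[OF \<mu>])
  finally show ?thesis by (simp add: mult_ac)
qed

text \<open>Near the origin \<open>q ^ n\<close> agrees with \<open>(q (m * x) / m) ^ n\<close>, whose derivatives up to an order below \<open>n\<close> tend
  to zero as the integer \<open>m\<close> grows.\<close>

lemma point_supported_moments_eventually_zero:
  assumes g: "distribution g"
    and supp: "\<And>\<phi> e. test_fun \<phi> \<Longrightarrow> e > 0 \<Longrightarrow> (\<And>x. x \<in> per {-e<..<e} \<Longrightarrow> \<phi> x = 0) \<Longrightarrow> g \<phi> = 0"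
    and q: "test_fun q" "\<And>x. \<bar>x\<bar> \<le> 2 \<Longrightarrow> q x = x"
  shows "\<exists>N. \<forall>n>N. g (\<lambda>x. q x ^ n) = 0"
proof -
  obtain C N where C: "C \<ge> 0" "\<And>\<phi> B. test_fun \<phi> \<Longrightarrow> (\<And>k x. k \<le> N \<Longrightarrow> \<bar>(deriv ^^ k) \<phi> x\<bar> \<le> B) \<Longrightarrow> norm (g \<phi>) \<le> C * B"
    using distribution_boundE[OF g] by blast
  have "g (\<lambda>x. q x ^ n) = 0" if n: "n > N" for n
  proof -
    have qn: "test_fun (\<lambda>x. q x ^ n)" by (intro test_fun_power q)
    obtain B where B: "B \<ge> 0" "\<And>k x. k \<le> N \<Longrightarrow> \<bar>(deriv ^^ k) (\<lambda>x. q x ^ n) x\<bar> \<le> B"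
      using test_fun_derivs_bounded[OF qn] by blast
    have le: "norm (g (\<lambda>x. q x ^ n)) \<le> C * B / real m" if m: "m \<ge> 1" for m :: nat
    proof -
      let ?\<psi> = "\<lambda>x. (1 / real m ^ n) * q (real m * x) ^ n"
      have t: "test_fun (\<lambda>x. q (real m * x) ^ n)"
        using test_fun_affine[OF qn, of "int m" 0] by simp
      have \<psi>: "test_fun ?\<psi>" by (intro test_fun_cmult t)
      have "g (\<lambda>x. q x ^ n - ?\<psi> x) = 0"
      proof (rule supp)
        show "test_fun (\<lambda>x. q x ^ n - ?\<psi> x)" by (intro test_fun_diff qn \<psi>)
        show "1 / real m > 0" using m by simp
        fix x assume "x \<in> per {-(1 / real m)<..<1 / real m}"
        then obtain k :: int where k: "x + 2 * pi * of_int k \<in> {-(1 / real m)<..<1 / real m}" by (auto simp: per_def)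
        let ?y = "x + 2 * pi * of_int k"
        have y: "\<bar>?y\<bar> < 1 / real m" using k by (simp only: greaterThanLessThan_iff) linarith
        then have my: "\<bar>real m * ?y\<bar> \<le> 2" using m unfolding abs_mult by (simp add: field_simps)
        have "1 / real m \<le> 1" using m by simp
        then have "q ?y = ?y" using y by (intro q(2)) linarith
        then have "q x = ?y" using test_fun_periodic[OF q(1), of x k] by simp
        moreover have "q (real m * x) = real m * ?y"
          using test_fun_periodic[OF q(1), of "real m * x" "int m * k"] q(2)[OF my]
          by (simp add: algebra_simps)
        ultimately show "q x ^ n - ?\<psi> x = 0" using m by (simp add: power_mult_distrib)
      qed
      then have "g (\<lambda>x. q x ^ n) = g ?\<psi>" using distribution_diff[OF g qn \<psi>] by simp
      also have "norm \<dots> \<le> C * (B / real m)"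
      proof (rule C(2)[OF \<psi>])
        fix k and x :: real assume k: "k \<le> N"
        have "(deriv ^^ k) ?\<psi> x = 1 / real m ^ n * (deriv ^^ k) (\<lambda>x. q (real m * x) ^ n) x"
          using higher_deriv_lincomb[OF test_fun_smooth[OF t] test_fun_smooth[OF t], of k "1 / real m ^ n" 0] by simp
        also have "\<dots> = (1 / real m ^ n * real m ^ k) * (deriv ^^ k) (\<lambda>x. q x ^ n) (real m * x)"
          using higher_deriv_affine[OF test_fun_smooth[OF qn], of k "real m" 0] by simp
        finally have "\<bar>(deriv ^^ k) ?\<psi> x\<bar> = (1 / real m ^ n * real m ^ k) * \<bar>(deriv ^^ k) (\<lambda>x. q x ^ n) (real m * x)\<bar>"
          by (simp add: abs_mult)
        also have "\<dots> \<le> (1 / real m) * B"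
        proof (intro mult_mono B(2) k)
          \<comment> \<open>Since \<open>k \<le> N < n\<close>, the prefactor
            \<open>1 / m ^ n\<close> outweighs the \<open>m ^ k\<close> from differentiation by at
            least one power of \<open>m\<close>.\<close>
          have "real m ^ Suc k \<le> real m ^ n" using m n k by (intro power_increasing) auto
          then show "1 / real m ^ n * real m ^ k \<le> 1 / real m" using m by (simp add: field_simps)
        qed (use B in auto)
        finally show "\<bar>(deriv ^^ k) ?\<psi> x\<bar> \<le> B / real m" by simp
      qed
      finally show ?thesis by simp
    qed
    have "(\<lambda>m. C * B / real m) \<longlonglongrightarrow> 0" by (rule lim_const_over_n)
    then have "norm (g (\<lambda>x. q x ^ n)) \<le> 0"
      using le by (intro LIMSEQ_le_const[of "\<lambda>m. C * B / real m"]) auto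
    then show ?thesis by simp
  qed
  then show ?thesis by blast
qed

text \<open>The sum \<open>s\<close> is the pairing of \<open>\<mu>\<close> with
  \<open>exp (\<i> * j * x)\<close>: Taylor polynomials of cosine and sine converge together with
  \<open>N\<close> derivatives on the window. Its derivatives grow like powers of \<open>j\<close>,
  which gives the bound; \<open>j\<close> is an integer so that the function is periodic. The factor
  \<open>2\<close> comes from estimating cosine and sine separately.\<close>

lemma moments_at_imaginary_integers:
  fixes m :: "nat \<Rightarrow> complex" and j :: int
  assumes approx: "\<And>\<phi> a n B. test_fun \<phi> \<Longrightarrow>
      (\<And>k x. k \<le> N \<Longrightarrow> \<bar>x\<bar> < 2 \<Longrightarrow> \<bar>(deriv ^^ k) \<phi> x - (deriv ^^ k) (\<lambda>x. \<Sum>i<n. a i * x ^ i) x\<bar> \<le> B) \<Longrightarrow>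
      norm (\<mu> \<phi> - (\<Sum>i<n. of_real (a i) * m i)) \<le> C * B"
    and sums: "(\<lambda>n. m n / fact n * (\<i> * of_int j) ^ n) sums s"
  shows "norm s \<le> 2 * C * (1 + \<bar>real_of_int j\<bar>) ^ N"
proof -
  define J where "J = \<bar>real_of_int j\<bar>"
  let ?c = "\<lambda>x. cos (of_int j * x)" and ?s = "\<lambda>x. sin (of_int j * x)"
  have test: "test_fun ?c" "test_fun ?s"
    using test_fun_affine[of cos j 0] test_fun_affine[of sin j 0]
    by (simp_all add: test_fun_iff smooth_sin_cos)
  let ?T = "\<lambda>\<phi> n. \<Sum>i<n. of_real ((deriv ^^ i) \<phi> 0 / fact i) * m i"
  have lim: "(\<lambda>n. ?T \<phi> n) \<longlonglongrightarrow> \<mu> \<phi>" and bd: "norm (\<mu> \<phi>) \<le> C * (1 + J) ^ N"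
    if \<phi>: "test_fun \<phi>" and b: "\<And>l x. \<bar>(deriv ^^ l) \<phi> x\<bar> \<le> J ^ l" for \<phi>
  proof -
    \<comment> \<open>Taking \<open>N\<close> extra terms keeps the factorial in the remainder at
      least \<open>fact n\<close> for every derivative of order \<open>k \<le> N\<close>.\<close>
    have le: "norm (?T \<phi> (n + N) - \<mu> \<phi>) \<le> C * (2 * J) ^ N * ((2 * J) ^ n / fact n)" for n
    proof -
      have "norm (\<mu> \<phi> - ?T \<phi> (n + N)) \<le> C * (1 * J ^ (n + N) * 2 ^ (n + N) / fact n)"
      proof (rule approx[OF \<phi>])
        fix k x assume k: "k \<le> N" and x: "\<bar>x :: real\<bar> < 2"
        have "\<bar>(deriv ^^ k) \<phi> x - (deriv ^^ k) (\<lambda>x. \<Sum>i<n + N. (deriv ^^ i) \<phi> 0 / fact i * x ^ i) x\<bar>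
            \<le> 1 * J ^ (n + N) * 2 ^ (n + N) / fact (n + N - k)"
          using k x b by (intro Taylor_higher_deriv_bound test_fun_smooth \<phi>) (auto simp: J_def)
        also have "\<dots> \<le> 1 * J ^ (n + N) * 2 ^ (n + N) / fact n"
          using k by (intro divide_left_mono fact_mono) (auto simp: J_def)
        finally show "\<bar>(deriv ^^ k) \<phi> x - (deriv ^^ k) (\<lambda>x. \<Sum>i<n + N. (deriv ^^ i) \<phi> 0 / fact i * x ^ i) x\<bar> \<le> \<dots>" .
      qed
      then show ?thesis by (simp add: norm_minus_commute power_mult_distrib power_add mult_ac)
    qed
    have "(\<lambda>n. (2 * J) ^ n / fact n) \<longlonglongrightarrow> 0"
      using summable_LIMSEQ_zero[OF summable_exp[of "2 * J"]] by (simp add: field_simps)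
    then have "(\<lambda>n. C * (2 * J) ^ N * ((2 * J) ^ n / fact n)) \<longlonglongrightarrow> 0"
      by (rule tendsto_mult_right_zero)
    then have "(\<lambda>n. ?T \<phi> (n + N) - \<mu> \<phi>) \<longlonglongrightarrow> 0"
      by (rule Lim_null_comparison[rotated]) (use le in auto)
    then have "(\<lambda>n. ?T \<phi> (n + N)) \<longlonglongrightarrow> \<mu> \<phi>" using LIM_zero_iff by blast
    then show "(\<lambda>n. ?T \<phi> n) \<longlonglongrightarrow> \<mu> \<phi>" by (rule LIMSEQ_offset)
    \<comment> \<open>With the empty polynomial the approximation estimate becomes a plain
      continuity estimate for \<open>\<mu>\<close>.\<close>
    have "norm (\<mu> \<phi> - (\<Sum>i<0. of_real 0 * m i)) \<le> C * (1 + J) ^ N"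
    proof (rule approx[OF \<phi>])
      fix k x assume k: "k \<le> N" and x: "\<bar>x :: real\<bar> < 2"
      have "J ^ k \<le> (1 + J) ^ k" by (intro power_mono) (auto simp: J_def)
      also have "\<dots> \<le> (1 + J) ^ N" using k by (intro power_increasing) (auto simp: J_def)
      finally show "\<bar>(deriv ^^ k) \<phi> x - (deriv ^^ k) (\<lambda>x. \<Sum>i<0. 0 * x ^ i) x\<bar> \<le> (1 + J) ^ N"
        using b[of k x] by (simp add: higher_deriv_zero)
    qed
    then show "norm (\<mu> \<phi>) \<le> C * (1 + J) ^ N" by simp
  qed
  note c = lim[OF test(1)] bd[OF test(1)] and s = lim[OF test(2)] bd[OF test(2)]
  have b: "\<bar>(deriv ^^ l) ?c x\<bar> \<le> J ^ l" "\<bar>(deriv ^^ l) ?s x\<bar> \<le> J ^ l" for l x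
    unfolding J_def by (rule higher_deriv_cos_sin_bound)+
  have "(\<lambda>n. ?T ?c n + \<i> * ?T ?s n) \<longlonglongrightarrow> \<mu> ?c + \<i> * \<mu> ?s"
    by (intro tendsto_intros c(1) s(1) b)
  moreover have "?T ?c n + \<i> * ?T ?s n = (\<Sum>i<n. m i / fact i * (\<i> * of_int j) ^ i)" for n
  proof -
    have "of_real ((deriv ^^ i) ?c 0 / fact i) * m i + \<i> * (of_real ((deriv ^^ i) ?s 0 / fact i) * m i)
      = m i / fact i * (\<i> * of_int j) ^ i" for i
    proof -
      have "of_real ((deriv ^^ i) ?c 0 / fact i) * m i + \<i> * (of_real ((deriv ^^ i) ?s 0 / fact i) * m i)
        = (of_real ((deriv ^^ i) ?c 0) + \<i> * of_real ((deriv ^^ i) ?s 0)) / fact i * m i"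
        by (simp add: add_divide_distrib distrib_right)
      then show ?thesis unfolding higher_deriv_cos_sin by simp
    qed
    then show ?thesis by (simp only: sum_distrib_left sum.distrib[symmetric])
  qed
  ultimately have "(\<lambda>n. \<Sum>i<n. m i / fact i * (\<i> * of_int j) ^ i) \<longlonglongrightarrow> \<mu> ?c + \<i> * \<mu> ?s" by simp
  then have "s = \<mu> ?c + \<i> * \<mu> ?s" using sums LIMSEQ_unique unfolding sums_def by blast
  then have "norm s \<le> norm (\<mu> ?c) + norm (\<mu> ?s)"
    by (metis norm_ii norm_mult mult_1 norm_triangle_ineq)
  also have "\<dots> \<le> C * (1 + J) ^ N + C * (1 + J) ^ N"
    by (intro add_mono c(2) s(2) b)
  finally show ?thesis by (simp add: J_def mult_ac)
qed

text \<open>At \<open>\<i> * j\<close> the exponential factor has modulus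
  \<open>exp (- Im c * j)\<close>. If \<open>Im c\<close> were nonzero, it would grow exponentially
  in one of the two directions, while \<open>Q\<close> stays bounded away from \<open>0\<close> far
  out.\<close>

lemma exponent_is_real:
  fixes Q :: "complex poly"
  assumes M: "fps_conv_radius M = \<infinity>" "M = fps_of_poly Q * fps_exp c" and "Q \<noteq> 0"
    and bound: "\<And>j::int. norm (eval_fps M (\<i> * of_int j)) \<le> C * (1 + \<bar>real_of_int j\<bar>) ^ N"
  shows "Im c = 0"
proof (rule ccontr)
  assume nz: "Im c \<noteq> 0"
  obtain \<delta> r where \<delta>: "\<delta> > 0" "\<And>z. r \<le> norm z \<Longrightarrow> \<delta> \<le> norm (poly Q z)"
    using poly_bounded_below[OF \<open>Q \<noteq> 0\<close>] by blast
  \<comment> \<open>The sign selects the direction along the imaginary axis in which the exponential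
    grows.\<close>
  define \<sigma> :: int where "\<sigma> = (if Im c > 0 then - 1 else 1)"
  have \<sigma>: "- Im c * of_int \<sigma> = \<bar>Im c\<bar>" "\<bar>\<sigma>\<bar> = 1" by (auto simp: \<sigma>_def)
  show False
  proof (rule exp_not_polynomially_bounded[where s = "\<bar>Im c\<bar>" and l = "nat \<lceil>r\<rceil>"])
    fix n :: nat assume n: "n \<ge> nat \<lceil>r\<rceil>"
    let ?j = "\<sigma> * int n" and ?z = "\<i> * of_int (\<sigma> * int n) :: complex"
    have abs_j: "\<bar>real_of_int ?j\<bar> = real n" using \<sigma>(2) by (simp add: abs_mult flip: of_int_abs)
    then have "norm ?z = real n" by (simp add: norm_mult abs_mult)
    then have "r \<le> norm ?z" using n by linarith
    then have "\<delta> \<le> norm (poly Q ?z)" by (rule \<delta>(2))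
    moreover have "norm (exp (c * ?z)) = exp (\<bar>Im c\<bar> * real n)"
      using \<sigma>(1) by (simp add: norm_exp_eq_Re) (metis mult.assoc mult_minus_left)
    moreover have "eval_fps M ?z = poly Q ?z * exp (c * ?z)"
      unfolding M(2) by (subst eval_fps_mult) auto
    ultimately have "\<delta> * exp (\<bar>Im c\<bar> * real n) \<le> norm (eval_fps M ?z)"
      by (simp add: norm_mult mult_right_mono)
    also have "\<dots> \<le> C * (1 + real n) ^ N" using bound[of ?j] abs_j by simp
    finally show "\<delta> * exp (\<bar>Im c\<bar> * real n) \<le> C * (1 + real n) ^ N" .
  qed (use nz \<delta> in auto)
qed

text \<open>The functional sending \<open>\<phi>\<close> to the sum of \<open>coeff Q i\<close>
  times the \<open>i\<close>-th derivative of \<open>\<phi>\<close> at \<open>p\<close> has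
  exponential moment series \<open>Q(z) * exp (p * z)\<close>. Terms beyond \<open>degree Q\<close>
  or beyond \<open>n\<close> vanish, so the two ranges of summation can be matched through their
  maximum.\<close>

lemma point_functional_monomial:
  fixes Q :: "complex poly" and p :: real
  shows "(\<Sum>i\<le>degree Q. coeff Q i * of_real ((deriv ^^ i) (\<lambda>x. x ^ n) p)) =
    fact n * fps_nth (fps_of_poly Q * fps_exp (of_real p)) n"
proof -
  define G where "G = (\<lambda>i. coeff Q i * of_real ((deriv ^^ i) (\<lambda>x. x ^ n) p))"
  have "sum G {..degree Q} = sum G {..max n (degree Q)}"
    by (rule sum.mono_neutral_left) (auto simp: G_def coeff_eq_0)
  also have "\<dots> = sum G {..n}"
    by (rule sum.mono_neutral_right) (auto simp: G_def higher_deriv_monomial)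
  also have "\<dots> = (\<Sum>i\<le>n. fact n * (coeff Q i * (of_real p ^ (n - i) / fact (n - i))))"
    by (intro sum.cong refl) (simp add: G_def higher_deriv_monomial)
  also have "\<dots> = fact n * fps_nth (fps_of_poly Q * fps_exp (of_real p)) n"
    by (simp add: fps_mult_nth atMost_atLeast0 sum_distrib_left)
  finally show ?thesis by (simp add: G_def)
qed

text \<open>Nothing is claimed here about where \<open>p\<close> lies relative to the window; for
  \<open>\<mu> = 0\<close> it is arbitrary. It is moved into the interval later, by comparing
  supports.\<close>

lemma autocorrelation_point_support:
  assumes \<mu>: "distribution \<mu>" and cd: "-2 < c" "c < d" "d < 2" "d - c < 2" and off: "vanishes_off \<mu> (per {c<..<d})"
    and ac: "\<And>\<phi> e. test_fun \<phi> \<Longrightarrow> e > 0 \<Longrightarrow> (\<And>x. x \<in> per {-e<..<e} \<Longrightarrow> \<phi> x = 0) \<Longrightarrow> dconv \<mu> (dreflect \<mu>) \<phi> = 0"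
  shows "\<exists>p. \<forall>e>0. vanishes_off \<mu> (per {p - e<..<p + e})"
proof -
  obtain q where q: "test_fun q" "\<And>x. \<bar>x\<bar> \<le> 2 \<Longrightarrow> q x = x"
    using periodic_coordinate_exists by blast
  have q_power: "test_fun (\<lambda>x. q x ^ n)" for n by (intro test_fun_power q)
  define m where "m = (\<lambda>n. \<mu> (\<lambda>x. q x ^ n))"
  define g where "g = (\<lambda>n. dconv \<mu> (dreflect \<mu>) (\<lambda>x. q x ^ n))"
  have g: "g n = (\<Sum>k\<le>n. of_nat (n choose k) * (- 1) ^ (n - k) * m k * m (n - k))" for n
    unfolding g_def m_def by (rule autocorrelation_moments[OF \<mu> cd(1,3,4) off q])
  have "\<exists>D. \<forall>n>D. g n = 0"
    unfolding g_def
    by (rule point_supported_moments_eventually_zero[OF distribution_dconv[OF \<mu> distribution_dreflect[OF \<mu>]] ac q])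
  then obtain D where D: "\<And>n. n > D \<Longrightarrow> g n = 0" by blast
  obtain C N where C: "C \<ge> 0" "\<And>\<phi> B. test_fun \<phi> \<Longrightarrow>
      (\<And>k x. k \<le> N \<Longrightarrow> \<bar>x\<bar> < 2 \<Longrightarrow> \<bar>(deriv ^^ k) \<phi> x\<bar> \<le> B) \<Longrightarrow> norm (\<mu> \<phi>) \<le> C * B"
    using local_bound[OF \<mu> cd(1-3) off] by metis
  \<comment> \<open>The index set is left open because the Taylor argument sums over
    \<open>{..<n}\<close> and the density argument over \<open>{..n}\<close>.\<close>
  have approx: "norm (\<mu> \<phi> - (\<Sum>i\<in>I. of_real (a i) * m i)) \<le> C * B"
    if \<phi>: "test_fun \<phi>" and B: "\<And>k x. k \<le> N \<Longrightarrow> \<bar>x\<bar> < 2 \<Longrightarrow>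
      \<bar>(deriv ^^ k) \<phi> x - (deriv ^^ k) (\<lambda>x. \<Sum>i\<in>I. a i * x ^ i) x\<bar> \<le> B"
    for \<phi> a B and I :: "nat set"
  proof -
    let ?P = "\<lambda>x. \<Sum>i\<in>I. a i * q x ^ i"
    have P: "test_fun ?P" by (intro test_fun_sum test_fun_cmult q_power)
    have "norm (\<mu> (\<lambda>x. \<phi> x - ?P x)) \<le> C * B"
    proof (rule C(2)[OF test_fun_diff[OF \<phi> P]])
      fix k x assume k: "k \<le> N" and x: "\<bar>x :: real\<bar> < 2"
      have "(deriv ^^ k) ?P x = (deriv ^^ k) (\<lambda>x. \<Sum>i\<in>I. a i * x ^ i) x"
      proof (rule higher_deriv_cong_open[where U = "{-2<..<2}"])
        show "x \<in> {-2<..<2}" using x by (auto simp: abs_less_iff)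
        show "?P y = (\<Sum>i\<in>I. a i * y ^ i)" if "y \<in> {-2<..<2}" for y
        proof -
          have "q y = y" by (rule q(2)) (use that in \<open>simp, linarith\<close>)
          then show ?thesis by simp
        qed
      qed simp
      then show "\<bar>(deriv ^^ k) (\<lambda>x. \<phi> x - ?P x) x\<bar> \<le> B"
        using B[OF k x] smooth_higher_deriv_diff[OF test_fun_smooth[OF \<phi>] test_fun_smooth[OF P], of k] by simp
    qed
    moreover have "\<mu> ?P = (\<Sum>i\<in>I. of_real (a i) * m i)"
      by (simp add: m_def distribution_sum[OF \<mu>] distribution_cmult[OF \<mu>] test_fun_cmult q_power)
    ultimately show ?thesis by (simp add: distribution_diff[OF \<mu> \<phi> P])
  qed
  have m_bound: "norm (m n) \<le> C * (fact N * 4 ^ n)" for n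
    unfolding m_def
  proof (rule C(2)[OF q_power])
    fix k x assume k: "k \<le> N" and x: "\<bar>x :: real\<bar> < 2"
    have "(deriv ^^ k) (\<lambda>x. q x ^ n) x = (deriv ^^ k) (\<lambda>x. x ^ n) x"
    proof (rule higher_deriv_cong_open[where U = "{-2<..<2}"])
      show "x \<in> {-2<..<2}" using x by (auto simp: abs_less_iff)
      show "q y ^ n = y ^ n" if "y \<in> {-2<..<2}" for y
      proof -
        have "q y = y" by (rule q(2)) (use that in \<open>simp, linarith\<close>)
        then show ?thesis by simp
      qed
    qed simp
    then show "\<bar>(deriv ^^ k) (\<lambda>x. q x ^ n) x\<bar> \<le> fact N * 4 ^ n"
      using higher_deriv_monomial_bound[of x k N n] k x by simp
  qed
  define M where "M = Abs_fps (\<lambda>n. m n / fact n)"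
  have M_bound: "norm (fps_nth M n) \<le> (C * fact N) * 4 ^ n / fact n" for n
    using m_bound[of n] by (simp add: M_def norm_divide divide_right_mono mult.assoc)
  define P where "P = (\<Sum>n\<le>D. monom (g n / fact n) n)"
  have coeff_P: "coeff P n = g n / fact n" for n
  proof (cases "n \<le> D")
    case True then show ?thesis by (simp add: P_def coeff_sum)
  next
    case False then show ?thesis using D[of n] by (simp add: P_def coeff_sum)
  qed
  \<comment> \<open>After division by factorials the binomial convolution of the moments becomes a
    Cauchy product, so \<open>P\<close> is the exponential moment series of the autocorrelation,
    finite because \<open>g\<close> vanishes beyond \<open>D\<close>.\<close>
  have "fps_nth (M * Abs_fps (\<lambda>n. (- 1) ^ n * fps_nth M n)) n = g n / fact n" for n
  proof -
    have "fps_nth (M * Abs_fps (\<lambda>n. (- 1) ^ n * fps_nth M n)) n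
      = (\<Sum>k\<le>n. m k / fact k * ((- 1) ^ (n - k) * (m (n - k) / fact (n - k))))"
      by (simp add: fps_mult_nth atMost_atLeast0 M_def)
    also have "\<dots> = (\<Sum>k\<le>n. of_nat (n choose k) * (- 1) ^ (n - k) * m k * m (n - k) / fact n)"
      by (intro sum.cong refl) (simp add: binomial_fact)
    finally show ?thesis by (simp add: g sum_divide_distrib)
  qed
  then have prod: "M * Abs_fps (\<lambda>n. (- 1) ^ n * fps_nth M n) = fps_of_poly P"
    by (simp add: fps_eq_iff coeff_P)
  have rad: "fps_conv_radius M = \<infinity>"
    by (rule fps_exponential_type_even_product_poly(1)[OF M_bound _ prod]) simp
  obtain Q c where Q: "M = fps_of_poly Q * fps_exp c"
    using fps_exponential_type_even_product_poly(2)[OF M_bound _ prod] by auto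
  have "\<exists>p. M = fps_of_poly Q * fps_exp (of_real p)"
  proof (cases "Q = 0")
    \<comment> \<open>Growth determines \<open>c\<close> only when \<open>Q\<close> is nonzero;
      otherwise \<open>M = 0\<close> and any real exponent will do.\<close>
    case False
    have "norm (eval_fps M (\<i> * of_int j)) \<le> 2 * C * (1 + \<bar>real_of_int j\<bar>) ^ N" for j
    proof (rule moments_at_imaginary_integers[OF approx])
      have "summable (\<lambda>n. fps_nth M n * (\<i> * of_int j) ^ n)"
        by (rule summable_fps) (simp add: rad)
      then show "(\<lambda>n. m n / fact n * (\<i> * of_int j) ^ n) sums eval_fps M (\<i> * of_int j)"
        unfolding eval_fps_def by (simp add: M_def summable_sums)
    qed
    then have "Im c = 0" by (rule exponent_is_real[OF rad Q False])
    then have "c = of_real (Re c)" by (simp add: complex_eq_iff)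
    then show ?thesis using Q by metis
  qed (use Q in simp)
  then obtain p where p: "M = fps_of_poly Q * fps_exp (of_real p)" by blast
  define L where "L = (\<lambda>\<phi>. \<Sum>i\<le>degree Q. coeff Q i * of_real ((deriv ^^ i) \<phi> p))"
  have L_monomial: "L (\<lambda>x. x ^ n) = m n" for n
    using point_functional_monomial[of Q n p] by (simp add: L_def flip: p) (simp add: M_def)
  have L_poly: "L (\<lambda>x. \<Sum>i\<le>n. a i * x ^ i) = (\<Sum>i\<le>n. of_real (a i) * m i)" for a and n :: nat
  proof -
    have "L (\<lambda>x. \<Sum>i\<le>n. a i * x ^ i) = (\<Sum>l\<le>degree Q. \<Sum>i\<le>n. of_real (a i) * (coeff Q l * of_real ((deriv ^^ l) (\<lambda>x. x ^ i) p)))"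
      by (simp add: L_def higher_deriv_sum smooth_power smooth_ident sum_distrib_left mult_ac)
    also have "\<dots> = (\<Sum>i\<le>n. of_real (a i) * L (\<lambda>x. x ^ i))"
      by (subst sum.swap) (simp add: L_def sum_distrib_left)
    finally show ?thesis by (simp add: L_monomial)
  qed
  define K where "K = (\<Sum>i\<le>degree Q. norm (coeff Q i))"
  have \<mu>_eq_L: "\<mu> \<phi> = L \<phi>" if \<phi>: "test_fun \<phi>" for \<phi>
  proof -
    have le: "norm (\<mu> \<phi> - L \<phi>) \<le> (C + K) * e" if e: "e > 0" for e
    proof -
      \<comment> \<open>The point \<open>p\<close> is not known to lie in the window, so the
        interval of approximation is widened to contain it, and the order is raised to cover the
        derivatives in \<open>L\<close>.\<close>
      obtain a n where an: "\<And>k x. k \<le> max N (degree Q) \<Longrightarrow> \<bar>x\<bar> \<le> 2 + \<bar>p\<bar> \<Longrightarrow>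
         \<bar>(deriv ^^ k) \<phi> x - (deriv ^^ k) (\<lambda>x. \<Sum>i\<le>n. a i * x ^ i) x\<bar> \<le> e"
        using smooth_polynomial_approximation[OF test_fun_smooth[OF \<phi>] e, of "2 + \<bar>p\<bar>" "max N (degree Q)"] by auto
      let ?p = "\<lambda>x. \<Sum>i\<le>n. a i * x ^ i"
      have "norm (\<mu> \<phi> - (\<Sum>i\<le>n. of_real (a i) * m i)) \<le> C * e"
        by (rule approx[OF \<phi>]) (use an in auto)
      moreover have "norm (L \<phi> - L ?p) \<le> K * e"
      proof -
        have "L \<phi> - L ?p = (\<Sum>i\<le>degree Q. coeff Q i * of_real ((deriv ^^ i) \<phi> p - (deriv ^^ i) ?p p))"
          by (simp add: L_def sum_subtractf right_diff_distrib)
        also have "norm \<dots> \<le> (\<Sum>i\<le>degree Q. norm (coeff Q i) * e)"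
        proof (rule sum_norm_le)
          fix i assume "i \<in> {..degree Q}"
          then have "\<bar>(deriv ^^ i) \<phi> p - (deriv ^^ i) ?p p\<bar> \<le> e" by (intro an) auto
          then show "norm (coeff Q i * of_real ((deriv ^^ i) \<phi> p - (deriv ^^ i) ?p p)) \<le> norm (coeff Q i) * e"
            unfolding norm_mult norm_of_real by (intro mult_left_mono) auto
        qed
        finally show ?thesis by (simp add: K_def sum_distrib_right)
      qed
      ultimately show ?thesis
        using norm_triangle_ineq4[of "\<mu> \<phi> - L ?p" "L \<phi> - L ?p"] by (simp add: L_poly algebra_simps)
    qed
    have "C + K \<ge> 0" using C(1) by (simp add: K_def sum_nonneg)
    have "norm (\<mu> \<phi> - L \<phi>) \<le> 0 + e" if "e > 0" for e
    proof -
      have "norm (\<mu> \<phi> - L \<phi>) \<le> (C + K) * (e / (C + K + 1))"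
        using \<open>C + K \<ge> 0\<close> \<open>e > 0\<close> by (intro le) auto
      also have "\<dots> \<le> e" using \<open>C + K \<ge> 0\<close> \<open>e > 0\<close> by (simp add: field_simps)
      finally show ?thesis by simp
    qed
    then have "norm (\<mu> \<phi> - L \<phi>) \<le> 0" by (rule field_le_epsilon)
    then show ?thesis by simp
  qed
  show ?thesis
    unfolding vanishes_off_def
  proof (intro exI[of _ p] allI impI)
    fix e :: real and \<phi> assume e: "e > 0" and \<phi>: "test_fun \<phi>" and 0: "\<forall>x\<in>per {p - e<..<p + e}. \<phi> x = 0"
    have "(deriv ^^ i) \<phi> p = (deriv ^^ i) (\<lambda>x. 0) p" for i
    proof (rule higher_deriv_cong_open[where U = "{p - e<..<p + e}"])
      show "\<phi> x = 0" if "x \<in> {p - e<..<p + e}" for x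
        by (rule 0[rule_format]) (use that in \<open>auto simp: per_def intro!: exI[of _ 0]\<close>)
    qed (use e in auto)
    then show "\<mu> \<phi> = 0" by (simp add: \<mu>_eq_L[OF \<phi>] L_def higher_deriv_zero)
  qed
qed

section \<open>Splitting into periodic and antiperiodic parts\<close>

lemma open_per: "open A \<Longrightarrow> open (per A)"
proof -
  assume "open A"
  have "per A = (\<Union>k::int. (\<lambda>t. t + 2 * pi * of_int k) -` A)" by (auto simp: per_def)
  moreover have "open ((\<lambda>t. t + 2 * pi * of_int k) -` A)" for k :: int
    using \<open>open A\<close> by (intro open_vimage continuous_intros)
  ultimately show ?thesis by auto
qed

lemma per_mono: "A \<subseteq> B \<Longrightarrow> per A \<subseteq> per B"
  unfolding per_def by blast

lemma per_shift: "x + 2 * pi * of_int k \<in> per A \<longleftrightarrow> x \<in> per A"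
proof -
  have *: "x + 2 * pi * of_int k \<in> per A" if x: "x \<in> per A" for x and k :: int
  proof -
    obtain l :: int where "x + 2 * pi * of_int l \<in> A" using x unfolding per_def by blast
    then have "x + 2 * pi * of_int k + 2 * pi * of_int (l - k) \<in> A" by (simp add: algebra_simps)
    then show ?thesis unfolding per_def by blast
  qed
  show ?thesis using *[of x k] *[of "x + 2 * pi * of_int k" "- k"] by auto
qed

lemma vanishes_off_mono: "vanishes_off T U \<Longrightarrow> U \<subseteq> V \<Longrightarrow> vanishes_off T V"
  unfolding vanishes_off_def by blast

lemma dsupp_subset_interval:
  assumes off: "\<And>e. e > 0 \<Longrightarrow> vanishes_off T (per {p - e<..<q + e})" and "p \<le> q"
  shows "dsupp T \<subseteq> per {p..q}"
proof
  fix x assume x: "x \<in> dsupp T"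
  show "x \<in> per {p..q}"
  proof (rule ccontr)
    assume nx: "x \<notin> per {p..q}"
    obtain k0 :: int where k0: "p \<le> x + 2 * pi * of_int k0" "x + 2 * pi * of_int k0 < p + 2 * pi"
      using ex_period_shift by blast
    define y where "y = x + 2 * pi * of_int k0"
    have "y \<notin> {p..q}" using nx unfolding per_def y_def by blast
    then have y: "q < y" "y < p + 2 * pi" using k0 by (auto simp: y_def)
    \<comment> \<open>The representative \<open>y\<close> lies strictly between \<open>q\<close> and
      \<open>p + 2 * pi\<close>. Half the distance to the nearer end keeps the
      \<open>e\<close>-neighbourhoods of \<open>y\<close> and of the interval disjoint modulo the
      period.\<close>
    define e where "e = min (y - q) (p + 2 * pi - y) / 2"
    have e: "e > 0" "q + 2 * e \<le> y" "y - 2 * pi \<le> p - 2 * e"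
      using y by (auto simp: e_def min_def field_simps)
    obtain \<phi> where \<phi>: "test_fun \<phi>" "T \<phi> \<noteq> 0"
      "\<And>t. \<phi> t \<noteq> 0 \<Longrightarrow> \<exists>k::int. \<bar>t - x - 2 * pi * of_int k\<bar> < e"
      using x e(1) unfolding dsupp_def by blast
    have "T \<phi> = 0"
    proof (rule vanishes_offD[OF off[OF e(1)] \<phi>(1)])
      fix t assume "t \<in> per {p - e<..<q + e}"
      then obtain l :: int where l: "p - e < t + 2 * pi * of_int l" "t + 2 * pi * of_int l < q + e"
        by (auto simp: per_def)
      show "\<phi> t = 0"
      proof (rule ccontr)
        assume "\<phi> t \<noteq> 0"
        then obtain k :: int where k: "\<bar>t - x - 2 * pi * of_int k\<bar> < e" using \<phi>(3) by blast
        define j where "j = k + l - k0"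
        have j: "y + 2 * pi * of_int j = x + 2 * pi * of_int k + 2 * pi * of_int l"
          by (simp add: j_def y_def algebra_simps)
        have b: "p - 2 * e < y + 2 * pi * of_int j" "y + 2 * pi * of_int j < q + 2 * e"
          unfolding j using k l by linarith+
        show False
        proof (cases "j \<ge> 0")
          case True
          then have "0 \<le> 2 * pi * real_of_int j" by simp
          then show ?thesis using b e by linarith
        next
          case False
          then have "real_of_int j \<le> - 1" by linarith
          then have "2 * pi * real_of_int j \<le> 2 * pi * (- 1)" by (intro mult_left_mono) auto
          then show ?thesis using b e by linarith
        qed
      qed
    qed
    then show False using \<phi>(2) by simp
  qed
qed

text \<open>Some multiple of the period moves \<open>p\<close> into the interval, unless
  \<open>S\<close> is empty, in which case any point of the interval serves.\<close>

lemma point_in_interval: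
  assumes "S \<subseteq> per {p}" "S \<subseteq> per {a..b}" "a \<le> b"
  shows "\<exists>r\<in>{a..b}. S \<subseteq> per {r}"
proof (cases "p \<in> per {a..b}")
  case True
  then obtain k :: int where k: "p + 2 * pi * of_int k \<in> {a..b}" by (auto simp: per_def)
  have "per {p} \<subseteq> per {p + 2 * pi * of_int k}"
  proof
    fix x assume "x \<in> per {p}"
    then obtain l :: int where "x + 2 * pi * of_int l = p" by (auto simp: per_def)
    then have "x + 2 * pi * of_int (l + k) \<in> {p + 2 * pi * of_int k}" by (simp add: algebra_simps)
    then show "x \<in> per {p + 2 * pi * of_int k}" unfolding per_def by blast
  qed
  then show ?thesis using assms(1) k by blast
next
  case False
  have "S = {}"
  proof (rule ccontr)
    assume "S \<noteq> {}"
    then obtain x where x: "x \<in> per {p}" "x \<in> per {a..b}" using assms by blast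
    then obtain l :: int where "p = x + 2 * pi * of_int l" by (auto simp: per_def)
    then show False using False x(2) per_shift by blast
  qed
  then show ?thesis using assms(3) by auto
qed

section \<open>Autocorrelations under the half-period shift\<close>

text \<open>On the torus the shift by \<open>pi\<close> is its own inverse and therefore commutes
  with reflection. With \<open>T\<close> equal to \<open>\<alpha>\<close> times \<open>S\<close>
  plus \<open>\<sigma>\<close> times its shift, the autocorrelation is multiplied by the square of
  that operator, which collapses because \<open>\<sigma> * \<sigma> = 1\<close>. The lemma is
  applied both to pass from \<open>f\<close> to its half and to pass from the cut-off piece to the
  same half.\<close>

lemma dconv_dreflect_shifted_pair:
  assumes S: "distribution S" and T: "distribution T" and \<sigma>: "\<sigma> * \<sigma> = 1" and \<theta>: "test_fun \<theta>"
    and T_eq: "\<And>\<phi>. test_fun \<phi> \<Longrightarrow> T \<phi> = \<alpha> * S \<phi> + \<alpha> * \<sigma> * S (\<lambda>x. \<phi> (x + pi))"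
  shows "dconv T (dreflect T) \<theta> =
    2 * \<alpha>\<^sup>2 * (dconv S (dreflect S) \<theta> + \<sigma> * dconv S (dreflect S) (\<lambda>x. \<theta> (x + pi)))"
proof -
  define h where "h = (\<lambda>x. S (\<lambda>y. \<theta> (x - y)))"
  have h: "complex_test_fun h" unfolding h_def by (rule complex_test_fun_translate_reflect[OF S \<theta>])
  have h': "complex_test_fun (\<lambda>x. h (x + pi))" by (rule complex_test_fun_shift[OF h])
  have per: "\<theta> (x + 2 * pi) = \<theta> x" for x using \<theta> by (simp add: test_fun_iff)
  have h_per: "h (x + pi + pi) = h x" for x
    unfolding h_def using per[of "x - _"] by (simp add: algebra_simps)
  have inner: "T (\<lambda>y. \<theta> (x - y)) = \<alpha> * h x + \<alpha> * \<sigma> * h (x + pi)" for x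
  proof -
    have "\<theta> (x - (y + pi)) = \<theta> (x + pi - y)" for y
      using per[of "x - (y + pi)"] by (simp add: algebra_simps)
    then show ?thesis using T_eq[OF test_fun_reflect[OF \<theta>, of x]] by (simp add: h_def)
  qed
  have ext: "complex_ext T k = \<alpha> * complex_ext S k + \<alpha> * \<sigma> * complex_ext S (\<lambda>x. k (x + pi))"
    if "complex_test_fun k" for k
    using that T_eq by (simp add: complex_ext_def complex_test_fun_def algebra_simps)
  have "dconv T (dreflect T) \<theta> = complex_ext T (\<lambda>x. \<alpha> * h x + \<alpha> * \<sigma> * h (x + pi))"
    by (simp add: dconv_dreflect_eq inner)
  also have "\<dots> = \<alpha> * complex_ext S (\<lambda>x. \<alpha> * h x + \<alpha> * \<sigma> * h (x + pi)) +
      \<alpha> * \<sigma> * complex_ext S (\<lambda>x. \<alpha> * h (x + pi) + \<alpha> * \<sigma> * h x)"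
    using ext[OF complex_test_fun_add[OF complex_test_fun_cmult[OF h, of \<alpha>] complex_test_fun_cmult[OF h', of "\<alpha> * \<sigma>"]]]
    unfolding h_per .
  also have "\<dots> = \<alpha> * (\<alpha> * complex_ext S h + \<alpha> * \<sigma> * complex_ext S (\<lambda>x. h (x + pi))) +
      \<alpha> * \<sigma> * (\<alpha> * complex_ext S (\<lambda>x. h (x + pi)) + \<alpha> * \<sigma> * complex_ext S h)"
    by (simp add: complex_ext_add[OF S] complex_ext_cmult[OF S] complex_test_fun_cmult h h')
  also have "\<dots> = \<alpha>\<^sup>2 * (1 + \<sigma> * \<sigma>) * complex_ext S h + 2 * \<alpha>\<^sup>2 * \<sigma> * complex_ext S (\<lambda>x. h (x + pi))"
    by (simp add: algebra_simps power2_eq_square)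
  also have "complex_ext S h = dconv S (dreflect S) \<theta>"
    by (simp add: dconv_dreflect_eq h_def)
  also have "complex_ext S (\<lambda>x. h (x + pi)) = dconv S (dreflect S) (\<lambda>x. \<theta> (x + pi))"
    by (simp add: dconv_dreflect_eq h_def algebra_simps)
  finally show ?thesis using \<sigma> by (simp add: algebra_simps)
qed

text \<open>An autocorrelation sees its test function only at differences of points of
  \<open>U\<close>.\<close>

lemma dconv_dreflect_cong:
  assumes S: "distribution S" "vanishes_off S U" and "test_fun \<phi>" "test_fun \<psi>"
    and eq: "\<And>x y. x \<in> U \<Longrightarrow> y \<in> U \<Longrightarrow> \<phi> (x - y) = \<psi> (x - y)"
  shows "dconv S (dreflect S) \<phi> = dconv S (dreflect S) \<psi>"
  unfolding dconv_dreflect_eq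
proof (rule complex_ext_cong[OF S])
  show "S (\<lambda>y. \<phi> (x - y)) = S (\<lambda>y. \<psi> (x - y))" if "x \<in> U" for x
    by (rule vanishes_off_eq[OF S]) (use assms(3,4) eq that in \<open>auto intro: test_fun_reflect\<close>)
qed (use assms complex_test_fun_translate_reflect in auto)

text \<open>The periodic half is the case \<open>\<sigma> = 1\<close>, the antiperiodic half
  \<open>\<sigma> = - 1\<close>; the argument uses only that \<open>\<sigma>\<close> squares to
  \<open>1\<close>.\<close>

lemma half_piece_exists:
  fixes f :: "(real \<Rightarrow> real) \<Rightarrow> complex" and a b :: real
  assumes f: "distribution f"
    and ab: "a \<le> b" "- (pi / 2) < a" "b < pi / 2" "b - a < pi / 2"
    and supp: "dsupp f \<subseteq> R2 a b"
    and conv: "dsupp (dconv f (dreflect f)) \<subseteq> per {0, pi}"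
    and \<sigma>: "\<sigma> * \<sigma> = 1"
  shows "\<exists>\<mu> p. distribution \<mu> \<and> p \<in> {a..b} \<and> dsupp \<mu> \<subseteq> per {p} \<and>
    (\<forall>\<phi>. test_fun \<phi> \<longrightarrow> f \<phi> / 2 + \<sigma> * f (\<lambda>x. \<phi> (x + pi)) / 2 = \<mu> \<phi> + \<sigma> * \<mu> (\<lambda>x. \<phi> (x + pi)))"
proof -
  have pi: "3 < pi" "pi < 3.2" using pi_gt3 pi_approx by auto
  \<comment> \<open>The cap \<open>1 / 10\<close> keeps the enlarged interval inside
    \<open>(-2, 2)\<close>, since \<open>pi / 2 < 1.6\<close>. A quarter of the slack in
    \<open>b - a < pi / 2\<close> leaves differences within the enlarged interval below
    \<open>pi / 2\<close>.\<close>
  define \<delta> where "\<delta> = min (1 / 10) ((pi / 2 - (b - a)) / 4)"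
  have \<delta>: "0 < \<delta>" "\<delta> \<le> 1 / 10" "b - a + 2 * \<delta> < pi / 2"
    using ab by (auto simp: \<delta>_def min_def field_simps)
  have eta_range: "a - 2 * \<delta> < a - \<delta>" "a - \<delta> \<le> b + \<delta>" "b + \<delta> < b + 2 * \<delta>" "b + 2 * \<delta> \<le> a - 2 * \<delta> + 2 * pi"
    using \<delta> ab pi by linarith+
  obtain \<eta> where \<eta>: "test_fun \<eta>" and \<eta>1: "\<And>x. a - \<delta> \<le> x \<Longrightarrow> x \<le> b + \<delta> \<Longrightarrow> \<eta> x = 1"
    and \<eta>0: "\<And>x. b + 2 * \<delta> \<le> x \<Longrightarrow> x \<le> a - 2 * \<delta> + 2 * pi \<Longrightarrow> \<eta> x = 0"
    using cutoff_exists[OF eta_range] by metis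
  define I where "I = (\<lambda>e. per {a - e<..<b + e})"
  have I_mono: "I e \<subseteq> I \<delta>" if "e \<le> \<delta>" for e
    using that unfolding I_def by (intro per_mono) auto
  have \<eta>I: "\<eta> x = 1" "\<eta> (x + pi) = 0" if "x \<in> I \<delta>" for x
  proof -
    obtain k :: int where k: "a - \<delta> < x + 2 * pi * of_int k" "x + 2 * pi * of_int k < b + \<delta>"
      using \<open>x \<in> I \<delta>\<close> by (auto simp: I_def per_def)
    show "\<eta> x = 1" using \<eta>1[of "x + 2 * pi * of_int k"] k test_fun_periodic[OF \<eta>, of x k] by simp
    have "\<eta> (x + pi + 2 * pi * of_int k) = 0" by (rule \<eta>0) (use k \<delta> ab pi in linarith)+
    then show "\<eta> (x + pi) = 0" using test_fun_periodic[OF \<eta>, of "x + pi" k] by simp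
  qed
  have per_pi: "\<phi> (x + pi + pi) = \<phi> x" if "test_fun \<phi>" for \<phi> x
    using that by (simp add: test_fun_iff add.assoc flip: mult_2)
  have \<eta>I': "\<eta> x = 0" "\<eta> (x + pi) = 1" if "x + pi \<in> I \<delta>" for x
    using \<eta>I[OF that] per_pi[OF \<eta>, of x] by auto
  have off_f: "vanishes_off f {x. x \<in> I e \<or> x + pi \<in> I e}" if e: "e > 0" for e
  proof (rule vanishes_off_neighbourhood[OF f])
    have "open (I e)" unfolding I_def by (intro open_per) auto
    moreover have "{x. x \<in> I e \<or> x + pi \<in> I e} = I e \<union> (\<lambda>x. x + pi) -` I e" by auto
    ultimately show "open {x. x \<in> I e \<or> x + pi \<in> I e}"
      by (auto intro!: open_Un open_vimage continuous_intros)
    show "dsupp f \<subseteq> {x. x \<in> I e \<or> x + pi \<in> I e}"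
    proof
      fix x assume "x \<in> dsupp f"
      then obtain k :: int where "x + 2 * pi * of_int k \<in> {a..b} \<or> x + 2 * pi * of_int k \<in> {a + pi..b + pi}"
        using supp by (auto simp: R2_def per_def)
      then have "x + 2 * pi * of_int k \<in> {a - e<..<b + e} \<or> x + pi + 2 * pi * of_int (k - 1) \<in> {a - e<..<b + e}"
        using e by (auto simp: algebra_simps)
      then show "x \<in> {x. x \<in> I e \<or> x + pi \<in> I e}" unfolding I_def per_def by blast
    qed
  qed
  \<comment> \<open>This is the half of \<open>f\<close> belonging to \<open>\<sigma>\<close>,
    multiplied by the cutoff \<open>\<eta>\<close>.\<close>
  define \<mu> where "\<mu> = (\<lambda>\<phi>. 1 / 2 * f (\<lambda>x. \<eta> x * \<phi> x) + \<sigma> / 2 * dshift pi f (\<lambda>x. \<eta> x * \<phi> x))"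
  have \<mu>: "distribution \<mu>"
    unfolding \<mu>_def by (intro distribution_lincomb distribution_mult distribution_dshift f \<eta>)
  have \<mu>_eq: "\<mu> \<phi> = f (\<lambda>x. \<eta> x * \<phi> x) / 2 + \<sigma> * f (\<lambda>x. \<eta> (x + pi) * \<phi> (x + pi)) / 2" for \<phi>
    by (simp add: \<mu>_def dshift_def)
  \<comment> \<open>Near the support of \<open>f\<close> the cutoff and its translate by
    \<open>pi\<close> add up to \<open>1\<close>: on each of the two arcs one of them is
    \<open>1\<close> and the other \<open>0\<close>.\<close>
  have split: "f \<phi> = f (\<lambda>x. \<eta> x * \<phi> x) + f (\<lambda>x. \<eta> (x + pi) * \<phi> x)" if \<phi>: "test_fun \<phi>" for \<phi>
  proof -
    have t: "test_fun (\<lambda>x. \<eta> x * \<phi> x)" "test_fun (\<lambda>x. \<eta> (x + pi) * \<phi> x)"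
      by (intro test_fun_mult test_fun_shift \<eta> \<phi>)+
    have "f \<phi> = f (\<lambda>x. \<eta> x * \<phi> x + \<eta> (x + pi) * \<phi> x)"
      by (rule vanishes_off_eq[OF f off_f[OF \<delta>(1)] \<phi> test_fun_add[OF t]]) (auto simp: \<eta>I \<eta>I')
    then show ?thesis using distribution_add[OF f t] by simp
  qed
  have decomp: "f \<phi> / 2 + \<sigma> * f (\<lambda>x. \<phi> (x + pi)) / 2 = \<mu> \<phi> + \<sigma> * \<mu> (\<lambda>x. \<phi> (x + pi))"
    if \<phi>: "test_fun \<phi>" for \<phi>
  proof -
    have "\<mu> \<phi> + \<sigma> * \<mu> (\<lambda>x. \<phi> (x + pi)) =
       (f (\<lambda>x. \<eta> x * \<phi> x) + (\<sigma> * \<sigma>) * f (\<lambda>x. \<eta> (x + pi) * \<phi> x)) / 2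
      + \<sigma> * (f (\<lambda>x. \<eta> x * \<phi> (x + pi)) + f (\<lambda>x. \<eta> (x + pi) * \<phi> (x + pi))) / 2"
      unfolding \<mu>_eq per_pi[OF \<phi>] by (simp add: add_divide_distrib distrib_left mult.assoc)
    then show ?thesis using split[OF \<phi>] split[OF test_fun_shift[OF \<phi>, of pi]] \<sigma> by simp
  qed
  have off_\<mu>: "vanishes_off \<mu> (I e)" if e: "0 < e" for e
  proof -
    define e' where "e' = min e \<delta>"
    have e': "0 < e'" "e' \<le> \<delta>" "e' \<le> e" using e \<delta> by (auto simp: e'_def)
    have "vanishes_off \<mu> (I e')"
      unfolding vanishes_off_def
    proof (intro allI impI)
      fix \<phi> assume \<phi>: "test_fun \<phi>" and 0: "\<forall>x\<in>I e'. \<phi> x = 0"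
      have t: "test_fun (\<lambda>x. \<eta> x * \<phi> x)" by (intro test_fun_mult \<eta> \<phi>)
      have "f (\<lambda>x. \<eta> x * \<phi> x) = 0"
        by (rule vanishes_offD[OF off_f[OF e'(1)] t]) (use 0 \<eta>I' I_mono[OF e'(2)] in auto)
      moreover have "f (\<lambda>x. \<eta> (x + pi) * \<phi> (x + pi)) = 0"
        by (rule vanishes_offD[OF off_f[OF e'(1)] test_fun_shift[OF t]]) (use 0 \<eta>I I_mono[OF e'(2)] in auto)
      ultimately show "\<mu> \<phi> = 0" by (simp add: \<mu>_eq)
    qed
    moreover have "I e' \<subseteq> I e" using e'(3) unfolding I_def by (intro per_mono) auto
    ultimately show ?thesis by (rule vanishes_off_mono)
  qed
  have dsupp_ab: "dsupp \<mu> \<subseteq> per {a..b}"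
    by (rule dsupp_subset_interval[OF _ ab(1)]) (use off_\<mu> in \<open>simp add: I_def\<close>)
  \<comment> \<open>Differences of points of the enlarged interval lie in \<open>(-l, l)\<close>. As
    \<open>l < pi / 2\<close>, this arc is disjoint from its translate by \<open>pi\<close>, so a
    cutoff \<open>\<kappa>\<close> can separate the contributions near \<open>0\<close> and near
    \<open>pi\<close>.\<close>
  define l where "l = b - a + 2 * \<delta>"
  have l: "0 < l" "l < pi / 2" using \<delta> ab by (auto simp: l_def)
  have kappa_range: "- (pi - l) < - l" "- l \<le> l" "l < pi - l" "pi - l \<le> - (pi - l) + 2 * pi" using l by linarith+
  obtain \<kappa> where \<kappa>: "test_fun \<kappa>" and \<kappa>1: "\<And>x. - l \<le> x \<Longrightarrow> x \<le> l \<Longrightarrow> \<kappa> x = 1"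
    and \<kappa>0: "\<And>x. pi - l \<le> x \<Longrightarrow> x \<le> - (pi - l) + 2 * pi \<Longrightarrow> \<kappa> x = 0"
    using cutoff_exists[OF kappa_range] by metis
  have \<kappa>_near: "\<kappa> x = 1" "\<kappa> (x + pi) = 0" if "x \<in> per {-l<..<l}" for x
  proof -
    obtain k :: int where k: "- l < x + 2 * pi * of_int k" "x + 2 * pi * of_int k < l"
      using \<open>x \<in> per {-l<..<l}\<close> by (auto simp: per_def)
    show "\<kappa> x = 1" using \<kappa>1[of "x + 2 * pi * of_int k"] k test_fun_periodic[OF \<kappa>, of x k] by simp
    have "\<kappa> (x + pi + 2 * pi * of_int k) = 0" by (rule \<kappa>0) (use k l in linarith)+
    then show "\<kappa> (x + pi) = 0" using test_fun_periodic[OF \<kappa>, of "x + pi" k] by simp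
  qed
  have \<kappa>_near': "\<kappa> x = 0" if "x + pi \<in> per {-l<..<l}" for x
    using \<kappa>_near(2)[OF that] per_pi[OF \<kappa>, of x] by simp
  have diff_I: "x - y \<in> per {-l<..<l}" if xy: "x \<in> I \<delta>" "y \<in> I \<delta>" for x y
  proof -
    obtain j k :: int where jk: "x + 2 * pi * of_int j \<in> {a - \<delta><..<b + \<delta>}" "y + 2 * pi * of_int k \<in> {a - \<delta><..<b + \<delta>}"
      using xy unfolding I_def per_def by blast
    have "x - y + 2 * pi * of_int (j - k) = (x + 2 * pi * of_int j) - (y + 2 * pi * of_int k)"
      by (simp add: algebra_simps)
    also have "\<dots> \<in> {-l<..<l}" using jk by (simp add: l_def)
    finally show ?thesis unfolding per_def by blast
  qed
  define g where "g = dconv f (dreflect f)"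
  have g: "distribution g" unfolding g_def by (intro distribution_dconv distribution_dreflect f)
  define S where "S = (\<lambda>\<phi>. 1 / 2 * f \<phi> + \<sigma> / 2 * dshift pi f \<phi>)"
  have S: "distribution S" unfolding S_def by (intro distribution_lincomb distribution_dshift f)
  have ac: "dconv \<mu> (dreflect \<mu>) \<phi> = 0"
    if \<phi>: "test_fun \<phi>" and e: "e > 0" and 0: "\<And>x. x \<in> per {-e<..<e} \<Longrightarrow> \<phi> x = 0" for \<phi> e
  proof -
    \<comment> \<open>Multiplication by \<open>\<kappa>\<close> leaves the pairing of
      \<open>\<phi>\<close> with the autocorrelation of \<open>\<mu>\<close> unchanged, but makes
      the pairing of the shifted function vanish.\<close>
    define \<theta> where "\<theta> = (\<lambda>x. \<kappa> x * \<phi> x)"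
    have \<theta>: "test_fun \<theta>" unfolding \<theta>_def by (intro test_fun_mult \<kappa> \<phi>)
    define r where "r = min e l"
    have r: "r > 0" "r \<le> e" "r \<le> l" using e l by (auto simp: r_def)
    have r_sub: "per {-r<..<r} \<subseteq> per {-e<..<e}" "per {-r<..<r} \<subseteq> per {-l<..<l}"
      using r by (auto intro!: per_mono)
    define W where "W = {x. x \<in> per {-r<..<r} \<or> x + pi \<in> per {-r<..<r}}"
    have W: "x \<in> per {-e<..<e} \<and> x \<in> per {-l<..<l} \<or> x + pi \<in> per {-e<..<e} \<and> x + pi \<in> per {-l<..<l}"
      if "x \<in> W" for x
      using that r_sub unfolding W_def by blast
    have off_g: "vanishes_off g W"
    proof (rule vanishes_off_neighbourhood[OF g])
      have "open (per {-r<..<r})" by (intro open_per) auto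
      moreover have "W = per {-r<..<r} \<union> (\<lambda>x. x + pi) -` per {-r<..<r}" by (auto simp: W_def)
      ultimately show "open W" by (auto intro!: open_Un open_vimage continuous_intros)
      show "dsupp g \<subseteq> W"
      proof
        fix x assume "x \<in> dsupp g"
        then obtain k :: int where "x + 2 * pi * of_int k = 0 \<or> x + 2 * pi * of_int k = pi"
          using conv by (auto simp: g_def per_def)
        then have "x + 2 * pi * of_int k \<in> {-r<..<r} \<or> x + pi + 2 * pi * of_int (k - 1) \<in> {-r<..<r}"
          using r by (auto simp: algebra_simps)
        then show "x \<in> W" unfolding W_def per_def by blast
      qed
    qed
    have \<theta>0: "\<theta> x = 0" "\<theta> (x + pi) = 0" if "x \<in> W" for x
      using W[OF that] 0 \<kappa>_near \<kappa>_near' by (auto simp: \<theta>_def)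
    have "g \<theta> = 0" "g (\<lambda>x. \<theta> (x + pi)) = 0"
      using vanishes_offD[OF off_g] \<theta> \<theta>0 test_fun_shift by auto
    \<comment> \<open>The half \<open>S\<close> is expressed in two ways, through \<open>f\<close>
      with \<open>\<alpha> = 1 / 2\<close> and through \<open>\<mu>\<close> with
      \<open>\<alpha> = 1\<close>. The first shows that its autocorrelation kills
      \<open>\<theta>\<close>; the second carries this over to \<open>\<mu>\<close>.\<close>
    then have "dconv S (dreflect S) \<theta> = 0"
      using dconv_dreflect_shifted_pair[OF f S \<sigma> \<theta>, of "1 / 2"] by (simp add: S_def dshift_def g_def)
    moreover have "dconv S (dreflect S) \<theta> =
        2 * (dconv \<mu> (dreflect \<mu>) \<theta> + \<sigma> * dconv \<mu> (dreflect \<mu>) (\<lambda>x. \<theta> (x + pi)))"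
      using dconv_dreflect_shifted_pair[OF \<mu> S \<sigma> \<theta>, of 1] decomp by (simp add: S_def dshift_def)
    moreover have "dconv \<mu> (dreflect \<mu>) \<theta> = dconv \<mu> (dreflect \<mu>) \<phi>"
      by (rule dconv_dreflect_cong[OF \<mu> off_\<mu>[OF \<delta>(1)] \<theta> \<phi>]) (simp add: \<theta>_def \<kappa>_near diff_I)
    moreover have "dconv \<mu> (dreflect \<mu>) (\<lambda>x. \<theta> (x + pi)) = dconv \<mu> (dreflect \<mu>) (\<lambda>x. 0)"
      by (rule dconv_dreflect_cong[OF \<mu> off_\<mu>[OF \<delta>(1)] test_fun_shift[OF \<theta>] test_fun_const])
         (simp add: \<theta>_def \<kappa>_near diff_I)
    moreover have "dconv \<mu> (dreflect \<mu>) (\<lambda>x. 0) = 0"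
      by (rule distribution_zero[OF distribution_dconv[OF \<mu> distribution_dreflect[OF \<mu>]]])
    ultimately show ?thesis by simp
  qed
  have "\<exists>p. \<forall>e>0. vanishes_off \<mu> (per {p - e<..<p + e})"
  proof (rule autocorrelation_point_support[OF \<mu>])
    show "-2 < a - \<delta>" "a - \<delta> < b + \<delta>" "b + \<delta> < 2" "b + \<delta> - (a - \<delta>) < 2"
      using ab \<delta> pi by linarith+
    show "vanishes_off \<mu> (per {a - \<delta><..<b + \<delta>})" using off_\<mu>[OF \<delta>(1)] by (simp add: I_def)
  qed (rule ac)
  then obtain p where "dsupp \<mu> \<subseteq> per {p}" using dsupp_subset_interval[of \<mu> p p for p] by fastforce
  then obtain r where "r \<in> {a..b}" "dsupp \<mu> \<subseteq> per {r}" using point_in_interval[OF _ dsupp_ab ab(1)] by blast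
  then show ?thesis using \<mu> decomp by blast
qed

lemma dsupp_shifted_sum:
  assumes f: "\<And>\<phi>. test_fun \<phi> \<Longrightarrow> f \<phi> = \<mu> \<phi> + \<mu> (\<lambda>x. \<phi> (x + pi)) + \<nu> \<phi> - \<nu> (\<lambda>x. \<phi> (x + pi))"
    and x: "x \<in> dsupp f"
  shows "x \<in> dsupp \<mu> \<or> x + pi \<in> dsupp \<mu> \<or> x \<in> dsupp \<nu> \<or> x + pi \<in> dsupp \<nu>"
proof (rule ccontr)
  define K where "K = (\<lambda>T z e. \<forall>\<phi>. test_fun \<phi> \<longrightarrow>
     (\<forall>t. \<phi> t \<noteq> 0 \<longrightarrow> (\<exists>k::int. \<bar>t - z - 2 * pi * of_int k\<bar> < e)) \<longrightarrow> T \<phi> = (0::complex))"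
  have K: "\<exists>e>0. K T z e" if "z \<notin> dsupp T" for T z
    using that unfolding dsupp_def K_def by blast
  have K_mono: "K T z e'" if "K T z e" "e' \<le> e" for T z e e'
    using that unfolding K_def by (meson less_le_trans)
  assume "\<not> ?thesis"
  then obtain e1 e2 e3 e4 where e: "e1 > 0" "K \<mu> x e1" "e2 > 0" "K \<mu> (x + pi) e2"
    "e3 > 0" "K \<nu> x e3" "e4 > 0" "K \<nu> (x + pi) e4" using K by meson
  define e where "e = min (min e1 e2) (min e3 e4)"
  have e0: "e > 0" using e by (simp add: e_def)
  have Ke: "K \<mu> x e" "K \<mu> (x + pi) e" "K \<nu> x e" "K \<nu> (x + pi) e"
    using K_mono[OF e(2)] K_mono[OF e(4)] K_mono[OF e(6)] K_mono[OF e(8)] by (simp_all add: e_def)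
  obtain \<phi> where \<phi>: "test_fun \<phi>" "f \<phi> \<noteq> 0"
    "\<And>t. \<phi> t \<noteq> 0 \<Longrightarrow> \<exists>k::int. \<bar>t - x - 2 * pi * of_int k\<bar> < e"
    using x e0 unfolding dsupp_def by blast
  have \<phi>': "\<exists>k::int. \<bar>t - (x + pi) - 2 * pi * of_int k\<bar> < e" if nz: "\<phi> (t + pi) \<noteq> 0" for t
  proof -
    obtain k :: int where "\<bar>t + pi - x - 2 * pi * of_int k\<bar> < e" using \<phi>(3)[OF nz] by blast
    then have "\<bar>t - (x + pi) - 2 * pi * of_int (k - 1)\<bar> < e" by (simp add: algebra_simps)
    then show ?thesis by blast
  qed
  have "\<mu> \<phi> = 0" "\<nu> \<phi> = 0" using Ke(1,3) \<phi> unfolding K_def by blast+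
  moreover have "\<mu> (\<lambda>x. \<phi> (x + pi)) = 0" "\<nu> (\<lambda>x. \<phi> (x + pi)) = 0"
    using Ke(2,4) test_fun_shift[OF \<phi>(1)] \<phi>' unfolding K_def by blast+
  ultimately show False using f[OF \<phi>(1)] \<phi>(2) by simp
qed

theorem theorem2:
  fixes f :: "(real \<Rightarrow> real) \<Rightarrow> complex" and a b :: real
  assumes "distribution f"
    and "a \<le> b" and "- (pi / 2) < a" and "b < pi / 2"
    and "b - a < pi / 2"
    and "dsupp f \<subseteq> R2 a b"
    and "\<not> (\<exists>c d. c \<le> d \<and> a \<le> c \<and> d \<le> b \<and> (c, d) \<noteq> (a, b) \<and> dsupp f \<subseteq> R2 c d)"
    and "dsupp (dconv f (dreflect f)) \<subseteq> per {0, pi}"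
  shows "dsupp f \<subseteq> per {a, b, pi + a, pi + b}
    \<and> (\<exists>\<mu> \<nu> p q. distribution \<mu> \<and> distribution \<nu>
         \<and> dsupp \<mu> \<subseteq> per {p} \<and> dsupp \<nu> \<subseteq> per {q}
         \<and> (\<forall>\<phi>. test_fun \<phi> \<longrightarrow>
              f \<phi> = \<mu> \<phi> + dshift pi \<mu> \<phi> + \<nu> \<phi> - dshift pi \<nu> \<phi>))"
proof -
  note piece = half_piece_exists[OF assms(1-6,8)]
  obtain \<mu> p where \<mu>: "distribution \<mu>" "p \<in> {a..b}" "dsupp \<mu> \<subseteq> per {p}"
    and \<mu>_eq: "\<And>\<phi>. test_fun \<phi> \<Longrightarrow> f \<phi> / 2 + 1 * f (\<lambda>x. \<phi> (x + pi)) / 2 = \<mu> \<phi> + 1 * \<mu> (\<lambda>x. \<phi> (x + pi))"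
    using piece[of 1] by auto
  obtain \<nu> q where \<nu>: "distribution \<nu>" "q \<in> {a..b}" "dsupp \<nu> \<subseteq> per {q}"
    and \<nu>_eq: "\<And>\<phi>. test_fun \<phi> \<Longrightarrow> f \<phi> / 2 + (- 1) * f (\<lambda>x. \<phi> (x + pi)) / 2 = \<nu> \<phi> + (- 1) * \<nu> (\<lambda>x. \<phi> (x + pi))"
    using piece[of "- 1"] by auto
  have f_eq: "f \<phi> = \<mu> \<phi> + \<mu> (\<lambda>x. \<phi> (x + pi)) + \<nu> \<phi> - \<nu> (\<lambda>x. \<phi> (x + pi))" if "test_fun \<phi>" for \<phi>
  proof -
    have "f \<phi> = (f \<phi> / 2 + 1 * f (\<lambda>x. \<phi> (x + pi)) / 2) + (f \<phi> / 2 + (- 1) * f (\<lambda>x. \<phi> (x + pi)) / 2)" by simp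
    then show ?thesis unfolding \<mu>_eq[OF that] \<nu>_eq[OF that] by simp
  qed
  have shift: "x \<in> per {pi + r}" if x: "x + pi \<in> per {r}" for x r
  proof -
    obtain k :: int where "x + pi + 2 * pi * of_int k = r" using x by (auto simp: per_def)
    then have "x + 2 * pi * of_int (k + 1) \<in> {pi + r}" by (simp add: algebra_simps)
    then show ?thesis unfolding per_def by blast
  qed
  have sub: "dsupp f \<subseteq> per {p, q, pi + p, pi + q}"
  proof
    fix x assume "x \<in> dsupp f"
    then have "x \<in> per {p} \<or> x \<in> per {pi + p} \<or> x \<in> per {q} \<or> x \<in> per {pi + q}"
      using dsupp_shifted_sum[of f \<mu> \<nu>, OF f_eq] \<mu>(3) \<nu>(3) shift by blast
    then show "x \<in> per {p, q, pi + p, pi + q}" by (auto simp: per_def)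
  qed
  \<comment> \<open>The interval spanned by \<open>p\<close> and \<open>q\<close> lies in
    \<open>[a, b]\<close> and already carries the support of \<open>f\<close>, so minimality
    identifies its ends with \<open>a\<close> and \<open>b\<close>. This includes the case
    \<open>p = q\<close>, which forces \<open>a = b\<close>.\<close>
  have "per {p, q, pi + p, pi + q} \<subseteq> R2 (min p q) (max p q)"
    unfolding R2_def by (rule per_mono) auto
  then have "dsupp f \<subseteq> R2 (min p q) (max p q)" using sub by blast
  moreover have "min p q \<le> max p q" "a \<le> min p q" "max p q \<le> b" using \<mu>(2) \<nu>(2) by auto
  ultimately have "(min p q, max p q) = (a, b)" using assms(7) by blast
  then have "{p, q, pi + p, pi + q} = {a, b, pi + a, pi + b}" by (auto simp: min_def max_def split: if_splits)
  then have "dsupp f \<subseteq> per {a, b, pi + a, pi + b}" using sub by simp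
  moreover have "\<forall>\<phi>. test_fun \<phi> \<longrightarrow> f \<phi> = \<mu> \<phi> + dshift pi \<mu> \<phi> + \<nu> \<phi> - dshift pi \<nu> \<phi>"
    using f_eq by (simp add: dshift_def)
  ultimately show ?thesis using \<mu> \<nu> by blast
qed

end
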